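(* Let $N'\ge 0$ be an integer, let $\ket{\varphi}=\sum_{n=0}^{N'}c_n\ket{\psi_n}$ with $\sum_n|c_n|^2=1$, and let either $\ket{\varphi'}=\sum_{n=0}^{N'}c'_n\ket{\psi_n}$ with $\sum_n|c'_n|^2=1$, or $\ket{\varphi'}=(2\pi/N)^{1/4}\ket{x_j}$ for some $j$. Define the discrete states $\ket{\varphi^{\rm d}}\propto\sum_{n=0}^{N'}c_n\ket{\psi_n^{\rm d}}$ and, respectively, $\ket{\varphi'^{\rm d}}\propto\sum_{n=0}^{N'}c'_n\ket{\psi_n^{\rm d}}$ or $\ket{\varphi'^{\rm d}}=\ket{j}$ (normalized). Let $t$ be the evolution time and $\epsilon>0$ a precision parameter, and assume $|t|>1$ and $t=O(1)$. Then there exists $N=O(\log(1/\epsilon)+N')$ such that $$\left|\bra{\varphi'^{\rm d}}U^{\rm d}(t)\ket{\varphi^{\rm d}}-\bra{\varphi'}U(t)\ket{\varphi}\right|=O(\epsilon).$$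
   Context: Hermite functions: $\psi_n(x)=(n!\,2^n\sqrt\pi)^{-1/2}e^{-x^2/2}H_n(x)$, $H_n$ the physicists' Hermite polynomial. The continuous quantum harmonic oscillator is $H=\frac12(\hat x^2+\hat p^2)$ on $L^2(\mathbb R)$ with eigenstates $\ket{\psi_n}$ ($\langle x|\psi_n\rangle=\psi_n(x)$), eigenvalues $n+1/2$, and $U(t)=e^{-iHt}$; $\ket{x}$ denotes the (generalized) eigenstate of $\hat x$ with eigenvalue $x$. Discrete QHO: $N\ge2$ even, orthonormal basis $\ket{j}$, $j\in\{-N/2,\dots,N/2-1\}$, $x_j=j\sqrt{2\pi/N}$; $x^{\rm d}=\mathrm{diag}(x_j)$; the centered discrete Fourier transform $F^{\rm d}_{\rm c}$ has entries $[F^{\rm d}_{\rm c}]_{j,k}=N^{-1/2}e^{i2\pi jk/N}$; $p^{\rm d}=(F^{\rm d}_{\rm c})^{-1}x^{\rm d}F^{\rm d}_{\rm c}$; $H^{\rm d}=\frac12((x^{\rm d})^2+(p^{\rm d})^2)$; $U^{\rm d}(t)=e^{-iH^{\rm d}t}$. Discrete Hermite states (unnormalized): $\ket{\psi_n^{\rm d}}=(2\pi/N)^{1/4}\sum_{j=-N/2}^{N/2-1}\psi_n(x_j)\ket{j}$. Order notation is asymptotic. *)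

theory Defs
  imports "HOL-Analysis.Analysis"
begin

fun hermite :: "nat \<Rightarrow> real \<Rightarrow> real" where
  "hermite 0 x = 1"
| "hermite (Suc 0) x = 2 * x"
| "hermite (Suc (Suc n)) x = 2 * x * hermite (Suc n) x - 2 * real (Suc n) * hermite n x"

definition hermite_fun :: "nat \<Rightarrow> real \<Rightarrow> real" where
  "hermite_fun n x = exp (- (x^2) / 2) * hermite n x / sqrt (fact n * 2 ^ n * sqrt pi)"

definition herm_state :: "nat \<Rightarrow> (nat \<Rightarrow> complex) \<Rightarrow> real \<Rightarrow> complex" where
  "herm_state N' c x = (\<Sum>n\<le>N'. c n * complex_of_real (hermite_fun n x))"

text \<open>Wavefunction of U(t) applied to sum_{n<=N'} c_n psi_n, using that psi_n is the
  eigenstate of H with eigenvalue n + 1/2, so U(t) psi_n = exp(-i (n+1/2) t) psi_n.\<close>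
definition evolved_state :: "real \<Rightarrow> nat \<Rightarrow> (nat \<Rightarrow> complex) \<Rightarrow> real \<Rightarrow> complex" where
  "evolved_state t N' c x =
     (\<Sum>n\<le>N'. c n * exp (- \<i> * complex_of_real ((real n + 1/2) * t)) * complex_of_real (hermite_fun n x))"

definition L2_inner :: "(real \<Rightarrow> complex) \<Rightarrow> (real \<Rightarrow> complex) \<Rightarrow> complex" where
  "L2_inner f g = (LINT x|lborel. cnj (f x) * g x)"

text \<open>Index set {-N/2, ..., N/2 - 1}; N x N matrices are functions int => int => complex
  on this index set.\<close>
definition idx :: "nat \<Rightarrow> int set" where
  "idx N = {- (int N div 2) ..< int N div 2}"

definition grid :: "nat \<Rightarrow> int \<Rightarrow> real" where
  "grid N j = real_of_int j * sqrt (2 * pi / real N)"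

definition mmult :: "nat \<Rightarrow> (int \<Rightarrow> int \<Rightarrow> complex) \<Rightarrow> (int \<Rightarrow> int \<Rightarrow> complex) \<Rightarrow> (int \<Rightarrow> int \<Rightarrow> complex)" where
  "mmult N A B = (\<lambda>j k. \<Sum>l\<in>idx N. A j l * B l k)"

definition mid :: "int \<Rightarrow> int \<Rightarrow> complex" where
  "mid = (\<lambda>j k. if j = k then 1 else 0)"

fun mpow :: "nat \<Rightarrow> (int \<Rightarrow> int \<Rightarrow> complex) \<Rightarrow> nat \<Rightarrow> (int \<Rightarrow> int \<Rightarrow> complex)" where
  "mpow N A 0 = mid"
| "mpow N A (Suc m) = mmult N A (mpow N A m)"

definition mexp :: "nat \<Rightarrow> (int \<Rightarrow> int \<Rightarrow> complex) \<Rightarrow> (int \<Rightarrow> int \<Rightarrow> complex)" where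
  "mexp N A = (\<lambda>j k. \<Sum>m. mpow N A m j k / of_nat (fact m))"

definition xd :: "nat \<Rightarrow> int \<Rightarrow> int \<Rightarrow> complex" where
  "xd N = (\<lambda>j k. if j = k then complex_of_real (grid N j) else 0)"

definition Fc :: "nat \<Rightarrow> int \<Rightarrow> int \<Rightarrow> complex" where
  "Fc N = (\<lambda>j k. exp (\<i> * complex_of_real (2 * pi * real_of_int j * real_of_int k / real N))
                   / complex_of_real (sqrt (real N)))"

text \<open>Inverse of the centered DFT (which is unitary, so its inverse is its adjoint).\<close>
definition Fc_inv :: "nat \<Rightarrow> int \<Rightarrow> int \<Rightarrow> complex" where
  "Fc_inv N = (\<lambda>j k. cnj (Fc N k j))"

definition pd :: "nat \<Rightarrow> int \<Rightarrow> int \<Rightarrow> complex" where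
  "pd N = mmult N (Fc_inv N) (mmult N (xd N) (Fc N))"

definition Hd :: "nat \<Rightarrow> int \<Rightarrow> int \<Rightarrow> complex" where
  "Hd N = (\<lambda>j k. (mmult N (xd N) (xd N) j k + mmult N (pd N) (pd N) j k) / 2)"

definition Ud :: "nat \<Rightarrow> real \<Rightarrow> int \<Rightarrow> int \<Rightarrow> complex" where
  "Ud N t = mexp N (\<lambda>j k. - \<i> * complex_of_real t * Hd N j k)"

definition herm_d :: "nat \<Rightarrow> nat \<Rightarrow> int \<Rightarrow> complex" where
  "herm_d N n j = complex_of_real ((2 * pi / real N) powr (1/4) * hermite_fun n (grid N j))"

definition vnorm :: "nat \<Rightarrow> (int \<Rightarrow> complex) \<Rightarrow> real" where
  "vnorm N v = sqrt (\<Sum>j\<in>idx N. (cmod (v j))^2)"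

definition herm_state_d :: "nat \<Rightarrow> nat \<Rightarrow> (nat \<Rightarrow> complex) \<Rightarrow> int \<Rightarrow> complex" where
  "herm_state_d N N' c j =
     (let v = (\<lambda>j. \<Sum>n\<le>N'. c n * herm_d N n j) in v j / complex_of_real (vnorm N v))"

definition basis_d :: "int \<Rightarrow> int \<Rightarrow> complex" where
  "basis_d j0 = (\<lambda>j. if j = j0 then 1 else 0)"

definition amp_d :: "nat \<Rightarrow> real \<Rightarrow> (int \<Rightarrow> complex) \<Rightarrow> (int \<Rightarrow> complex) \<Rightarrow> complex" where
  "amp_d N t v' v = (\<Sum>j\<in>idx N. \<Sum>k\<in>idx N. cnj (v' j) * Ud N t j k * v k)"

end

(* With h = sqrt (2 pi / N), Poisson summation shows that the centered DFT maps the grid samples of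
   psi_n to i^n times themselves, up to tails of psi_n beyond |x| = sqrt (pi N / 2); by
   |psi_n x| <= 4^n exp (-x^2/4) these are at most 4^n exp (-c N).  Combined with the three-term
   recurrence for x psi_n this makes the sampled Hermite functions approximate eigenvectors of H^d with
   eigenvalues n + 1/2.  Symmetry of H^d then gives approximate orthogonality, symmetry of x^d makes
   consecutive norms agree, and Poisson summation for a Gaussian gives the norm for n = 0.  Duhamel's
   principle bounds the deviation of U^d(t) from the diagonal evolution by |t| times the eigenvector
   residual.  All errors are at most poly(N) 64^N' exp (-3N/16), hence O(eps) once N is a large multiple
   of log (1/eps) + N'. *)
theory Submission
  imports Defs "HOL-Probability.Probability"
begin

section \<open>Hermite functions\<close>

text \<open>Poisson summation is needed with explicit constants and finitely many samples. It comes
  from integrating against the Dirichlet kernel, whose antiderivative on a unit cell is the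
  remainder of the Fourier series of the sawtooth; the squared L2 norm of that remainder is computed
  exactly and tends to 0 by the Basel sum. The obstacle to \<open>N\<close> being linear in
  \<open>N'\<close> is growth in the level n. It suffices that every loss is a fixed base to the
  power \<open>N'\<close> times a polynomial in \<open>N\<close>, since
  \<open>exp (- (3 * real N / 16))\<close> absorbs both. The base 64 is 4^3: one factor 4^(N'+3) is
  the sup bound inside the Fourier error, one comes from bounding entries in inner products, one
  from the entries of the unnormalised combination in the position amplitude. Control of level n
  consumes higher levels: the residual at n involves n + 2, and the norm at n, reached by steps of
  one level, uses orthogonality to level n + 1 and hence the residual there. So all estimates run up
  to level \<open>N' + 3\<close>.\<close>

lemma hermite_Suc: "hermite (Suc n) x = 2 * x * hermite n x - 2 * real n * hermite (n - 1) x"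
  by (cases n) auto

lemma has_real_derivative_hermite:
  "(hermite n has_real_derivative 2 * real n * hermite (n - 1) x) (at x)"
proof (induction n x rule: hermite.induct)
  case (1 x)
  have "hermite 0 = (\<lambda>x. 1)" by (simp add: fun_eq_iff)
  then show ?case by simp
next
  case (2 x)
  have "hermite (Suc 0) = (\<lambda>x. 2 * x)" by (simp add: fun_eq_iff)
  moreover have "((\<lambda>x. 2 * x) has_real_derivative 2) (at x)"
    by (auto intro!: derivative_eq_intros)
  ultimately show ?case by simp
next
  case (3 n x)
  have eq: "hermite (Suc (Suc n)) =
      (\<lambda>x. 2 * x * hermite (Suc n) x - 2 * real (Suc n) * hermite n x)"
    by (simp add: fun_eq_iff)
  have "((\<lambda>x. 2 * x * hermite (Suc n) x - 2 * real (Suc n) * hermite n x) has_real_derivative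
      2 * hermite (Suc n) x + 2 * x * (2 * real (Suc n) * hermite n x)
        - 2 * real (Suc n) * (2 * real n * hermite (n - 1) x)) (at x)"
    using 3 by (auto intro!: derivative_eq_intros)
  also have "2 * hermite (Suc n) x + 2 * x * (2 * real (Suc n) * hermite n x)
        - 2 * real (Suc n) * (2 * real n * hermite (n - 1) x)
      = 2 * hermite (Suc n) x + 2 * real (Suc n) * (2 * x * hermite n x - 2 * real n * hermite (n - 1) x)"
    by (simp add: algebra_simps)
  also have "\<dots> = 2 * real (Suc (Suc n)) * hermite (Suc n) x"
    unfolding hermite_Suc[symmetric] by (simp add: algebra_simps)
  finally show ?case unfolding eq by simp
qed

definition hermite_norm :: "nat \<Rightarrow> real" where
  "hermite_norm n = sqrt (fact n * 2 ^ n * sqrt pi)"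

lemma hermite_norm_pos: "hermite_norm n > 0"
  by (simp add: hermite_norm_def)

lemma hermite_norm_Suc: "hermite_norm (Suc n) = sqrt (2 * real (Suc n)) * hermite_norm n"
  unfolding hermite_norm_def real_sqrt_mult[symmetric] by (simp add: algebra_simps)

lemma hermite_fun_altdef: "hermite_fun n x = exp (- (x^2) / 2) * hermite n x / hermite_norm n"
  by (simp add: hermite_fun_def hermite_norm_def)

text \<open>This quotient and the next convert the coefficients n and 1/2 of the polynomial
  recurrences into the symmetric ladder coefficients sqrt (n/2) and sqrt ((n+1)/2) of the normalised
  functions.\<close>

lemma sqrt_half_mult_hermite_norm:
  "sqrt (real n / 2) / hermite_norm (n - 1) = real n / hermite_norm n"
proof (cases n)
  case (Suc k)
  have "sqrt (real (Suc k) / 2) * sqrt (2 * real (Suc k)) = real (Suc k)"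
    unfolding real_sqrt_mult[symmetric] by (simp add: real_sqrt_unique power2_eq_square)
  then show ?thesis using Suc hermite_norm_pos[of k] hermite_norm_pos[of "Suc k"] hermite_norm_Suc[of k]
    by (simp add: field_simps)
qed simp

lemma sqrt_half_div_hermite_norm_Suc:
  "sqrt (real (Suc n) / 2) / hermite_norm (Suc n) = 1 / (2 * hermite_norm n)"
proof -
  have "sqrt (2 * real (Suc n)) = 2 * sqrt (real (Suc n) / 2)"
    by (simp add: real_sqrt_divide real_sqrt_mult field_simps flip: of_nat_Suc)
  then show ?thesis using hermite_norm_pos[of n] by (simp add: hermite_norm_Suc field_simps)
qed

text \<open>Position as the sum of raising and lowering operators. At n = 0 the index
  \<open>n - 1\<close> truncates to 0, but its coefficient is 0; all lowering terms below rely on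
  this convention.\<close>

lemma hermite_fun_mult_x:
  "x * hermite_fun n x = sqrt (real (Suc n) / 2) * hermite_fun (Suc n) x
     + sqrt (real n / 2) * hermite_fun (n - 1) x"
proof -
  have "sqrt (real (Suc n) / 2) * hermite_fun (Suc n) x + sqrt (real n / 2) * hermite_fun (n - 1) x
     = exp (- (x^2) / 2) * (sqrt (real (Suc n) / 2) / hermite_norm (Suc n) * hermite (Suc n) x
        + sqrt (real n / 2) / hermite_norm (n - 1) * hermite (n - 1) x)"
    by (simp add: hermite_fun_altdef algebra_simps)
  also have "\<dots> = x * hermite_fun n x"
    unfolding sqrt_half_mult_hermite_norm sqrt_half_div_hermite_norm_Suc hermite_Suc
    using hermite_norm_pos[of n] by (simp add: hermite_fun_altdef field_simps)
  finally show ?thesis by simp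
qed

text \<open>Same coefficients as in \<open>hermite_fun_mult_x\<close> with one sign changed, so that
  combining the two eliminates either neighbour.\<close>

lemma has_real_derivative_hermite_fun:
  "(hermite_fun n has_real_derivative
     (sqrt (real n / 2) * hermite_fun (n - 1) x - sqrt (real (Suc n) / 2) * hermite_fun (Suc n) x)) (at x)"
proof -
  have "hermite_fun n = (\<lambda>x. exp (- (x^2) / 2) * hermite n x / hermite_norm n)"
    by (simp add: fun_eq_iff hermite_fun_altdef)
  moreover have "((\<lambda>x. exp (- (x^2) / 2) * hermite n x / hermite_norm n) has_real_derivative
      (exp (- (x^2) / 2) * (2 * real n * hermite (n - 1) x) - x * exp (- (x^2) / 2) * hermite n x)
        / hermite_norm n) (at x)"
    using hermite_norm_pos[of n]
    by (auto intro!: derivative_eq_intros has_real_derivative_hermite simp: field_simps)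
  moreover have "(exp (- (x^2) / 2) * (2 * real n * hermite (n - 1) x)
        - x * exp (- (x^2) / 2) * hermite n x) / hermite_norm n
     = 2 * (exp (- (x^2) / 2) * hermite (n - 1) x) * (real n / hermite_norm n) - x * hermite_fun n x"
    by (simp add: hermite_fun_altdef diff_divide_distrib mult_ac)
  moreover have "\<dots> = sqrt (real n / 2) * hermite_fun (n - 1) x
      - sqrt (real (Suc n) / 2) * hermite_fun (Suc n) x"
    unfolding sqrt_half_mult_hermite_norm[symmetric] hermite_fun_mult_x
    by (simp add: hermite_fun_altdef)
  ultimately show ?thesis by simp
qed

lemma continuous_on_hermite_fun [continuous_intros]: "continuous_on S (hermite_fun n)"
  using has_real_derivative_hermite_fun
  by (intro continuous_at_imp_continuous_on ballI) (blast intro: DERIV_isCont)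

lemma hermite_fun_measurable [measurable]: "hermite_fun n \<in> borel_measurable borel"
  by (intro borel_measurable_continuous_onI continuous_intros)

text \<open>The condition \<open>n \<le> M\<^sup>2\<close> lets the leading term \<open>2 x H\<^sub>n\<close> of the recurrence dominate.\<close>

lemma hermite_bound:
  assumes "\<bar>x\<bar> \<le> M" "real n \<le> M\<^sup>2"
  shows "\<bar>hermite n x\<bar> \<le> (3 * M) ^ n"
  using assms
proof (induction n x rule: hermite.induct)
  case (3 n x)
  have M: "M \<ge> 0" "real n \<le> M\<^sup>2" "real (Suc n) \<le> M\<^sup>2" using 3 by linarith+
  have "\<bar>hermite (Suc (Suc n)) x\<bar> \<le> 2 * \<bar>x\<bar> * \<bar>hermite (Suc n) x\<bar> + 2 * real (Suc n) * \<bar>hermite n x\<bar>"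
    using abs_triangle_ineq4[of "2 * x * hermite (Suc n) x" "2 * real (Suc n) * hermite n x"]
    by (simp only: hermite.simps abs_mult) simp
  also have "\<dots> \<le> 2 * M * (3 * M) ^ Suc n + 2 * M\<^sup>2 * (3 * M) ^ n"
    using 3 M by (intro add_mono mult_mono) auto
  also have "\<dots> = 8 * M\<^sup>2 * (3 * M) ^ n" by (simp add: power2_eq_square)
  \<comment> \<open>The base 3 satisfies 2 * 3 + 2 <= 3^2, which is what closes the
    recurrence.\<close>
  also have "\<dots> \<le> 9 * M\<^sup>2 * (3 * M) ^ n" using M by (intro mult_right_mono) auto
  also have "\<dots> = (3 * M) ^ Suc (Suc n)" by (simp add: power2_eq_square)
  finally show ?case .
qed auto

lemma power_div_fact_le_exp: "0 \<le> y \<Longrightarrow> y ^ n / fact n \<le> exp (y::real)"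
proof -
  assume y: "0 \<le> y"
  have "(\<Sum>k\<in>{n}. y ^ k / fact k) \<le> (\<Sum>k. y ^ k / fact k)"
    using summable_exp[of y] y by (intro sum_le_suminf) (auto simp: field_simps)
  then show ?thesis by (simp add: exp_def field_simps)
qed

text \<open>The estimate y^n <= n! exp y replaces the polynomial growth by a factorial, which the
  normalisation cancels, at the price of half the Gaussian exponent. The square of the bound has
  base 18 * exp (1/2) <= 32, and division by 2^n leaves 16 = 4^2.\<close>

lemma hermite_fun_bound: "\<bar>hermite_fun n x\<bar> \<le> 4 ^ n * exp (- (x\<^sup>2) / 4)"
proof -
  define y where "y = (x\<^sup>2 + real n) / 2"
  \<comment> \<open>With this M both hypotheses of \<open>hermite_bound\<close> hold for every x and
    n.\<close>
  define M where "M = sqrt (x\<^sup>2 + real n)"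
  have y: "y \<ge> 0" and M2: "M\<^sup>2 = 2 * y" by (auto simp: y_def M_def)
  have "\<bar>hermite n x\<bar> \<le> (3 * M) ^ n"
    by (intro hermite_bound) (auto simp: M_def intro: real_le_rsqrt)
  then have "\<bar>hermite n x\<bar>\<^sup>2 \<le> ((3 * M) ^ n)\<^sup>2" by (intro power_mono) auto
  also have "\<dots> = 18 ^ n * y ^ n"
  proof -
    have "((3 * M) ^ n)\<^sup>2 = ((3 * M)\<^sup>2) ^ n" by (simp only: power_mult[symmetric] mult.commute)
    also have "(3 * M)\<^sup>2 = 18 * y" by (simp add: power_mult_distrib M2)
    finally show ?thesis by (simp only: power_mult_distrib)
  qed
  also have "\<dots> \<le> 18 ^ n * (fact n * exp y)"
    using power_div_fact_le_exp[OF y, of n] by (intro mult_left_mono) (auto simp: field_simps)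
  also have "\<dots> = fact n * (18 * exp (1/2)) ^ n * exp (x\<^sup>2 / 2)"
  proof -
    have "exp y = exp (x\<^sup>2 / 2) * exp (1/2) ^ n"
      unfolding exp_of_nat_mult[symmetric] exp_add[symmetric] by (simp add: y_def add_divide_distrib)
    then show ?thesis by (simp only: power_mult_distrib mult_ac)
  qed
  also have "\<dots> \<le> fact n * 32 ^ n * exp (x\<^sup>2 / 2)"
  proof -
    have "exp (1/2) \<le> (16/9::real)"
    proof (rule power2_le_imp_le)
      have "exp (1/2) ^ 2 = exp (1::real)" by (simp only: exp_double[symmetric]) simp
      also have "\<dots> \<le> 3" by (rule exp_le)
      finally show "exp (1/2) ^ 2 \<le> (16/9::real)^2" by (simp add: power2_eq_square)
    qed simp
    then have "(18 * exp (1/2::real)) ^ n \<le> 32 ^ n" by (intro power_mono) auto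
    then show ?thesis by (intro mult_right_mono mult_left_mono) auto
  qed
  also have "\<dots> \<le> fact n * 32 ^ n * exp (x\<^sup>2 / 2) * sqrt pi"
    using pi_gt3 by (simp add: real_le_rsqrt)
  also have "\<dots> = (4 ^ n * exp (x\<^sup>2 / 4) * hermite_norm n)\<^sup>2"
  proof -
    have "(exp (x\<^sup>2 / 4))\<^sup>2 = exp (x\<^sup>2 / 2)" by (simp only: exp_double[symmetric]) simp
    moreover have "(hermite_norm n)\<^sup>2 = fact n * 2 ^ n * sqrt pi" by (simp add: hermite_norm_def)
    moreover have "((4::real) ^ n)\<^sup>2 * 2 ^ n = 32 ^ n"
      by (simp only: power2_eq_square power_mult_distrib[symmetric]) simp
    moreover have "fact n * ((4 ^ n)\<^sup>2 * 2 ^ n) * exp (x\<^sup>2 / 2) * sqrt pi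
        = (4 ^ n)\<^sup>2 * exp (x\<^sup>2 / 2) * (fact n * 2 ^ n * sqrt pi)"
      by (simp only: mult_ac)
    ultimately show ?thesis unfolding power_mult_distrib by simp
  qed
  finally have "\<bar>hermite n x\<bar> \<le> 4 ^ n * exp (x\<^sup>2 / 4) * hermite_norm n"
    by (rule power2_le_imp_le) (use hermite_norm_pos[of n] in simp)
  then have "exp (- (x^2) / 2) * \<bar>hermite n x\<bar> \<le> exp (- (x^2) / 2) * (4 ^ n * exp (x\<^sup>2 / 4) * hermite_norm n)"
    by (intro mult_left_mono) auto
  also have "\<dots> = 4 ^ n * exp (- (x\<^sup>2) / 4) * hermite_norm n"
  proof -
    have "exp (- (x^2) / 2) * exp (x\<^sup>2 / 4) = exp (- (x\<^sup>2) / 4)" by (simp flip: exp_add)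
    then show ?thesis by (metis mult.left_commute mult.commute)
  qed
  finally show ?thesis using hermite_norm_pos[of n]
    by (simp add: hermite_fun_altdef abs_mult field_simps)
qed

section \<open>Orthonormality and Fourier transform of the Hermite functions\<close>

text \<open>The envelope of \<open>hermite_fun_bound\<close> with its constant hidden. It is stable
  under sums and bounded factors and yields integrability and decay at infinity, which is all that
  integration by parts asks for.\<close>

definition gauss_bounded :: "(real \<Rightarrow> 'a::real_normed_vector) \<Rightarrow> bool" where
  "gauss_bounded f \<longleftrightarrow> (\<exists>K. \<forall>x. norm (f x) \<le> K * exp (- (x\<^sup>2) / 4))"

lemma gauss_boundedI: "(\<And>x. norm (f x) \<le> K * exp (- (x\<^sup>2) / 4)) \<Longrightarrow> gauss_bounded f"
  by (auto simp: gauss_bounded_def)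

lemma gauss_boundedE:
  assumes "gauss_bounded f"
  obtains K where "K \<ge> 0" "\<And>x. norm (f x) \<le> K * exp (- (x\<^sup>2) / 4)"
proof -
  obtain K where K: "\<And>x. norm (f x) \<le> K * exp (- (x\<^sup>2) / 4)"
    using assms by (auto simp: gauss_bounded_def)
  have "0 \<le> K" using order.trans[OF norm_ge_zero K[of 0]] by simp
  then show ?thesis using K that by blast
qed

lemma gauss_bounded_hermite_fun: "gauss_bounded (hermite_fun n)"
  using hermite_fun_bound by (intro gauss_boundedI[where K = "4 ^ n"]) auto

lemma gauss_bounded_add:
  assumes "gauss_bounded f" "gauss_bounded g"
  shows "gauss_bounded (\<lambda>x. f x + g x)"
proof -
  obtain K where K: "\<And>x. norm (f x) \<le> K * exp (- (x\<^sup>2) / 4)"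
    using assms(1) by (auto simp: gauss_bounded_def)
  obtain L where L: "\<And>x. norm (g x) \<le> L * exp (- (x\<^sup>2) / 4)"
    using assms(2) by (auto simp: gauss_bounded_def)
  show ?thesis
    using norm_triangle_le[OF add_mono[OF K L]]
    by (intro gauss_boundedI[where K = "K + L"]) (simp add: algebra_simps)
qed

lemma gauss_bounded_mult_bounded:
  fixes f g :: "real \<Rightarrow> 'a::real_normed_algebra"
  assumes "gauss_bounded f" "\<And>x. norm (g x) \<le> B"
  shows "gauss_bounded (\<lambda>x. g x * f x)"
proof -
  obtain K where K: "K \<ge> 0" "\<And>x. norm (f x) \<le> K * exp (- (x\<^sup>2) / 4)"
    using gauss_boundedE[OF assms(1)] by blast
  have "B \<ge> 0" using order.trans[OF norm_ge_zero assms(2)] .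
  have "norm (g x * f x) \<le> B * K * exp (- (x\<^sup>2) / 4)" for x
    using order.trans[OF norm_mult_ineq mult_mono[OF assms(2) K(2) \<open>B \<ge> 0\<close> norm_ge_zero]]
    by (simp add: mult_ac)
  then show ?thesis by (rule gauss_boundedI)
qed

lemma gauss_bounded_cmult:
  fixes f :: "real \<Rightarrow> 'a::real_normed_algebra"
  shows "gauss_bounded f \<Longrightarrow> gauss_bounded (\<lambda>x. c * f x)"
  by (rule gauss_bounded_mult_bounded[where B = "norm c"]) auto

lemma gauss_bounded_diff:
  fixes f :: "real \<Rightarrow> 'a::real_normed_vector"
  assumes "gauss_bounded f" "gauss_bounded g"
  shows "gauss_bounded (\<lambda>x. f x - g x)"
  using gauss_bounded_add[OF assms(1), of "\<lambda>x. - g x"] assms(2)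
  by (simp add: gauss_bounded_def)

section \<open>Integrals over the whole line and vanishing boundary terms\<close>

lemma integrable_exp_sq: "integrable lborel (\<lambda>x::real. exp (- (x\<^sup>2) / 4))"
proof -
  have "integrable lborel (\<lambda>x. sqrt (2 * pi * (sqrt 2)\<^sup>2) * normal_density 0 (sqrt 2) x)"
    by (intro integrable_mult_right) (auto intro: integrable_normal_density)
  moreover have "(\<lambda>x. sqrt (2 * pi * (sqrt 2)\<^sup>2) * normal_density 0 (sqrt 2) x) = (\<lambda>x. exp (- (x\<^sup>2) / 4))"
    by (auto simp: normal_density_def fun_eq_iff)
  ultimately show ?thesis by (simp only:)
qed

lemma gauss_bounded_integrable:
  fixes f :: "real \<Rightarrow> 'a::{banach,second_countable_topology}"
  assumes "gauss_bounded f" "f \<in> borel_measurable borel"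
  shows "integrable lborel f"
proof -
  obtain K where K: "K \<ge> 0" "\<And>x. norm (f x) \<le> K * exp (- (x\<^sup>2) / 4)"
    using gauss_boundedE[OF assms(1)] by blast
  show ?thesis
    using K assms(2)
    by (intro Bochner_Integration.integrable_bound[OF integrable_mult_right[OF integrable_exp_sq, of K]])
       (auto simp: abs_mult)
qed

lemma gauss_bounded_tendsto_0:
  fixes f :: "real \<Rightarrow> 'a::real_normed_vector"
  assumes "gauss_bounded f"
  shows "(f \<longlongrightarrow> 0) at_top" "(f \<longlongrightarrow> 0) at_bot"
proof -
  obtain K where K: "K \<ge> 0" "\<And>x. norm (f x) \<le> K * exp (- (x\<^sup>2) / 4)"
    using gauss_boundedE[OF assms(1)] by blast
  have "((\<lambda>x::real. K * exp (- (x\<^sup>2) / 4)) \<longlongrightarrow> 0) at_top"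
       "((\<lambda>x::real. K * exp (- (x\<^sup>2) / 4)) \<longlongrightarrow> 0) at_bot"
    by real_asymp+
  then show "(f \<longlongrightarrow> 0) at_top" "(f \<longlongrightarrow> 0) at_bot"
    using K(2) by (auto intro: Lim_null_comparison[rotated])
qed

text \<open>Integration by parts over the line is used in this form: a derivative is expanded by the
  ladder relations, and its vanishing integral becomes a recurrence between integrals.\<close>

lemma integral_derivative_eq_0:
  fixes g :: "real \<Rightarrow> 'a::euclidean_space"
  assumes "\<And>x. (g has_vector_derivative g' x) (at x)" "\<And>x. isCont g' x"
    and "gauss_bounded g" "gauss_bounded g'"
  shows "(LINT x|lborel. g' x) = 0"
proof -
  have meas: "g' \<in> borel_measurable borel"
    using assms(2) by (intro borel_measurable_continuous_onI continuous_at_imp_continuous_on) auto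
  have "(LBINT x=-\<infinity>..\<infinity>. g' x) = 0 - 0"
  proof (rule interval_integral_FTC_integrable[where F = g])
    show "set_integrable lborel (einterval (- \<infinity>) \<infinity>) g'"
      using gauss_bounded_integrable[OF assms(4) meas] by (simp add: set_integrable_def)
  qed (use assms gauss_bounded_tendsto_0[OF assms(3)] in \<open>auto simp: ereal_tendsto_simps\<close>)
  then show ?thesis
    by (simp add: interval_lebesgue_integral_def set_lebesgue_integral_def)
qed

section \<open>Orthonormality\<close>

lemma isCont_hermite_fun [continuous_intros]: "isCont (hermite_fun n) x"
  using has_real_derivative_hermite_fun by (blast intro: DERIV_isCont)

lemma gauss_bounded_hermite_fun_mult: "gauss_bounded (\<lambda>x. hermite_fun m x * hermite_fun n x)"
proof (rule gauss_bounded_mult_bounded[OF gauss_bounded_hermite_fun])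
  fix x :: real
  have "4 ^ m * exp (- (x\<^sup>2) / 4) \<le> 4 ^ m * 1" by (intro mult_left_mono) auto
  then show "norm (hermite_fun m x) \<le> 4 ^ m" using hermite_fun_bound[of m x] unfolding real_norm_def by linarith
qed

lemma integrable_hermite_fun_mult: "integrable lborel (\<lambda>x. hermite_fun m x * hermite_fun n x)"
  by (intro gauss_bounded_integrable gauss_bounded_hermite_fun_mult) measurable

text \<open>Adjointness of the raising and the lowering operator, read off from the vanishing
  integral of the derivative of psi_m psi_n.\<close>

lemma hermite_fun_inner_recursion:
  "sqrt (real (Suc m)) * (LINT x|lborel. hermite_fun (Suc m) x * hermite_fun n x)
    = sqrt (real n) * (LINT x|lborel. hermite_fun m x * hermite_fun (n - 1) x)"
proof -
  define d where "d x = sqrt 2 * sqrt (real n) * (hermite_fun m x * hermite_fun (n - 1) x)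
      - sqrt 2 * sqrt (real (Suc m)) * (hermite_fun (Suc m) x * hermite_fun n x)" for x
  have "(LINT x|lborel. d x) = 0"
  proof (rule integral_derivative_eq_0)
    fix x
    have half: "sqrt 2 * sqrt a = 2 * sqrt (a / 2)" for a
      by (simp add: real_sqrt_divide field_simps)
    have "d x = 2 * sqrt (real n / 2) * hermite_fun (n - 1) x * hermite_fun m x
       - 2 * sqrt (real (Suc m) / 2) * hermite_fun (Suc m) x * hermite_fun n x"
      unfolding d_def half by simp
    \<comment> \<open>Both factors satisfy the recurrence for multiplication by x, so x psi_m psi_n
      can be inserted and removed again; this trades psi_(m-1) for psi_(m+1) and psi_(n+1) for
      psi_(n-1).\<close>
    also have "\<dots> = 2 * (x * hermite_fun n x - sqrt (real (Suc n) / 2) * hermite_fun (Suc n) x) * hermite_fun m x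
       - 2 * sqrt (real (Suc m) / 2) * hermite_fun (Suc m) x * hermite_fun n x"
      unfolding hermite_fun_mult_x by (simp add: algebra_simps)
    also have "\<dots> = (sqrt (real m / 2) * hermite_fun (m - 1) x - sqrt (real (Suc m) / 2) * hermite_fun (Suc m) x)
          * hermite_fun n x
        + (sqrt (real n / 2) * hermite_fun (n - 1) x - sqrt (real (Suc n) / 2) * hermite_fun (Suc n) x)
          * hermite_fun m x"
    proof -
      have "sqrt (real m / 2) * hermite_fun (m - 1) x = x * hermite_fun m x - sqrt (real (Suc m) / 2) * hermite_fun (Suc m) x"
           "sqrt (real n / 2) * hermite_fun (n - 1) x = x * hermite_fun n x - sqrt (real (Suc n) / 2) * hermite_fun (Suc n) x"
        by (simp_all add: hermite_fun_mult_x)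
      then show ?thesis by (simp only:) (simp add: algebra_simps)
    qed
    finally show "((\<lambda>x. hermite_fun m x * hermite_fun n x) has_vector_derivative d x) (at x)"
      using DERIV_mult[OF has_real_derivative_hermite_fun[of m x] has_real_derivative_hermite_fun[of n x]]
      by (simp add: has_real_derivative_iff_has_vector_derivative)
    show "isCont d x" unfolding d_def by (intro continuous_intros)
  next
    show "gauss_bounded d" unfolding d_def
      by (intro gauss_bounded_diff gauss_bounded_cmult gauss_bounded_hermite_fun_mult)
  qed (rule gauss_bounded_hermite_fun_mult)
  then show ?thesis
    by (simp add: d_def integrable_hermite_fun_mult)
qed

lemma hermite_fun_0_sq: "hermite_fun 0 x * hermite_fun 0 x = exp (- (x\<^sup>2)) / sqrt pi"
proof -
  have "hermite_fun 0 x * hermite_fun 0 x = (exp (- (x\<^sup>2) / 2))\<^sup>2 / (sqrt (sqrt pi))\<^sup>2"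
    by (simp add: hermite_fun_def power2_eq_square)
  also have "\<dots> = exp (- (x\<^sup>2)) / sqrt pi" by (simp only: exp_double[symmetric]) simp
  finally show ?thesis .
qed

text \<open>The recursion lowers both indices at once. When one index reaches 0 before the other,
  the coefficient sqrt 0 gives orthogonality; when both do, a Gaussian mass remains.\<close>

lemma hermite_fun_orthonormal:
  "(LINT x|lborel. hermite_fun m x * hermite_fun n x) = (if m = n then 1 else 0)"
proof (induction m arbitrary: n)
  case 0
  show ?case
  proof (cases n)
    case 0
    \<comment> \<open>The square of psi_0 is the normal density of variance 1/2.\<close>
    have "(LINT x|lborel. hermite_fun 0 x * hermite_fun 0 x) = (LINT x|lborel. normal_density 0 (1 / sqrt 2) x)"
      unfolding hermite_fun_0_sq by (intro Bochner_Integration.integral_cong) (auto simp: normal_density_def power_divide)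
    then show ?thesis using 0 by (simp add: integral_normal_density)
  next
    case (Suc k)
    then show ?thesis using hermite_fun_inner_recursion[of k 0] by (simp add: mult.commute)
  qed
next
  case (Suc m)
  show ?case
  proof (cases n)
    case 0
    then show ?thesis using hermite_fun_inner_recursion[of m 0] by simp
  next
    case (Suc k)
    have "sqrt (real (Suc m)) * (LINT x|lborel. hermite_fun (Suc m) x * hermite_fun n x) = sqrt (real n) * (if m = k then 1 else 0)"
      using hermite_fun_inner_recursion[of m n] Suc.IH[of k] \<open>n = Suc k\<close> by simp
    moreover have "sqrt (real (Suc m)) > 0" by simp
    ultimately show ?thesis using \<open>n = Suc k\<close> by (auto split: if_splits)
  qed
qed

section \<open>Hermite functions as eigenfunctions of the Fourier transform\<close>

lemma hermite_fun_0_Fourier: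
  "(LINT x|lborel. complex_of_real (hermite_fun 0 x) * exp (\<i> * complex_of_real (x * y)))
    = complex_of_real (sqrt (2 * pi) * hermite_fun 0 y)"
proof -
  have "char std_normal_distribution y =
      (LINT x|lborel. std_normal_density x *\<^sub>R exp (\<i> * complex_of_real (y * x)))"
    unfolding char_def by (subst integral_density) auto
  also have "\<dots> = (LINT x|lborel. complex_of_real (hermite_norm 0 / sqrt (2 * pi)) *
      (complex_of_real (hermite_fun 0 x) * exp (\<i> * complex_of_real (x * y))))"
    using hermite_norm_pos[of 0]
    by (intro Bochner_Integration.integral_cong)
       (auto simp: std_normal_density_def hermite_fun_altdef scaleR_conv_of_real mult.commute)
  finally have "complex_of_real (exp (- y\<^sup>2 / 2)) = complex_of_real (hermite_norm 0 / sqrt (2 * pi)) *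
     (LINT x|lborel. complex_of_real (hermite_fun 0 x) * exp (\<i> * complex_of_real (x * y)))"
    unfolding char_std_normal_distribution by simp
  then show ?thesis using hermite_norm_pos[of 0]
    by (simp add: hermite_fun_altdef field_simps)
qed

lemma norm_exp_i_of_real [simp]: "norm (exp (\<i> * complex_of_real t)) = 1"
  by (simp add: norm_exp_eq_Re)

lemma gauss_bounded_hermite_fun_exp:
  "gauss_bounded (\<lambda>x. complex_of_real (hermite_fun n x) * exp (\<i> * complex_of_real (x * y)))"
  by (rule gauss_boundedI[where K = "4 ^ n"]) (use hermite_fun_bound[of n] in \<open>simp add: norm_mult\<close>)

lemma integrable_hermite_fun_exp:
  "integrable lborel (\<lambda>x. complex_of_real (hermite_fun n x) * exp (\<i> * complex_of_real (x * y)))"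
  by (intro gauss_bounded_integrable gauss_bounded_hermite_fun_exp) measurable

text \<open>Kept as a combination of three functions of the form psi_m(x) exp(ixy), so that its
  integral splits at once into Fourier transforms of levels n - 1, n + 1 and n.\<close>

definition hermite_fun_exp_deriv :: "nat \<Rightarrow> real \<Rightarrow> real \<Rightarrow> complex" where
  "hermite_fun_exp_deriv n y x =
     complex_of_real (sqrt (real n / 2)) * (complex_of_real (hermite_fun (n - 1) x) * exp (\<i> * complex_of_real (x * y)))
   - complex_of_real (sqrt (real (Suc n) / 2)) * (complex_of_real (hermite_fun (Suc n) x) * exp (\<i> * complex_of_real (x * y)))
   + \<i> * complex_of_real y * (complex_of_real (hermite_fun n x) * exp (\<i> * complex_of_real (x * y)))"

lemma has_vector_derivative_hermite_fun_exp:
  "((\<lambda>x. complex_of_real (hermite_fun n x) * exp (\<i> * complex_of_real (x * y)))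
     has_vector_derivative hermite_fun_exp_deriv n y x) (at x)"
proof -
  have 1: "((\<lambda>x. complex_of_real (hermite_fun n x)) has_vector_derivative
     complex_of_real (sqrt (real n / 2) * hermite_fun (n - 1) x - sqrt (real (Suc n) / 2) * hermite_fun (Suc n) x)) (at x)"
    by (intro has_vector_derivative_of_real has_real_derivative_hermite_fun)
  have "((\<lambda>z. exp (\<i> * (z * complex_of_real y))) has_field_derivative
       \<i> * complex_of_real y * exp (\<i> * (of_real x * complex_of_real y))) (at (of_real x))"
    by (auto intro!: derivative_eq_intros)
  from has_vector_derivative_real_field[OF this]
  have 2: "((\<lambda>x. exp (\<i> * complex_of_real (x * y))) has_vector_derivative
      \<i> * complex_of_real y * exp (\<i> * complex_of_real (x * y))) (at x)" by simp
  show ?thesis using has_vector_derivative_mult[OF 1 2]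
    unfolding hermite_fun_exp_deriv_def by (simp add: algebra_simps)
qed

lemma gauss_bounded_hermite_fun_exp_deriv: "gauss_bounded (hermite_fun_exp_deriv n y)"
  unfolding hermite_fun_exp_deriv_def
  by (intro gauss_bounded_diff gauss_bounded_add gauss_bounded_cmult gauss_bounded_hermite_fun_exp)

lemma isCont_hermite_fun_exp_deriv: "isCont (hermite_fun_exp_deriv n y) x"
  unfolding hermite_fun_exp_deriv_def
  by (intro continuous_intros isCont_o2[OF _ isCont_hermite_fun])

text \<open>The transforms obey, up to powers of i, the recurrence that
  \<open>hermite_fun_mult_x\<close> gives for psi_n(y). It links three levels, hence the strong
  induction.\<close>

lemma hermite_fun_Fourier:
  "(LINT x|lborel. complex_of_real (hermite_fun n x) * exp (\<i> * complex_of_real (x * y)))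
    = complex_of_real (sqrt (2 * pi)) * \<i> ^ n * complex_of_real (hermite_fun n y)"
proof (induction n rule: less_induct)
  case (less n)
  define J where "J n = (LINT x|lborel. complex_of_real (hermite_fun n x) * exp (\<i> * complex_of_real (x * y)))" for n
  show ?case
  proof (cases n)
    case 0
    then show ?thesis using hermite_fun_0_Fourier[of y] by simp
  next
    case (Suc k)
    have rec: "complex_of_real (sqrt (real k / 2)) * J (k - 1) - complex_of_real (sqrt (real (Suc k) / 2)) * J (Suc k)
        + \<i> * complex_of_real y * J k = 0"
      using integral_derivative_eq_0[OF has_vector_derivative_hermite_fun_exp isCont_hermite_fun_exp_deriv
          gauss_bounded_hermite_fun_exp gauss_bounded_hermite_fun_exp_deriv, of k y]
      unfolding hermite_fun_exp_deriv_def
      by (simp add: J_def integrable_hermite_fun_exp del: of_real_mult of_nat_Suc)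
    have IH: "J k = complex_of_real (sqrt (2 * pi)) * \<i> ^ k * complex_of_real (hermite_fun k y)"
      using less[of k] Suc by (simp add: J_def)
    \<comment> \<open>The minus sign is i^(k+1) = - i^(k-1); for k = 0 both sides vanish with their
      coefficient.\<close>
    have IH': "complex_of_real (sqrt (real k / 2)) * J (k - 1) =
        - (complex_of_real (sqrt (2 * pi)) * \<i> ^ Suc k * complex_of_real (sqrt (real k / 2) * hermite_fun (k - 1) y))"
    proof (cases k)
      case (Suc l)
      then show ?thesis using less[of l] \<open>n = Suc k\<close> by (simp add: J_def)
    qed simp
    have "complex_of_real (sqrt (real (Suc k) / 2)) * J (Suc k) =
        complex_of_real (sqrt (2 * pi)) * \<i> ^ Suc k *
          complex_of_real (y * hermite_fun k y - sqrt (real k / 2) * hermite_fun (k - 1) y)"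
      using rec unfolding IH IH' by (simp add: algebra_simps)
    also have "y * hermite_fun k y - sqrt (real k / 2) * hermite_fun (k - 1) y
        = sqrt (real (Suc k) / 2) * hermite_fun (Suc k) y"
      by (simp add: hermite_fun_mult_x)
    finally have "complex_of_real (sqrt (real (Suc k) / 2)) * J (Suc k) = complex_of_real (sqrt (real (Suc k) / 2)) *
         (complex_of_real (sqrt (2 * pi)) * \<i> ^ Suc k * complex_of_real (hermite_fun (Suc k) y))"
      by simp
    moreover have "complex_of_real (sqrt (real (Suc k) / 2)) \<noteq> 0" by simp
    ultimately have "J (Suc k) = complex_of_real (sqrt (2 * pi)) * \<i> ^ Suc k * complex_of_real (hermite_fun (Suc k) y)"
      using mult_left_cancel by blast
    then show ?thesis using Suc by (simp add: J_def)
  qed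
qed

section \<open>Truncated Fourier series of the sawtooth function\<close>

text \<open>On (0, 1) the function x - 1/2 has the Fourier series - sum sin(2 pi m x) / (pi m); this
  is what remains of it after M terms.\<close>

definition sawtooth_rem :: "nat \<Rightarrow> real \<Rightarrow> real" where
  "sawtooth_rem M x = x - 1/2 + (\<Sum>m=1..M. sin (2 * pi * real m * x) / (pi * real m))"

text \<open>The sum of exp(2 pi i m x) over |m| <= M, written with real terms.\<close>

definition dirichlet :: "nat \<Rightarrow> real \<Rightarrow> real" where
  "dirichlet M x = 1 + (\<Sum>m=1..M. 2 * cos (2 * pi * real m * x))"

lemma has_real_derivative_sawtooth_rem:
  "(sawtooth_rem M has_real_derivative dirichlet M x) (at x within S)"
proof -
  have "((\<lambda>x. x - 1/2 + (\<Sum>m=1..M. sin (2 * pi * real m * x) / (pi * real m)))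
      has_real_derivative 1 - 0 + (\<Sum>m=1..M. 2 * cos (2 * pi * real m * x))) (at x within S)"
    by (intro DERIV_add DERIV_diff DERIV_ident DERIV_const DERIV_sum)
       (auto intro!: derivative_eq_intros simp: field_simps)
  then show ?thesis unfolding dirichlet_def sawtooth_rem_def[abs_def] by simp
qed

lemma continuous_on_sawtooth_rem [continuous_intros]: "continuous_on S (sawtooth_rem M)"
  unfolding sawtooth_rem_def[abs_def] by (intro continuous_intros) auto

lemma continuous_on_dirichlet [continuous_intros]: "continuous_on S (dirichlet M)"
  unfolding dirichlet_def[abs_def] by (intro continuous_intros)

lemma sawtooth_rem_0 [simp]: "sawtooth_rem M 0 = - 1/2"
  by (simp add: sawtooth_rem_def)

lemma sin_2pi_nat [simp]: "sin (2 * pi * real m) = 0"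
  by (rule sin_integer_2pi) simp

lemma cos_2pi_nat [simp]: "cos (2 * pi * real m) = 1"
  by (rule cos_integer_2pi) simp

lemma sawtooth_rem_1 [simp]: "sawtooth_rem M 1 = 1/2"
  by (simp add: sawtooth_rem_def)

lemma dirichlet_diff_int: "dirichlet M (x - real_of_int j) = dirichlet M x"
proof -
  have "cos (2 * pi * real m * (x - real_of_int j)) = cos (2 * pi * real m * x)" for m
  proof -
    have "cos (2 * pi * real m * (x - real_of_int j))
        = cos (2 * pi * real m * x - 2 * pi * real_of_int (int m * j))"
      by (simp add: algebra_simps)
    also have "\<dots> = cos (2 * pi * real m * x)"
      using cos_integer_2pi[of "real_of_int (int m * j)"] sin_integer_2pi[of "real_of_int (int m * j)"]
      unfolding cos_diff by simp
    finally show ?thesis .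
  qed
  then show ?thesis by (simp add: dirichlet_def)
qed

lemma has_integral_sin_linear:
  assumes "m > 0"
  shows "((\<lambda>x. (x - 1/2) * sin (2 * pi * real m * x)) has_integral - 1 / (2 * pi * real m)) {0..1}"
proof -
  define G where "G x = - (x - 1/2) * cos (2 * pi * real m * x) / (2 * pi * real m)
       + sin (2 * pi * real m * x) / (2 * pi * real m)^2" for x
  have "((\<lambda>x. (x - 1/2) * sin (2 * pi * real m * x)) has_integral G 1 - G 0) {0..1}"
  proof (rule fundamental_theorem_of_calculus)
    fix x :: real
    have "(G has_real_derivative (x - 1/2) * sin (2 * pi * real m * x)) (at x within {0..1})"
      unfolding G_def[abs_def] using assms
      by (auto intro!: derivative_eq_intros simp: power2_eq_square divide_simps)
    then show "(G has_vector_derivative (x - 1/2) * sin (2 * pi * real m * x)) (at x within {0..1})"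
      by (simp add: has_real_derivative_iff_has_vector_derivative)
  qed simp
  moreover have "G 1 - G 0 = - 1 / (2 * pi * real m)"
  proof -
    have "G 1 = - (1/2) / (2 * pi * real m)" "G 0 = (1/2) / (2 * pi * real m)" by (simp_all add: G_def)
    then show ?thesis by simp
  qed
  ultimately show ?thesis by simp
qed

lemma has_integral_cos_2pi:
  assumes "k \<noteq> (0::int)"
  shows "((\<lambda>x. cos (2 * pi * real_of_int k * x)) has_integral 0) {0..1}"
proof -
  define G where "G x = sin (2 * pi * real_of_int k * x) / (2 * pi * real_of_int k)" for x
  have "((\<lambda>x. cos (2 * pi * real_of_int k * x)) has_integral G 1 - G 0) {0..1}"
  proof (rule fundamental_theorem_of_calculus)
    fix x :: real
    have "(G has_real_derivative cos (2 * pi * real_of_int k * x)) (at x within {0..1})"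
      unfolding G_def[abs_def] using assms by (auto intro!: derivative_eq_intros)
    then show "(G has_vector_derivative cos (2 * pi * real_of_int k * x)) (at x within {0..1})"
      by (simp add: has_real_derivative_iff_has_vector_derivative)
  qed simp
  moreover have "G 1 - G 0 = 0"
    using sin_integer_2pi[of "real_of_int k"] by (simp add: G_def)
  ultimately show ?thesis by simp
qed

lemma has_integral_sin_mult_sin:
  assumes "m > 0" "n > 0"
  shows "((\<lambda>x. sin (2 * pi * real m * x) * sin (2 * pi * real n * x)) has_integral
           (if m = n then 1/2 else 0)) {0..1}"
proof -
  have eq: "sin (2 * pi * real m * x) * sin (2 * pi * real n * x) =
      (cos (2 * pi * real_of_int (int m - int n) * x) - cos (2 * pi * real_of_int (int m + int n) * x)) / 2" for x
    unfolding sin_times_sin by (simp add: algebra_simps)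
  have 1: "((\<lambda>x. cos (2 * pi * real_of_int (int m - int n) * x)) has_integral (if m = n then 1 else 0)) {0..1}"
    using has_integral_cos_2pi[of "int m - int n"] has_integral_const_real[of 1 0 1] by auto
  have "((\<lambda>x. (cos (2 * pi * real_of_int (int m - int n) * x) - cos (2 * pi * real_of_int (int m + int n) * x)) / 2)
     has_integral ((if m = n then 1 else 0) - 0) / 2) {0..1}"
    using assms by (intro has_integral_divide has_integral_diff 1 has_integral_cos_2pi) auto
  then show ?thesis unfolding eq by (auto split: if_splits)
qed

text \<open>Bessel's identity: 1/12 is the squared norm of x - 1/2, and each mode removes the square
  of its coefficient.\<close>

lemma has_integral_sawtooth_rem_sq:
  "((\<lambda>x. (sawtooth_rem M x)\<^sup>2) has_integral 1/12 - (\<Sum>m=1..M. 1 / (2 * pi\<^sup>2 * real m ^ 2))) {0..1}"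
proof (induction M)
  case 0
  define G where "G x = (x - 1/2) ^ 3 / (3::real)" for x
  have "((\<lambda>x. (x - 1/2)\<^sup>2) has_integral G 1 - G 0) {0..1::real}"
  proof (rule fundamental_theorem_of_calculus)
    fix x :: real
    have "(G has_real_derivative (x - 1/2)\<^sup>2) (at x within {0..1})"
      unfolding G_def[abs_def] by (auto intro!: derivative_eq_intros)
    then show "(G has_vector_derivative (x - 1/2)\<^sup>2) (at x within {0..1})"
      by (simp add: has_real_derivative_iff_has_vector_derivative)
  qed simp
  moreover have "G 1 - G 0 = 1/12" by (simp add: G_def power3_eq_cube)
  ultimately show ?case by (simp add: sawtooth_rem_def)
next
  case (Suc M)
  define v where "v x = sin (2 * pi * real (Suc M) * x) / (pi * real (Suc M))" for x
  define c where "c = 1 / (2 * pi\<^sup>2 * real (Suc M) ^ 2)"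
  have S: "sawtooth_rem (Suc M) x = sawtooth_rem M x + v x" for x
    by (simp add: sawtooth_rem_def v_def)
  have eq: "sawtooth_rem M x * v x = ((x - 1/2) * sin (2 * pi * real (Suc M) * x)
      + (\<Sum>m=1..M. sin (2 * pi * real m * x) * sin (2 * pi * real (Suc M) * x) / (pi * real m))) / (pi * real (Suc M))" for x
    unfolding sawtooth_rem_def v_def by (simp only: distrib_right sum_distrib_right add_divide_distrib times_divide_eq_right times_divide_eq_left)
  have "((\<lambda>x. sawtooth_rem M x * v x) has_integral
      (- 1 / (2 * pi * real (Suc M)) + (\<Sum>m=1..M. 0 / (pi * real m))) / (pi * real (Suc M))) {0..1}"
    unfolding eq
  proof (intro has_integral_divide has_integral_add has_integral_sin_linear has_integral_sum)
    fix m assume "m \<in> {1..M}"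
    then show "((\<lambda>x. sin (2 * pi * real m * x) * sin (2 * pi * real (Suc M) * x)) has_integral 0) {0..1}"
      using has_integral_sin_mult_sin[of m "Suc M"] by simp
  qed auto
  \<comment> \<open>The new sine is orthogonal to the earlier ones, so the cross term sees only x -
    1/2 and equals -c; with the square c of the new term the net change is -2c + c = -c.\<close>
  then have 1: "((\<lambda>x. sawtooth_rem M x * v x) has_integral - c) {0..1}"
    by (rule has_integral_eq_rhs) (simp add: c_def power2_eq_square)
  have "((\<lambda>x. v x * v x) has_integral (1/2) / (pi * real (Suc M))\<^sup>2) {0..1}"
  proof -
    have *: "v x * v x = sin (2 * pi * real (Suc M) * x) * sin (2 * pi * real (Suc M) * x) / (pi * real (Suc M))\<^sup>2" for x
      by (simp add: v_def power2_eq_square)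
    show ?thesis unfolding * using has_integral_sin_mult_sin[of "Suc M" "Suc M"]
      by (intro has_integral_divide) simp
  qed
  then have 2: "((\<lambda>x. v x * v x) has_integral c) {0..1}"
    by (rule has_integral_eq_rhs) (simp add: c_def power_mult_distrib)
  have "((\<lambda>x. (sawtooth_rem M x)\<^sup>2 + 2 * (sawtooth_rem M x * v x) + v x * v x) has_integral
     (1/12 - (\<Sum>m=1..M. 1 / (2 * pi\<^sup>2 * real m ^ 2))) + 2 * (- c) + c) {0..1}"
    by (intro has_integral_add has_integral_mult_right Suc.IH 1 2)
  moreover have "(\<lambda>x. (sawtooth_rem M x)\<^sup>2 + 2 * (sawtooth_rem M x * v x) + v x * v x) = (\<lambda>x. (sawtooth_rem (Suc M) x)\<^sup>2)"
    unfolding S by (simp add: fun_eq_iff power2_eq_square algebra_simps)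
  moreover have "(1/12 - (\<Sum>m=1..M. 1 / (2 * pi\<^sup>2 * real m ^ 2))) + 2 * (- c) + c
      = 1/12 - (\<Sum>m=1..Suc M. 1 / (2 * pi\<^sup>2 * real m ^ 2))"
    by (simp add: c_def)
  ultimately show ?case by metis
qed

text \<open>The limit is 1/12 - (pi^2/6) / (2 pi^2), which is 0 precisely by the Basel sum.\<close>

lemma integral_sawtooth_rem_sq_tendsto_0:
  "(\<lambda>M. integral {0..1} (\<lambda>x. (sawtooth_rem M x)\<^sup>2)) \<longlonglongrightarrow> 0"
proof -
  have "(\<lambda>M. 1/12 - (\<Sum>m<M. 1 / (real m + 1)\<^sup>2) / (2 * pi\<^sup>2)) \<longlonglongrightarrow> 1/12 - (pi\<^sup>2/6) / (2 * pi\<^sup>2)"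
    using inverse_squares_sums unfolding sums_def by (intro tendsto_intros) (auto simp: add.commute)
  moreover have "1/12 - (\<Sum>m<M. 1 / (real m + 1)\<^sup>2) / (2 * pi\<^sup>2) = integral {0..1} (\<lambda>x. (sawtooth_rem M x)\<^sup>2)" for M
  proof -
    have "(\<Sum>m=1..M. 1 / (2 * pi\<^sup>2 * real m ^ 2)) = (\<Sum>m<M. 1 / (2 * pi\<^sup>2 * real (Suc m) ^ 2))"
      by (rule sum.reindex_bij_witness[of _ Suc "\<lambda>m. m - 1"]) auto
    also have "\<dots> = (\<Sum>m<M. 1 / (real m + 1)\<^sup>2) / (2 * pi\<^sup>2)"
      by (simp add: sum_divide_distrib add.commute mult.commute)
    finally show ?thesis using integral_unique[OF has_integral_sawtooth_rem_sq[of M]] by simp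
  qed
  ultimately show ?thesis by simp
qed

text \<open>Passage from L2 to L1 by the pointwise inequality |s| <= (s^2 / r + r) / 2; once the
  integral of s^2 is below r^2, the right side integrates to less than r.\<close>

lemma integral_abs_sawtooth_rem_tendsto_0:
  "(\<lambda>M. integral {0..1} (\<lambda>x. \<bar>sawtooth_rem M x\<bar>)) \<longlonglongrightarrow> 0"
proof (rule LIMSEQ_I)
  fix r :: real assume r: "r > 0"
  have "eventually (\<lambda>M. integral {0..1} (\<lambda>x. (sawtooth_rem M x)\<^sup>2) < r\<^sup>2) sequentially"
    using order_tendstoD(2)[OF integral_sawtooth_rem_sq_tendsto_0, of "r\<^sup>2"] r by simp
  then obtain M0 where M0: "\<And>M. M \<ge> M0 \<Longrightarrow> integral {0..1} (\<lambda>x. (sawtooth_rem M x)\<^sup>2) < r\<^sup>2"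
    by (auto simp: eventually_sequentially)
  have "norm (integral {0..1} (\<lambda>x. \<bar>sawtooth_rem M x\<bar>) - 0) < r" if "M \<ge> M0" for M
  proof -
    have "integral {0..1} (\<lambda>x. \<bar>sawtooth_rem M x\<bar>) \<le> integral {0..1} (\<lambda>x. ((sawtooth_rem M x)\<^sup>2 / r + r) / 2)"
    proof (rule integral_le)
      fix x :: real
      have "0 \<le> (\<bar>sawtooth_rem M x\<bar> - r)\<^sup>2" by simp
      then have "2 * \<bar>sawtooth_rem M x\<bar> * r \<le> (sawtooth_rem M x)\<^sup>2 + r * r"
        by (simp add: power2_eq_square algebra_simps)
      then show "\<bar>sawtooth_rem M x\<bar> \<le> ((sawtooth_rem M x)\<^sup>2 / r + r) / 2"
        using r by (simp add: field_simps)
    qed (use r in \<open>intro integrable_continuous_real continuous_intros; simp\<close>)+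
    also have "((\<lambda>x. ((sawtooth_rem M x)\<^sup>2 / r + r) / 2) has_integral
        (integral {0..1} (\<lambda>x. (sawtooth_rem M x)\<^sup>2) / r + r) / 2) {0..1}"
      using has_integral_const_real[of r 0 1] has_integral_sawtooth_rem_sq[of M]
      by (intro has_integral_divide has_integral_add integrable_integral) auto
    then have "integral {0..1} (\<lambda>x. ((sawtooth_rem M x)\<^sup>2 / r + r) / 2)
        = (integral {0..1} (\<lambda>x. (sawtooth_rem M x)\<^sup>2) / r + r) / 2" by (rule integral_unique)
    also have "\<dots> < (r\<^sup>2 / r + r) / 2" using M0[OF that] r by (intro divide_strict_right_mono add_strict_right_mono) auto
    also have "\<dots> = r" using r by (simp add: power2_eq_square)
    finally show ?thesis
      by (simp add: integral_nonneg integrable_continuous_real continuous_intros)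
  qed
  then show "\<exists>no. \<forall>M\<ge>no. norm (integral {0..1} (\<lambda>x. \<bar>sawtooth_rem M x\<bar>) - 0) < r" by blast
qed

section \<open>Poisson summation with error bound\<close>

text \<open>\<^const>\<open>sawtooth_rem\<close> is the antiderivative of the Dirichlet kernel that takes the values
  \<open>-1/2, 1/2\<close> at \<open>0\<close> and \<open>1\<close>; integration by parts produces the trapezoid rule.\<close>

lemma euler_maclaurin_unit:
  fixes f f' :: "real \<Rightarrow> complex" and j :: int
  assumes deriv: "\<And>x. (f has_vector_derivative f' x) (at x)" and cont: "\<And>x. isCont f' x"
    and S: "\<And>x. real_of_int j \<le> x \<Longrightarrow> x \<le> real_of_int j + 1 \<Longrightarrow> norm (f' x) \<le> S"
  shows "norm ((f (real_of_int j) + f (real_of_int j + 1)) / 2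
            - integral {real_of_int j..real_of_int j + 1} (\<lambda>x. f x * complex_of_real (dirichlet M x)))
       \<le> S * integral {0..1} (\<lambda>x. \<bar>sawtooth_rem M x\<bar>)"
proof -
  let ?j = "real_of_int j"
  \<comment> \<open>\<open>sawtooth_rem\<close> is not periodic, so it is shifted to the cell; its
    derivative is periodic, so the shift disappears there.\<close>
  define E where "E x = sawtooth_rem M (x - ?j)" for x
  have contE: "continuous_on A E" for A
    unfolding E_def by (intro continuous_on_compose2[OF continuous_on_sawtooth_rem[of UNIV]] continuous_intros) auto
  have contf: "continuous_on A f" for A
    using deriv by (intro continuous_at_imp_continuous_on ballI) (blast intro: has_vector_derivative_continuous)
  have contf': "continuous_on A f'" for A
    using cont by (intro continuous_at_imp_continuous_on ballI)
  have derE: "(E has_real_derivative dirichlet M x) (at x within A)" for x A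
  proof -
    have "((\<lambda>x. sawtooth_rem M (x - ?j)) has_real_derivative dirichlet M (x - ?j) * 1) (at x within A)"
      by (rule DERIV_chain2[OF has_real_derivative_sawtooth_rem]) (auto intro!: derivative_eq_intros)
    then show ?thesis
      by (simp add: E_def[abs_def] dirichlet_diff_int)
  qed
  have ftc: "((\<lambda>x. f x * complex_of_real (dirichlet M x) + f' x * complex_of_real (E x)) has_integral
      (f (?j + 1) * complex_of_real (E (?j + 1)) - f ?j * complex_of_real (E ?j))) {?j..?j + 1}"
    using has_vector_derivative_mult[OF has_vector_derivative_at_within[OF deriv] has_vector_derivative_of_real[OF derE]]
    by (intro fundamental_theorem_of_calculus) auto
  have int1: "(\<lambda>x. f x * complex_of_real (dirichlet M x)) integrable_on {?j..?j + 1}"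
    by (intro integrable_continuous_real continuous_intros contf)
  have int2: "(\<lambda>x. f' x * complex_of_real (E x)) integrable_on {?j..?j + 1}"
    by (intro integrable_continuous_real continuous_intros contf' contE)
  have "(f ?j + f (?j + 1)) / 2 = f (?j + 1) * complex_of_real (E (?j + 1)) - f ?j * complex_of_real (E ?j)"
    by (simp add: E_def add_divide_distrib)
  also have "\<dots> = integral {?j..?j + 1} (\<lambda>x. f x * complex_of_real (dirichlet M x) + f' x * complex_of_real (E x))"
    using ftc by (simp add: integral_unique)
  also have "\<dots> = integral {?j..?j + 1} (\<lambda>x. f x * complex_of_real (dirichlet M x))
      + integral {?j..?j + 1} (\<lambda>x. f' x * complex_of_real (E x))"
    by (rule integral_add[OF int1 int2])
  finally have "norm ((f ?j + f (?j + 1)) / 2 - integral {?j..?j + 1} (\<lambda>x. f x * complex_of_real (dirichlet M x)))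
     = norm (integral {?j..?j + 1} (\<lambda>x. f' x * complex_of_real (E x)))"
    by (simp only: add_diff_cancel_left')
  also have "\<dots> \<le> integral {?j..?j + 1} (\<lambda>x. S * \<bar>E x\<bar>)"
    by (rule integral_norm_bound_integral[OF int2])
       (auto intro!: integrable_continuous_real continuous_intros contE mult_right_mono S simp: norm_mult)
  also have "\<dots> = S * integral {?j..?j + 1} (\<lambda>x. \<bar>E x\<bar>)" by simp
  also have "integral {?j..?j + 1} (\<lambda>x. \<bar>E x\<bar>) = integral {0..1} (\<lambda>x. \<bar>sawtooth_rem M x\<bar>)"
  proof -
    have "((\<lambda>x. \<bar>sawtooth_rem M x\<bar>) has_integral integral {0..1} (\<lambda>x. \<bar>sawtooth_rem M x\<bar>)) {0..1}"
      by (intro integrable_integral integrable_continuous_real continuous_intros)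
    moreover have "((\<lambda>x. \<bar>E x\<bar>) \<circ> ((+) ?j)) = (\<lambda>x. \<bar>sawtooth_rem M x\<bar>)" by (simp add: fun_eq_iff E_def)
    ultimately have "(((\<lambda>x. \<bar>E x\<bar>) \<circ> ((+) ?j)) has_integral integral {0..1} (\<lambda>x. \<bar>sawtooth_rem M x\<bar>)) {0..1}"
      by (simp only:)
    from this[unfolded has_integral_shift_Icc_real]
    have "((\<lambda>x. \<bar>E x\<bar>) has_integral integral {0..1} (\<lambda>x. \<bar>sawtooth_rem M x\<bar>)) {0 + ?j..1 + ?j}" .
    then show ?thesis by (simp add: integral_unique add.commute)
  qed
  finally show ?thesis .
qed

lemma sum_exp_neg_abs_le:
  fixes a :: real
  assumes "a > 0"
  shows "(\<Sum>j\<in>{- int A..<int A}. exp (- a * \<bar>real_of_int j\<bar>)) \<le> 2 / (1 - exp (- a))"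
proof -
  have e: "0 < exp (- a)" "exp (- a) < 1" using assms by auto
  have geo: "(\<Sum>k<n. exp (- a) ^ k) \<le> 1 / (1 - exp (- a))" for n
    using e by (simp add: sum_gp_strict divide_right_mono)
  \<comment> \<open>The two halves of the range are unequal: absolute values 0 to A - 1 on one side
    and 1 to A on the other. The second sum is enlarged by its term k = 0.\<close>
  have "(\<Sum>j\<in>{- int A..<int A}. exp (- a * \<bar>real_of_int j\<bar>))
     \<le> (\<Sum>k<A. exp (- a) ^ k) + (\<Sum>k<Suc A. exp (- a) ^ k)"
  proof (induction A)
    case (Suc A)
    have "{- int (Suc A)..<int (Suc A)} = insert (- int (Suc A)) (insert (int A) {- int A..<int A})" by auto
    then have "(\<Sum>j\<in>{- int (Suc A)..<int (Suc A)}. exp (- a * \<bar>real_of_int j\<bar>))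
       = exp (- a * real (Suc A)) + (exp (- a * real A) + (\<Sum>j\<in>{- int A..<int A}. exp (- a * \<bar>real_of_int j\<bar>)))"
      by simp
    moreover have "exp (- a * real k) = exp (- a) ^ k" for k
      by (simp add: exp_of_nat_mult[symmetric] mult.commute)
    ultimately have "(\<Sum>j\<in>{- int (Suc A)..<int (Suc A)}. exp (- a * \<bar>real_of_int j\<bar>))
       = exp (- a) ^ Suc A + (exp (- a) ^ A + (\<Sum>j\<in>{- int A..<int A}. exp (- a * \<bar>real_of_int j\<bar>)))"
      by (simp only:)
    then show ?case using Suc.IH unfolding sum.lessThan_Suc by linarith
  qed simp
  also have "\<dots> \<le> 1 / (1 - exp (- a)) + 1 / (1 - exp (- a))" by (intro add_mono geo)
  finally show ?thesis by simp
qed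

text \<open>Decay of f' makes the cell errors summable, so the bound is independent of A. This
  permits A to go to infinity at fixed M.\<close>

lemma poisson_partial:
  fixes f f' :: "real \<Rightarrow> complex"
  assumes deriv: "\<And>x. (f has_vector_derivative f' x) (at x)" and cont: "\<And>x. isCont f' x"
    and K: "\<And>x. norm (f' x) \<le> K * exp (- a * \<bar>x\<bar>)" and a: "a > 0"
  shows "norm ((\<Sum>j\<in>{- int A..<int A}. (f (real_of_int j) + f (real_of_int j + 1)) / 2)
            - integral {- real A..real A} (\<lambda>x. f x * complex_of_real (dirichlet M x)))
       \<le> K * exp a * (2 / (1 - exp (- a))) * integral {0..1} (\<lambda>x. \<bar>sawtooth_rem M x\<bar>)"
proof -
  define I where "I = integral {0..1} (\<lambda>x. \<bar>sawtooth_rem M x\<bar>)"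
  define T where "T j = (f (real_of_int j) + f (real_of_int j + 1)) / 2" for j
  define g where "g x = f x * complex_of_real (dirichlet M x)" for x
  have I: "I \<ge> 0" unfolding I_def by (intro integral_nonneg integrable_continuous_real continuous_intros) auto
  have K0: "K \<ge> 0" using order.trans[OF norm_ge_zero K[of 0]] by simp
  have contf: "continuous_on S f" for S
    using deriv by (intro continuous_at_imp_continuous_on ballI) (blast intro: has_vector_derivative_continuous)
  have intg: "g integrable_on {u..v}" for u v
    unfolding g_def by (intro integrable_continuous_real continuous_intros contf)
  have unit: "norm (T j - integral {real_of_int j..real_of_int j + 1} g) \<le> K * exp a * exp (- a * \<bar>real_of_int j\<bar>) * I" for j
    unfolding T_def g_def I_def
  proof (rule euler_maclaurin_unit[OF deriv cont])
    fix x assume x: "real_of_int j \<le> x" "x \<le> real_of_int j + 1"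
    \<comment> \<open>On the cell, |x| >= |j| - 1; the lost unit is the factor
      \<open>exp a\<close>.\<close>
    have "exp (- a * \<bar>x\<bar>) \<le> exp (a - a * \<bar>real_of_int j\<bar>)"
    proof -
      have "a * (\<bar>real_of_int j\<bar> - 1) \<le> a * \<bar>x\<bar>" using x a by (intro mult_left_mono) auto
      then show ?thesis by (simp add: algebra_simps)
    qed
    then have "K * exp (- a * \<bar>x\<bar>) \<le> K * exp (a - a * \<bar>real_of_int j\<bar>)" using K0 by (intro mult_left_mono)
    moreover have "exp (a - a * \<bar>real_of_int j\<bar>) = exp a * exp (- a * \<bar>real_of_int j\<bar>)"
      by (simp flip: exp_add)
    ultimately show "norm (f' x) \<le> K * exp a * exp (- a * \<bar>real_of_int j\<bar>)"
      using K[of x] by (simp only: mult.assoc)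
  qed
  have "norm ((\<Sum>j\<in>{- int A..<int A}. T j) - integral {- real A..real A} g)
     \<le> K * exp a * I * (\<Sum>j\<in>{- int A..<int A}. exp (- a * \<bar>real_of_int j\<bar>))"
  proof (induction A)
    case (Suc A)
    have set: "{- int (Suc A)..<int (Suc A)} = insert (- int (Suc A)) (insert (int A) {- int A..<int A})" by auto
    have "integral {- real (Suc A)..real (Suc A)} g = integral {- real (Suc A)..- real A} g + integral {- real A..real (Suc A)} g"
      by (rule Henstock_Kurzweil_Integration.integral_combine[symmetric]) (auto intro: intg)
    also have "integral {- real A..real (Suc A)} g = integral {- real A..real A} g + integral {real A..real (Suc A)} g"
      by (rule Henstock_Kurzweil_Integration.integral_combine[symmetric]) (auto intro: intg)
    finally have "(\<Sum>j\<in>{- int (Suc A)..<int (Suc A)}. T j) - integral {- real (Suc A)..real (Suc A)} g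
       = (T (- int (Suc A)) - integral {real_of_int (- int (Suc A))..real_of_int (- int (Suc A)) + 1} g)
       + ((T (int A) - integral {real_of_int (int A)..real_of_int (int A) + 1} g)
       + ((\<Sum>j\<in>{- int A..<int A}. T j) - integral {- real A..real A} g))"
      unfolding set by (simp add: algebra_simps)
    also have "norm \<dots> \<le> K * exp a * exp (- a * \<bar>real_of_int (- int (Suc A))\<bar>) * I
       + (K * exp a * exp (- a * \<bar>real_of_int (int A)\<bar>) * I
       + K * exp a * I * (\<Sum>j\<in>{- int A..<int A}. exp (- a * \<bar>real_of_int j\<bar>)))"
      by (intro order.trans[OF norm_triangle_ineq] add_mono unit Suc.IH)
    also have "\<dots> = K * exp a * I * (\<Sum>j\<in>{- int (Suc A)..<int (Suc A)}. exp (- a * \<bar>real_of_int j\<bar>))"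
      unfolding set by (simp add: algebra_simps)
    finally show ?case .
  qed simp
  also have "\<dots> \<le> K * exp a * I * (2 / (1 - exp (- a)))"
    using K0 I a by (intro mult_left_mono sum_exp_neg_abs_le) auto
  finally show ?thesis unfolding T_def g_def I_def by (simp add: mult_ac)
qed

lemma integral_Icc_tendsto:
  fixes f :: "real \<Rightarrow> 'a::euclidean_space"
  assumes f: "integrable lborel f"
  shows "(\<lambda>A. integral {- real A..real A} f) \<longlonglongrightarrow> (LINT x|lborel. f x)"
proof -
  have meas: "f \<in> borel_measurable borel" using f by simp
  have "(\<lambda>A. LINT x|lborel. indicator {- real A..real A} x *\<^sub>R f x) \<longlonglongrightarrow> (LINT x|lborel. f x)"
  proof (rule integral_dominated_convergence[where w = "\<lambda>x. norm (f x)"])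
    show "AE x in lborel. (\<lambda>A. indicator {- real A..real A} x *\<^sub>R f x) \<longlonglongrightarrow> f x"
    proof (intro AE_I2 tendsto_eventually)
      fix x :: real
      obtain n where "\<bar>x\<bar> \<le> real n" using real_arch_simple by blast
      then show "eventually (\<lambda>A. indicator {- real A..real A} x *\<^sub>R f x = f x) sequentially"
        by (intro eventually_sequentiallyI[of n]) (auto simp: indicator_def)
    qed
  qed (use f meas in \<open>auto simp: indicator_def\<close>)
  moreover have "(LINT x|lborel. indicator {- real A..real A} x *\<^sub>R f x) = integral {- real A..real A} f" for A
  proof -
    have "set_integrable lborel {- real A..real A} f"
      unfolding set_integrable_def using f by (intro integrable_mult_indicator) auto
    from set_borel_integral_eq_integral(2)[OF this] show ?thesis
      by (simp add: set_lebesgue_integral_def)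
  qed
  ultimately show ?thesis by simp
qed

text \<open>First A tends to infinity at fixed M, which turns the integral against the kernel into
  the Fourier transforms at integer frequencies up to M; then M tends to infinity, which removes the
  sawtooth error. Frequency 0 is the main term. T bounds the samples outside J and Q the other
  frequencies, both through uniformly bounded partial sums.\<close>

lemma poisson_bound:
  fixes f f' :: "real \<Rightarrow> complex" and J :: "int set"
  assumes deriv: "\<And>x. (f has_vector_derivative f' x) (at x)" and cont: "\<And>x. isCont f' x"
    and K: "\<And>x. norm (f' x) \<le> K * exp (- a * \<bar>x\<bar>)" and a: "a > 0"
    and int: "integrable lborel f" and lim: "(f \<longlongrightarrow> 0) at_top" "(f \<longlongrightarrow> 0) at_bot"
    and J: "finite J" and T: "\<And>A. (\<Sum>j\<in>{- int A..int A} - J. norm (f (real_of_int j))) \<le> T"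
    and Q: "\<And>M. (\<Sum>m=1..M. norm (LINT x|lborel. f x * exp (\<i> * complex_of_real (2 * pi * real m * x)))
                 + norm (LINT x|lborel. f x * exp (\<i> * complex_of_real (2 * pi * - real m * x)))) \<le> Q"
  shows "norm ((\<Sum>j\<in>J. f (real_of_int j)) - (LINT x|lborel. f x)) \<le> T + Q"
proof -
  define F where "F w = (LINT x|lborel. f x * exp (\<i> * complex_of_real (2 * pi * w * x)))" for w
  define I where "I M = integral {0..1} (\<lambda>x. \<bar>sawtooth_rem M x\<bar>)" for M
  define B where "B = K * exp a * (2 / (1 - exp (- a)))"
  have meas [measurable]: "f \<in> borel_measurable borel" using int by simp
  have intF: "integrable lborel (\<lambda>x. f x * exp (\<i> * complex_of_real (2 * pi * w * x)))" for w
    by (rule Bochner_Integration.integrable_bound[OF int]) (auto simp: norm_mult simp del: of_real_mult)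
  \<comment> \<open>Frequencies m and -m stay paired, matching the form of the hypothesis on
    Q.\<close>
  have dir: "f x * complex_of_real (dirichlet M x) = f x + (\<Sum>m=1..M.
       f x * exp (\<i> * complex_of_real (2 * pi * real m * x)) + f x * exp (\<i> * complex_of_real (2 * pi * - real m * x)))" for M x
  proof -
    have "complex_of_real (2 * cos t) = exp (\<i> * complex_of_real t) + exp (\<i> * complex_of_real (- t))" for t
    proof -
      have "complex_of_real (2 * cos t) = 2 * cos (complex_of_real t)" by (simp add: cos_of_real)
      moreover have "2 * cos z = exp (\<i> * z) + exp (- (\<i> * z))" for z :: complex
        by (simp add: cos_exp_eq)
      ultimately show ?thesis by simp
    qed
    then have "complex_of_real (dirichlet M x) = 1 + (\<Sum>m=1..M.
        exp (\<i> * complex_of_real (2 * pi * real m * x)) + exp (\<i> * complex_of_real (2 * pi * - real m * x)))"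
      unfolding dirichlet_def of_real_add of_real_sum by (simp only: of_real_1 mult_minus_left mult_minus_right)
    then show ?thesis by (simp add: distrib_left sum_distrib_left)
  qed
  have "norm ((\<Sum>j\<in>J. f (real_of_int j)) - (LINT x|lborel. f x)) \<le> T + Q + B * I M" for M
  proof -
    define D where "D = (LINT x|lborel. f x * complex_of_real (dirichlet M x))"
    have intD: "integrable lborel (\<lambda>x. f x * complex_of_real (dirichlet M x))"
      unfolding dir by (intro Bochner_Integration.integrable_add Bochner_Integration.integrable_sum int intF)
    have D: "D = (LINT x|lborel. f x) + (\<Sum>m=1..M. F (real m) + F (- real m))"
      unfolding D_def dir F_def
      by (subst Bochner_Integration.integral_add, intro int, intro Bochner_Integration.integrable_sum Bochner_Integration.integrable_add intF,
          subst Bochner_Integration.integral_sum, intro Bochner_Integration.integrable_add intF,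
          subst Bochner_Integration.integral_add[OF intF intF]) simp
    obtain A0 where A0: "J \<subseteq> {- int A0..int A0}"
    proof -
      have "finite ((\<lambda>j. nat \<bar>j\<bar>) ` J)" using J by simp
      then obtain A0 where "\<forall>n\<in>(\<lambda>j. nat \<bar>j\<bar>) ` J. n \<le> A0" using finite_nat_set_iff_bounded_le by blast
      then have "nat \<bar>j\<bar> \<le> A0" if "j \<in> J" for j using that by blast
      then have "J \<subseteq> {- int A0..int A0}" by (force simp: nat_le_iff)
      then show ?thesis using that by blast
    qed
    have "norm ((\<Sum>j\<in>J. f (real_of_int j)) - integral {- real A..real A} (\<lambda>x. f x * complex_of_real (dirichlet M x)))
        \<le> T + B * I M + (norm (f (real A)) + norm (f (- real A))) / 2" if "A \<ge> A0" for A
    proof -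
      define S where "S = (\<Sum>j\<in>{- int A..<int A}. (f (real_of_int j) + f (real_of_int j + 1)) / 2)"
      have JA: "J \<subseteq> {- int A..int A}" using A0 that by fastforce
      \<comment> \<open>The trapezoid rule counts the two extreme samples with weight 1/2; the
        correction vanishes in the limit because f decays.\<close>
      have S: "S = (\<Sum>j\<in>{- int A..int A}. f (real_of_int j)) - (f (real A) + f (- real A)) / 2"
      proof -
        have "(\<Sum>j\<in>{- int A..<int A}. f (real_of_int j + 1)) = (\<Sum>j\<in>{- int A<..int A}. f (real_of_int j))"
          by (rule sum.reindex_bij_witness[of _ "\<lambda>j. j - 1" "\<lambda>j. j + 1"]) auto
        moreover have "(\<Sum>j\<in>insert (int A) {- int A..<int A}. f (real_of_int j)) = f (real A) + (\<Sum>j\<in>{- int A..<int A}. f (real_of_int j))"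
          by simp
        moreover have "(\<Sum>j\<in>insert (- int A) {- int A<..int A}. f (real_of_int j)) = f (- real A) + (\<Sum>j\<in>{- int A<..int A}. f (real_of_int j))"
          by simp
        moreover have "insert (int A) {- int A..<int A} = {- int A..int A}" by auto
        moreover have "insert (- int A) {- int A<..int A} = {- int A..int A}" by auto
        ultimately have "(\<Sum>j\<in>{- int A..<int A}. f (real_of_int j)) = (\<Sum>j\<in>{- int A..int A}. f (real_of_int j)) - f (real A)"
          "(\<Sum>j\<in>{- int A..<int A}. f (real_of_int j + 1)) = (\<Sum>j\<in>{- int A..int A}. f (real_of_int j)) - f (- real A)"
          by (simp_all add: algebra_simps)
        then show ?thesis unfolding S_def by (simp add: sum.distrib flip: sum_divide_distrib) (simp add: field_simps)
      qed
      have "(\<Sum>j\<in>{- int A..int A}. f (real_of_int j)) = (\<Sum>j\<in>{- int A..int A} - J. f (real_of_int j)) + (\<Sum>j\<in>J. f (real_of_int j))"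
        using JA J by (intro sum.subset_diff) auto
      then have "(\<Sum>j\<in>J. f (real_of_int j)) - integral {- real A..real A} (\<lambda>x. f x * complex_of_real (dirichlet M x))
         = (S - integral {- real A..real A} (\<lambda>x. f x * complex_of_real (dirichlet M x)))
           + ((f (real A) + f (- real A)) / 2 - (\<Sum>j\<in>{- int A..int A} - J. f (real_of_int j)))"
        by (simp add: S)
      also have "norm \<dots> \<le> B * I M + ((norm (f (real A)) + norm (f (- real A))) / 2 + T)"
      proof (intro order.trans[OF norm_triangle_ineq] add_mono)
        show "norm (S - integral {- real A..real A} (\<lambda>x. f x * complex_of_real (dirichlet M x))) \<le> B * I M"
          unfolding S_def B_def I_def by (rule poisson_partial[OF deriv cont K a])
        show "norm ((f (real A) + f (- real A)) / 2 - (\<Sum>j\<in>{- int A..int A} - J. f (real_of_int j)))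
           \<le> (norm (f (real A)) + norm (f (- real A))) / 2 + T"
          using order.trans[OF norm_sum T[of A]]
          by (intro order.trans[OF norm_triangle_ineq4] add_mono) (auto simp: norm_divide intro!: divide_right_mono norm_triangle_ineq)
      qed
      finally show ?thesis by simp
    qed
    moreover have "(\<lambda>A. norm ((\<Sum>j\<in>J. f (real_of_int j)) - integral {- real A..real A} (\<lambda>x. f x * complex_of_real (dirichlet M x))))
       \<longlonglongrightarrow> norm ((\<Sum>j\<in>J. f (real_of_int j)) - D)"
      unfolding D_def by (intro tendsto_intros integral_Icc_tendsto intD)
    moreover have "(\<lambda>A. T + B * I M + (norm (f (real A)) + norm (f (- real A))) / 2) \<longlonglongrightarrow> T + B * I M + (norm (0::complex) + norm (0::complex)) / 2"
      using filterlim_compose[OF lim(1) filterlim_real_sequentially]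
        filterlim_compose[OF lim(2) filterlim_compose[OF filterlim_uminus_at_bot_at_top filterlim_real_sequentially]]
      by (intro tendsto_intros) auto
    ultimately have 1: "norm ((\<Sum>j\<in>J. f (real_of_int j)) - D) \<le> T + B * I M + (norm (0::complex) + norm (0::complex)) / 2"
      by (intro tendsto_le[OF sequentially_bot]) (auto intro: eventually_sequentiallyI[of A0])
    have 2: "norm (\<Sum>m=1..M. F (real m) + F (- real m)) \<le> Q"
      using Q[of M] unfolding F_def by (intro order.trans[OF norm_sum] order.trans[OF sum_mono[OF norm_triangle_ineq]])
    have "(\<Sum>j\<in>J. f (real_of_int j)) - (LINT x|lborel. f x) = ((\<Sum>j\<in>J. f (real_of_int j)) - D) + (\<Sum>m=1..M. F (real m) + F (- real m))"
      by (simp add: D)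
    also have "norm \<dots> \<le> (T + B * I M + (norm (0::complex) + norm (0::complex)) / 2) + Q"
      by (intro order.trans[OF norm_triangle_ineq] add_mono 1 2)
    finally show ?thesis by simp
  qed
  moreover have "(\<lambda>M. T + Q + B * I M) \<longlonglongrightarrow> T + Q + B * 0"
    unfolding I_def by (intro tendsto_intros integral_abs_sawtooth_rem_tendsto_0)
  ultimately show ?thesis
    by (intro LIMSEQ_le_const[of "\<lambda>M. T + Q + B * I M"]) auto
qed

text \<open>Sampling with step h repeats the transform with period 2 pi / h, so the error consists
  of the samples outside J and the aliases of psi_n at y + 2 pi m / h and y - 2 pi m / h with m >=
  1.\<close>

lemma hermite_fun_poisson:
  assumes h: "h > 0" and J: "finite J"
    and T: "\<And>A. (\<Sum>j\<in>{- int A..int A} - J. \<bar>hermite_fun n (h * real_of_int j)\<bar>) \<le> T"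
    and Q: "\<And>M. (\<Sum>m=1..M. \<bar>hermite_fun n (y + 2 * pi * real m / h)\<bar> + \<bar>hermite_fun n (y - 2 * pi * real m / h)\<bar>) \<le> Q"
  shows "norm (complex_of_real h * (\<Sum>j\<in>J. complex_of_real (hermite_fun n (h * real_of_int j)) * exp (\<i> * complex_of_real (h * real_of_int j * y)))
            - complex_of_real (sqrt (2 * pi)) * \<i> ^ n * complex_of_real (hermite_fun n y))
        \<le> h * T + sqrt (2 * pi) * Q"
proof -
  define g where "g x = complex_of_real (hermite_fun n x) * exp (\<i> * complex_of_real (x * y))" for x
  define f where "f x = g (h * x)" for x
  define f' where "f' x = complex_of_real h * hermite_fun_exp_deriv n y (h * x)" for x
  have gb: "gauss_bounded g" unfolding g_def by (rule gauss_bounded_hermite_fun_exp)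
  have Fint: "(LINT x|lborel. f x * exp (\<i> * complex_of_real (2 * pi * w * x)))
      = complex_of_real (sqrt (2 * pi) / h) * \<i> ^ n * complex_of_real (hermite_fun n (y + 2 * pi * w / h))" for w
  proof -
    have "complex_of_real (sqrt (2 * pi)) * \<i> ^ n * complex_of_real (hermite_fun n (y + 2 * pi * w / h))
      = (LINT x|lborel. complex_of_real (hermite_fun n x) * exp (\<i> * complex_of_real (x * (y + 2 * pi * w / h))))"
      by (rule hermite_fun_Fourier[symmetric])
    also have "\<dots> = \<bar>h\<bar> *\<^sub>R (LINT x|lborel. complex_of_real (hermite_fun n (0 + h * x)) *
        exp (\<i> * complex_of_real ((0 + h * x) * (y + 2 * pi * w / h))))"
      using h by (intro lborel_integral_real_affine) auto
    also have "(\<lambda>x. complex_of_real (hermite_fun n (0 + h * x)) * exp (\<i> * complex_of_real ((0 + h * x) * (y + 2 * pi * w / h))))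
        = (\<lambda>x. f x * exp (\<i> * complex_of_real (2 * pi * w * x)))"
    proof
      fix x
      have "\<i> * complex_of_real ((0 + h * x) * (y + 2 * pi * w / h))
          = \<i> * complex_of_real (h * x * y) + \<i> * complex_of_real (2 * pi * w * x)"
      proof -
        have "(0 + h * x) * (y + 2 * pi * w / h) = h * x * y + 2 * pi * w * x" using h by (simp add: field_simps)
        then show ?thesis by (simp only: of_real_add distrib_left)
      qed
      then show "complex_of_real (hermite_fun n (0 + h * x)) * exp (\<i> * complex_of_real ((0 + h * x) * (y + 2 * pi * w / h)))
         = f x * exp (\<i> * complex_of_real (2 * pi * w * x))"
        by (simp only: f_def g_def exp_add) simp
    qed
    finally show ?thesis using h by (simp add: scaleR_conv_of_real field_simps)
  qed
  have Fnorm: "norm (LINT x|lborel. f x * exp (\<i> * complex_of_real (2 * pi * w * x)))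
      = sqrt (2 * pi) / h * \<bar>hermite_fun n (y + 2 * pi * w / h)\<bar>" for w
    unfolding Fint using h by (simp add: norm_mult norm_power norm_divide)
  obtain K where K: "K \<ge> 0" "\<And>x. norm (hermite_fun_exp_deriv n y x) \<le> K * exp (- (x\<^sup>2) / 4)"
    using gauss_boundedE[OF gauss_bounded_hermite_fun_exp_deriv] by blast
  have "norm ((\<Sum>j\<in>J. f (real_of_int j)) - (LINT x|lborel. f x)) \<le> T + sqrt (2 * pi) / h * Q"
  proof (rule poisson_bound[where f' = f' and a = "h\<^sup>2 / 2" and K = "h * K * exp (h\<^sup>2 / 4)"])
    fix x
    have "((\<lambda>x. h * x) has_vector_derivative h) (at x)"
      by (auto intro!: derivative_eq_intros)
    from vector_diff_chain_at[OF this has_vector_derivative_hermite_fun_exp]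
    have "((g \<circ> (\<lambda>x. h * x)) has_vector_derivative (h *\<^sub>R hermite_fun_exp_deriv n y (h * x))) (at x)"
      unfolding g_def .
    then show "(f has_vector_derivative f' x) (at x)"
      by (simp add: f_def[abs_def] f'_def o_def scaleR_conv_of_real)
    show "isCont f' x" unfolding f'_def
      by (intro continuous_intros isCont_o2[OF _ isCont_hermite_fun_exp_deriv])
    have "norm (f' x) \<le> h * (K * exp (- ((h * x)\<^sup>2) / 4))"
      using h K(2)[of "h * x"] by (simp add: f'_def norm_mult)
    \<comment> \<open>\<open>poisson_bound\<close> wants exponential decay; x^2 >= 2 |x| - 1
      supplies it and fixes the rate h^2 / 2 and the factor exp (h^2 / 4).\<close>
    also have "exp (- ((h * x)\<^sup>2) / 4) \<le> exp (h\<^sup>2 / 4 - h\<^sup>2 / 2 * \<bar>x\<bar>)"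
    proof -
      have "0 \<le> h\<^sup>2 * (\<bar>x\<bar> - 1)\<^sup>2" by simp
      then have "h\<^sup>2 * (2 * \<bar>x\<bar>) \<le> h\<^sup>2 * x\<^sup>2 + h\<^sup>2"
        by (simp add: power2_diff algebra_simps)
      then show ?thesis by (simp add: power_mult_distrib)
    qed
    also have "exp (h\<^sup>2 / 4 - h\<^sup>2 / 2 * \<bar>x\<bar>) = exp (h\<^sup>2 / 4) * exp (- (h\<^sup>2 / 2) * \<bar>x\<bar>)"
      by (simp flip: exp_add)
    finally show "norm (f' x) \<le> h * K * exp (h\<^sup>2 / 4) * exp (- (h\<^sup>2 / 2) * \<bar>x\<bar>)"
      using h K(1) by (simp add: mult_left_mono mult.assoc)
  next
    have "g \<in> borel_measurable borel" unfolding g_def by measurable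
    then have "integrable lborel (\<lambda>x. g (0 + h * x))"
      using h lborel_integrable_real_affine[OF gauss_bounded_integrable[OF gb], of h 0] by blast
    then show "integrable lborel f" by (simp add: f_def[abs_def])
    show "(f \<longlongrightarrow> 0) at_top" unfolding f_def
      by (rule filterlim_compose[OF gauss_bounded_tendsto_0(1)[OF gb]])
         (use h in \<open>auto intro: filterlim_tendsto_pos_mult_at_top[OF tendsto_const _ filterlim_ident]\<close>)
    show "(f \<longlongrightarrow> 0) at_bot" unfolding f_def
      by (rule filterlim_compose[OF gauss_bounded_tendsto_0(2)[OF gb]])
         (use h in \<open>auto intro: filterlim_tendsto_pos_mult_at_bot[OF tendsto_const _ filterlim_ident]\<close>)
    show "(\<Sum>j\<in>{- int A..int A} - J. norm (f (real_of_int j))) \<le> T" for A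
      using T[of A] by (simp add: f_def g_def norm_mult del: of_real_mult)
    show "(\<Sum>m=1..M. norm (LINT x|lborel. f x * exp (\<i> * complex_of_real (2 * pi * real m * x)))
         + norm (LINT x|lborel. f x * exp (\<i> * complex_of_real (2 * pi * - real m * x)))) \<le> sqrt (2 * pi) / h * Q" for M
    proof -
      have "(\<Sum>m=1..M. norm (LINT x|lborel. f x * exp (\<i> * complex_of_real (2 * pi * real m * x)))
         + norm (LINT x|lborel. f x * exp (\<i> * complex_of_real (2 * pi * - real m * x))))
        = sqrt (2 * pi) / h * (\<Sum>m=1..M. \<bar>hermite_fun n (y + 2 * pi * real m / h)\<bar> + \<bar>hermite_fun n (y - 2 * pi * real m / h)\<bar>)"
        unfolding Fnorm by (simp add: sum_distrib_left distrib_left)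
      also have "\<dots> \<le> sqrt (2 * pi) / h * Q" using h Q[of M] by (intro mult_left_mono) auto
      finally show ?thesis .
    qed
  qed (use h J in auto)
  then have "h * norm ((\<Sum>j\<in>J. f (real_of_int j)) - (LINT x|lborel. f x)) \<le> h * (T + sqrt (2 * pi) / h * Q)"
    using h by (intro mult_left_mono) auto
  also have "h * norm ((\<Sum>j\<in>J. f (real_of_int j)) - (LINT x|lborel. f x))
     = norm (complex_of_real h * ((\<Sum>j\<in>J. f (real_of_int j)) - (LINT x|lborel. f x)))"
    using h by (simp add: norm_mult)
  also have "complex_of_real h * ((\<Sum>j\<in>J. f (real_of_int j)) - (LINT x|lborel. f x))
     = complex_of_real h * (\<Sum>j\<in>J. f (real_of_int j)) - complex_of_real (sqrt (2 * pi)) * \<i> ^ n * complex_of_real (hermite_fun n y)"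
    using Fint[of 0] h by (simp add: right_diff_distrib)
  also have "h * (T + sqrt (2 * pi) / h * Q) = h * T + sqrt (2 * pi) * Q" using h by (simp add: field_simps)
  finally show ?thesis unfolding f_def g_def .
qed

section \<open>Tails beyond the grid and at the aliases\<close>

lemma exp_neg_3_8: "1 / (1 - exp (- (3/8::real))) \<le> 4"
proof -
  have "1 + 3/8 \<le> exp (3/8::real)" by (rule exp_ge_add_one_self)
  then have "exp (- (3/8::real)) \<le> 8/11" by (simp add: exp_minus field_simps)
  then show ?thesis by (simp add: field_simps)
qed

lemma finite_idx [simp]: "finite (idx N)"
  by (simp add: idx_def)

text \<open>For r = |j| >= N/2 the Gaussian exponent is at least pi r / 4 >= 3 r / 4. One half of
  it, 3 r / 8 >= 3 N / 16, is the prefactor; the other half is summed as a geometric series of ratio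
  exp (- 3/8).\<close>

lemma hermite_fun_grid_tail:
  assumes N: "even N" "2 \<le> N" and h: "h\<^sup>2 \<ge> 2 * pi / real N"
  shows "(\<Sum>j\<in>{- int A..int A} - idx N. \<bar>hermite_fun n (h * real_of_int j)\<bar>) \<le> 8 * 4 ^ n * exp (- (3 * real N / 16))"
proof -
  have "(\<Sum>j\<in>{- int A..int A} - idx N. \<bar>hermite_fun n (h * real_of_int j)\<bar>)
      \<le> (\<Sum>j\<in>{- int A..int A} - idx N. 4 ^ n * exp (- (3 * real N / 16)) * exp (- (3/8) * \<bar>real_of_int j\<bar>))"
  proof (rule sum_mono)
    fix j assume j: "j \<in> {- int A..int A} - idx N"
    define r where "r = \<bar>real_of_int j\<bar>"
    \<comment> \<open>The index set is asymmetric: j = N/2 already lies in the tail, so equality can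
      occur.\<close>
    have "int N \<le> 2 * \<bar>j\<bar>" using j N(1) by (auto simp: idx_def)
    then have "real_of_int (int N) \<le> real_of_int (2 * \<bar>j\<bar>)" by (simp only: of_int_le_iff)
    then have r: "real N \<le> 2 * r" by (simp add: r_def)
    have "3/2 * r * real N \<le> 3/2 * r * (2 * r)" using r by (intro mult_left_mono) (auto simp: r_def)
    also have "\<dots> = 3 * r * r" by simp
    also have "\<dots> \<le> pi * r * r" using pi_gt3 by (intro mult_right_mono) (auto simp: r_def)
    finally have "3/4 * r \<le> (2 * pi / real N) * r\<^sup>2 / 4" using N by (simp add: field_simps power2_eq_square)
    also have "\<dots> \<le> h\<^sup>2 * r\<^sup>2 / 4" using h by (intro divide_right_mono mult_right_mono) auto
    also have "\<dots> = (h * real_of_int j)\<^sup>2 / 4" by (simp add: r_def power_mult_distrib)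
    finally have e: "3/4 * r \<le> (h * real_of_int j)\<^sup>2 / 4" .
    have "\<bar>hermite_fun n (h * real_of_int j)\<bar> \<le> 4 ^ n * exp (- ((h * real_of_int j)\<^sup>2) / 4)" by (rule hermite_fun_bound)
    also have "\<dots> \<le> 4 ^ n * exp (- (3 * real N / 16) + - (3/8) * r)"
      using e r by (intro mult_left_mono) auto
    finally show "\<bar>hermite_fun n (h * real_of_int j)\<bar> \<le> 4 ^ n * exp (- (3 * real N / 16)) * exp (- (3/8) * \<bar>real_of_int j\<bar>)"
      by (simp only: exp_add mult.assoc r_def)
  qed
  also have "\<dots> \<le> (\<Sum>j\<in>{- int (Suc A)..<int (Suc A)}. 4 ^ n * exp (- (3 * real N / 16)) * exp (- (3/8) * \<bar>real_of_int j\<bar>))"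
    by (rule sum_mono2) auto
  also have "\<dots> = 4 ^ n * exp (- (3 * real N / 16)) * (\<Sum>j\<in>{- int (Suc A)..<int (Suc A)}. exp (- (3/8) * \<bar>real_of_int j\<bar>))"
    by (rule sum_distrib_left[symmetric])
  also have "\<dots> \<le> 4 ^ n * exp (- (3 * real N / 16)) * 8"
    using exp_neg_3_8 by (intro mult_left_mono order.trans[OF sum_exp_neg_abs_le]) auto
  finally show ?thesis by simp
qed

text \<open>The exponent 3 m N / 8 is again halved: 3 m N / 16 is at least 3 N / 16 because m >= 1,
  and at least 3 m / 8 because N >= 2.\<close>

lemma hermite_fun_alias_tail:
  assumes N: "2 \<le> N"
    and p: "\<And>m. m \<ge> 1 \<Longrightarrow> 3/2 * real m * real N \<le> (y + 2 * pi * real m / h)\<^sup>2"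
    and q: "\<And>m. m \<ge> 1 \<Longrightarrow> 3/2 * real m * real N \<le> (y - 2 * pi * real m / h)\<^sup>2"
  shows "(\<Sum>m=1..M. \<bar>hermite_fun n (y + 2 * pi * real m / h)\<bar> + \<bar>hermite_fun n (y - 2 * pi * real m / h)\<bar>)
       \<le> 8 * 4 ^ n * exp (- (3 * real N / 16))"
proof -
  have tm: "\<bar>hermite_fun n z\<bar> \<le> 4 ^ n * exp (- (3 * real N / 16)) * exp (- (3/8)) ^ m"
    if "m \<ge> 1" "3/2 * real m * real N \<le> z\<^sup>2" for m z
  proof -
    have "1 * real N \<le> real m * real N" using that(1) by (intro mult_right_mono) auto
    moreover have "real m * 2 \<le> real m * real N" using N by (intro mult_left_mono) auto
    ultimately have e: "3 * real N / 16 + 3/8 * real m \<le> z\<^sup>2 / 4" using that(2) by simp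
    have "\<bar>hermite_fun n z\<bar> \<le> 4 ^ n * exp (- (z\<^sup>2) / 4)" by (rule hermite_fun_bound)
    also have "\<dots> \<le> 4 ^ n * exp (- (3 * real N / 16) + real m * - (3/8))"
      using e by (intro mult_left_mono) auto
    finally show ?thesis by (simp only: exp_add exp_of_nat_mult mult.assoc)
  qed
  have "(\<Sum>m=1..M. \<bar>hermite_fun n (y + 2 * pi * real m / h)\<bar> + \<bar>hermite_fun n (y - 2 * pi * real m / h)\<bar>)
      \<le> (\<Sum>m=1..M. 2 * (4 ^ n * exp (- (3 * real N / 16))) * exp (- (3/8)) ^ m)"
  proof (rule sum_mono)
    fix m assume "m \<in> {1..M}"
    then have m: "m \<ge> 1" by simp
    show "\<bar>hermite_fun n (y + 2 * pi * real m / h)\<bar> + \<bar>hermite_fun n (y - 2 * pi * real m / h)\<bar>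
       \<le> 2 * (4 ^ n * exp (- (3 * real N / 16))) * exp (- (3/8)) ^ m"
      using add_mono[OF tm[OF m p[OF m]] tm[OF m q[OF m]]] by (simp add: mult_ac)
  qed
  also have "\<dots> \<le> (\<Sum>m<Suc M. 2 * (4 ^ n * exp (- (3 * real N / 16))) * exp (- (3/8)) ^ m)"
    by (rule sum_mono2) auto
  also have "\<dots> = 2 * (4 ^ n * exp (- (3 * real N / 16))) * (\<Sum>m<Suc M. exp (- (3/8)) ^ m)"
    by (rule sum_distrib_left[symmetric])
  also have "(\<Sum>m<Suc M. exp (- (3/8::real)) ^ m) \<le> 4"
  proof -
    have "(\<Sum>m<Suc M. exp (- (3/8::real)) ^ m) = (1 - exp (- (3/8)) ^ Suc M) / (1 - exp (- (3/8)))"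
      by (subst sum_gp_strict) simp
    also have "\<dots> \<le> 1 / (1 - exp (- (3/8)))" by (intro divide_right_mono) auto
    finally show ?thesis using exp_neg_3_8 by linarith
  qed
  finally show ?thesis by (simp add: mult_ac)
qed

text \<open>The step h is left free because it is used twice: with the grid step for the DFT, and
  with sqrt 2 times the grid step for the norm of the Gaussian.\<close>

lemma hermite_fun_grid_poisson:
  assumes N: "even N" "2 \<le> N" and h: "0 < h" "2 * pi / real N \<le> h\<^sup>2"
    and p: "\<And>m. m \<ge> 1 \<Longrightarrow> 3/2 * real m * real N \<le> (y + 2 * pi * real m / h)\<^sup>2"
    and q: "\<And>m. m \<ge> 1 \<Longrightarrow> 3/2 * real m * real N \<le> (y - 2 * pi * real m / h)\<^sup>2"
  shows "norm (complex_of_real h * (\<Sum>j\<in>idx N. complex_of_real (hermite_fun n (h * real_of_int j)) * exp (\<i> * complex_of_real (h * real_of_int j * y)))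
            - complex_of_real (sqrt (2 * pi)) * \<i> ^ n * complex_of_real (hermite_fun n y))
        \<le> (h + sqrt (2 * pi)) * (8 * 4 ^ n * exp (- (3 * real N / 16)))"
  unfolding distrib_right
  by (intro hermite_fun_poisson hermite_fun_grid_tail hermite_fun_alias_tail assms) auto

section \<open>Matrix exponentials and Duhamel's principle\<close>

definition mvec :: "nat \<Rightarrow> (int \<Rightarrow> int \<Rightarrow> complex) \<Rightarrow> (int \<Rightarrow> complex) \<Rightarrow> int \<Rightarrow> complex" where
  "mvec N A v j = (\<Sum>k\<in>idx N. A j k * v k)"

lemma mvec_sum: "mvec N A (\<lambda>j. \<Sum>n\<in>S. c n * v n j) j = (\<Sum>n\<in>S. c n * mvec N A (v n) j)"
  unfolding mvec_def by (simp add: sum_distrib_left) (subst sum.swap, simp add: mult_ac)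

lemma mvec_diff: "mvec N A (\<lambda>j. v j - w j) j = mvec N A v j - mvec N A w j"
  by (simp add: mvec_def algebra_simps sum_subtractf)

lemma mvec_add: "mvec N A (\<lambda>j. v j + w j) j = mvec N A v j + mvec N A w j"
  by (simp add: mvec_def algebra_simps sum.distrib)

lemma mvec_cmult: "mvec N A (\<lambda>j. c * v j) j = c * mvec N A v j"
  by (simp add: mvec_def sum_distrib_left mult_ac)

lemma mvec_mmult: "mvec N (mmult N A B) v j = mvec N A (mvec N B v) j"
  unfolding mvec_def mmult_def
  by (simp add: sum_distrib_left sum_distrib_right mult.assoc) (subst sum.swap, simp)

lemma mvec_cong: "(\<And>k. k \<in> idx N \<Longrightarrow> v k = w k) \<Longrightarrow> mvec N A v j = mvec N A w j"
  by (simp add: mvec_def)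

lemma norm_mvec_le:
  assumes "\<And>k. k \<in> idx N \<Longrightarrow> norm (A j k) \<le> a" "\<And>k. k \<in> idx N \<Longrightarrow> norm (v k) \<le> b" "0 \<le> a" "0 \<le> b"
  shows "norm (mvec N A v j) \<le> real N * (a * b)"
proof -
  have "norm (mvec N A v j) \<le> (\<Sum>k\<in>idx N. a * b)"
    unfolding mvec_def using assms
    by (intro order.trans[OF norm_sum] sum_mono) (auto simp: norm_mult intro!: mult_mono)
  also have "\<dots> = real (card (idx N)) * (a * b)" by simp
  also have "\<dots> \<le> real N * (a * b)"
    using assms(3,4) by (intro mult_right_mono) (auto simp: idx_def)
  finally show ?thesis .
qed

section \<open>Entries of the matrix exponential as power series\<close>

lemma mpow_cmult: "mpow N (\<lambda>j k. c * A j k) m = (\<lambda>j k. c ^ m * mpow N A m j k)"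
proof (induction m)
  case (Suc m)
  show ?case unfolding mpow.simps Suc.IH mmult_def by (simp add: sum_distrib_left mult_ac)
qed simp

text \<open>The sum of all entry norms dominates every row sum, so it serves as a growth rate for
  the powers.\<close>

lemma norm_mpow_le:
  assumes "j \<in> idx N"
  shows "norm (mpow N A m j k) \<le> (\<Sum>j\<in>idx N. \<Sum>l\<in>idx N. norm (A j l)) ^ m"
  using assms
proof (induction m arbitrary: j)
  case (Suc m)
  let ?B = "\<Sum>j\<in>idx N. \<Sum>l\<in>idx N. norm (A j l)"
  have B: "?B \<ge> 0" by (intro sum_nonneg) auto
  have "norm (mpow N A (Suc m) j k) \<le> (\<Sum>l\<in>idx N. norm (A j l) * ?B ^ m)"
    unfolding mpow.simps mmult_def
    by (intro order.trans[OF norm_sum] sum_mono) (auto simp: norm_mult intro!: mult_left_mono Suc.IH)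
  also have "\<dots> = (\<Sum>l\<in>idx N. norm (A j l)) * ?B ^ m" by (rule sum_distrib_right[symmetric])
  also have "\<dots> \<le> ?B * ?B ^ m"
    using B Suc.prems by (intro mult_right_mono member_le_sum) (auto intro: sum_nonneg)
  finally show ?case by simp
qed (simp add: mid_def)

lemma summable_mpow:
  assumes "j \<in> idx N"
  shows "summable (\<lambda>m. mpow N A m j k / of_nat (fact m) * z ^ m)"
proof (rule summable_comparison_test')
  let ?B = "\<Sum>j\<in>idx N. \<Sum>l\<in>idx N. norm (A j l)"
  show "summable (\<lambda>m. inverse (fact m) * (?B * norm z) ^ m)" by (rule summable_exp)
  fix m :: nat assume "m \<ge> 0"
  have "norm (mpow N A m j k) * norm z ^ m \<le> ?B ^ m * norm z ^ m"
    by (intro mult_right_mono norm_mpow_le assms) auto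
  then have "norm (mpow N A m j k) * norm z ^ m / fact m \<le> ?B ^ m * norm z ^ m / fact m"
    by (intro divide_right_mono) auto
  then show "norm (mpow N A m j k / of_nat (fact m) * z ^ m) \<le> inverse (fact m) * (?B * norm z) ^ m"
    by (simp add: norm_mult norm_divide norm_power power_mult_distrib field_simps)
qed

text \<open>Each entry is an everywhere convergent power series in z. Differentiation shifts its
  coefficients by one, and the shifted coefficients are those of the series multiplied by A from the
  left.\<close>

lemma has_field_derivative_mexp:
  assumes "j \<in> idx N"
  shows "((\<lambda>z. mexp N (\<lambda>j k. z * A j k) j k) has_field_derivative
            (\<Sum>l\<in>idx N. A j l * mexp N (\<lambda>j k. z * A j k) l k)) (at z)"
proof -
  define c where "c j m = mpow N A m j k / of_nat (fact m)" for j m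
  have mexp: "mexp N (\<lambda>j k. z * A j k) j k = (\<Sum>m. c j m * z ^ m)" for z j
    by (simp add: mexp_def mpow_cmult c_def mult.commute)
  have sm: "summable (\<lambda>m. c j m * z ^ m)" if "j \<in> idx N" for j z
    unfolding c_def by (rule summable_mpow[OF that])
  have "diffs (c j) m = (\<Sum>l\<in>idx N. A j l * c l m)" for m
  proof -
    have "diffs (c j) m = (of_nat (Suc m) / of_nat (fact (Suc m))) * mpow N A (Suc m) j k"
      by (simp add: diffs_def c_def)
    also have "(of_nat (Suc m) / of_nat (fact (Suc m)) :: complex) = 1 / of_nat (fact m)"
    proof -
      have "(of_nat (fact (Suc m)) :: complex) = of_nat (Suc m) * of_nat (fact m)" by (simp add: algebra_simps)
      then show ?thesis using of_nat_neq_0[of m, where 'a = complex] by (simp del: of_nat_Suc fact_Suc)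
    qed
    finally have "diffs (c j) m = 1 / of_nat (fact m) * mpow N A (Suc m) j k" .
    moreover have "1 / of_nat (fact m) * mpow N A (Suc m) j k = (\<Sum>l\<in>idx N. A j l * c l m)"
      by (simp add: mmult_def c_def sum_divide_distrib)
    ultimately show ?thesis by (rule trans)
  qed
  then have "(\<Sum>m. diffs (c j) m * z ^ m) = (\<Sum>m. \<Sum>l\<in>idx N. A j l * (c l m * z ^ m))"
    by (simp add: sum_distrib_right mult.assoc)
  also have "\<dots> = (\<Sum>l\<in>idx N. \<Sum>m. A j l * (c l m * z ^ m))"
    by (intro suminf_sum summable_mult sm)
  also have "\<dots> = (\<Sum>l\<in>idx N. A j l * mexp N (\<lambda>j k. z * A j k) l k)"
    unfolding mexp by (intro sum.cong suminf_mult sm) auto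
  finally show ?thesis
    using termdiffs_strong_converges_everywhere[of "c j" z, OF sm[OF assms]]
    unfolding mexp[of _ j] by simp
qed

lemma mexp_0: "mexp N (\<lambda>j k. 0 * A j k) j k = mid j k"
proof -
  have "mexp N (\<lambda>j k. 0 * A j k) j k = (\<Sum>m. mpow N A m j k / of_nat (fact m) * 0 ^ m)"
    by (simp only: mexp_def mpow_cmult) (simp add: mult.commute)
  then show ?thesis by (simp only: powser_zero) simp
qed

lemma has_vector_derivative_Ud:
  assumes "j \<in> idx N"
  shows "((\<lambda>t. mvec N (Ud N t) v j) has_vector_derivative - \<i> * mvec N (Hd N) (mvec N (Ud N t) v) j) (at t)"
proof -
  have U: "Ud N t = mexp N (\<lambda>j k. complex_of_real t * (- \<i> * Hd N j k))" for t
    unfolding Ud_def by (simp add: mult_ac)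
  have d: "((\<lambda>t. Ud N t j k) has_vector_derivative (\<Sum>l\<in>idx N. (- \<i> * Hd N j l) * Ud N t l k)) (at t)" for k
    unfolding U using has_vector_derivative_real_field[OF has_field_derivative_mexp[OF assms, of "\<lambda>j k. - \<i> * Hd N j k" k "complex_of_real t"]]
    by simp
  have "((\<lambda>t. \<Sum>k\<in>idx N. Ud N t j k * v k) has_vector_derivative
      (\<Sum>k\<in>idx N. (\<Sum>l\<in>idx N. (- \<i> * Hd N j l) * Ud N t l k) * v k)) (at t)"
    by (intro has_vector_derivative_sum has_vector_derivative_mult_left d)
  also have "(\<Sum>k\<in>idx N. (\<Sum>l\<in>idx N. (- \<i> * Hd N j l) * Ud N t l k) * v k) = - \<i> * mvec N (Hd N) (mvec N (Ud N t) v) j"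
  proof -
    have "(\<Sum>k\<in>idx N. (\<Sum>l\<in>idx N. (- \<i> * Hd N j l) * Ud N t l k) * v k)
        = (\<Sum>k\<in>idx N. \<Sum>l\<in>idx N. - \<i> * (Hd N j l * (Ud N t l k * v k)))"
      by (simp add: sum_distrib_right mult.assoc)
    also have "\<dots> = (\<Sum>l\<in>idx N. \<Sum>k\<in>idx N. - \<i> * (Hd N j l * (Ud N t l k * v k)))"
      by (rule sum.swap)
    also have "\<dots> = - \<i> * mvec N (Hd N) (mvec N (Ud N t) v) j"
      unfolding mvec_def by (simp only: sum_distrib_left)
    finally show ?thesis .
  qed
  finally show ?thesis unfolding mvec_def .
qed

lemma mvec_Ud_0: "j \<in> idx N \<Longrightarrow> mvec N (Ud N 0) v j = v j"
proof -
  assume j: "j \<in> idx N"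
  have "Ud N 0 j k = mid j k" for k
    unfolding Ud_def using mexp_0[of N "\<lambda>j k. 0" j k] by simp
  then have "mvec N (Ud N 0) v j = (\<Sum>k\<in>idx N. if k = j then v k else 0)"
    unfolding mvec_def by (intro sum.cong) (auto simp: mid_def)
  then show ?thesis using j by simp
qed

section \<open>Energy estimate for the perturbed evolution\<close>

lemma inner_complex_Re: "inner z w = Re (cnj z * w)"
  by (simp add: inner_complex_def)

text \<open>Only the source s can change the norm of u: since H is Hermitian, its term drops out of
  the derivative of the squared norm, and Cauchy-Schwarz bounds the rest by 2 times the norm of u
  times rho.\<close>

lemma duhamel_bound:
  fixes u :: "real \<Rightarrow> int \<Rightarrow> complex"
  assumes herm: "\<And>j k. H k j = cnj (H j k)"
    and deriv: "\<And>t j. j \<in> idx N \<Longrightarrow>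
      ((\<lambda>t. u t j) has_vector_derivative - \<i> * mvec N H (u t) j + s t j) (at t)"
    and u0: "\<And>j. j \<in> idx N \<Longrightarrow> u 0 j = 0"
    and s: "\<And>t. vnorm N (s t) \<le> \<rho>"
  shows "vnorm N (u t) \<le> \<bar>t\<bar> * \<rho>"
proof -
  define n where "n t = (\<Sum>j\<in>idx N. (cmod (u t j))\<^sup>2)" for t
  define n' where "n' t = 2 * (\<Sum>j\<in>idx N. inner (u t j) (s t j))" for t
  have vn: "vnorm N (u t) = sqrt (n t)" for t by (simp add: vnorm_def n_def)
  have n0: "n t \<ge> 0" for t by (simp add: n_def sum_nonneg)
  have rho: "\<rho> \<ge> 0" using order.trans[OF _ s[of 0]] by (simp add: vnorm_def sum_nonneg)
  have dn: "(n has_real_derivative n' t) (at t)" for t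
  proof -
    have "((\<lambda>t. \<Sum>j\<in>idx N. inner (u t j) (u t j)) has_vector_derivative
       (\<Sum>j\<in>idx N. inner (u t j) (- \<i> * mvec N H (u t) j + s t j) + inner (- \<i> * mvec N H (u t) j + s t j) (u t j))) (at t)"
      by (intro has_vector_derivative_sum bounded_bilinear.has_vector_derivative[OF bounded_bilinear_inner] deriv)
    also have "(\<lambda>t. \<Sum>j\<in>idx N. inner (u t j) (u t j)) = n"
      by (simp add: fun_eq_iff n_def dot_square_norm)
    also have "(\<Sum>j\<in>idx N. inner (u t j) (- \<i> * mvec N H (u t) j + s t j) + inner (- \<i> * mvec N H (u t) j + s t j) (u t j))
       = 2 * (\<Sum>j\<in>idx N. inner (u t j) (- \<i> * mvec N H (u t) j)) + n' t"
    proof -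
      have "inner a (b + c) + inner (b + c) a = 2 * inner a b + 2 * inner a c" for a b c :: complex
        by (simp add: inner_commute[of "b + c" a] inner_add_right)
      then show ?thesis unfolding n'_def sum_distrib_left sum.distrib[symmetric] by (simp only:)
    qed
    \<comment> \<open>The form S = (u, H u) is real, so - i S has real part 0.\<close>
    also have "(\<Sum>j\<in>idx N. inner (u t j) (- \<i> * mvec N H (u t) j)) = 0"
    proof -
      define S where "S = (\<Sum>j\<in>idx N. cnj (u t j) * mvec N H (u t) j)"
      have "cnj S = (\<Sum>j\<in>idx N. \<Sum>k\<in>idx N. u t j * (H k j * cnj (u t k)))"
        unfolding S_def mvec_def by (simp add: sum_distrib_left herm[symmetric])
      also have "\<dots> = (\<Sum>k\<in>idx N. \<Sum>j\<in>idx N. u t j * (H k j * cnj (u t k)))"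
        by (rule sum.swap)
      also have "\<dots> = S" unfolding S_def mvec_def by (simp add: sum_distrib_left mult_ac)
      finally have "Im S = 0" by (simp add: complex_eq_iff)
      have "(\<Sum>j\<in>idx N. inner (u t j) (- \<i> * mvec N H (u t) j)) = Re (\<Sum>j\<in>idx N. - \<i> * (cnj (u t j) * mvec N H (u t) j))"
        unfolding inner_complex_Re Re_sum by (intro sum.cong) (auto simp: algebra_simps)
      also have "(\<Sum>j\<in>idx N. - \<i> * (cnj (u t j) * mvec N H (u t) j)) = - \<i> * S"
        unfolding S_def by (rule sum_distrib_left[symmetric])
      also have "Re (- \<i> * S) = 0" using \<open>Im S = 0\<close> by simp
      finally show ?thesis .
    qed
    finally show ?thesis by (simp add: has_real_derivative_iff_has_vector_derivative)
  qed
  have n'_le: "\<bar>n' t\<bar> \<le> 2 * (sqrt (n t) * \<rho>)" for t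
  proof -
    have "\<bar>\<Sum>j\<in>idx N. inner (u t j) (s t j)\<bar> \<le> (\<Sum>j\<in>idx N. \<bar>cmod (u t j)\<bar> * \<bar>cmod (s t j)\<bar>)"
      by (intro order.trans[OF sum_abs] sum_mono) (use Cauchy_Schwarz_ineq2 in auto)
    also have "\<dots> \<le> L2_set (\<lambda>j. cmod (u t j)) (idx N) * L2_set (\<lambda>j. cmod (s t j)) (idx N)"
      by (rule L2_set_mult_ineq)
    also have "\<dots> = sqrt (n t) * vnorm N (s t)" by (simp add: L2_set_def n_def vnorm_def)
    also have "\<dots> \<le> sqrt (n t) * \<rho>" by (intro mult_left_mono s) (simp add: n0)
    finally show ?thesis by (simp add: n'_def)
  qed
  \<comment> \<open>\<open>sqrt (n t)\<close> need not be differentiable where \<open>n t = 0\<close>, hence the regularisation by \<open>\<eta>\<close>.\<close>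
  have "sqrt (n t) \<le> \<bar>t\<bar> * \<rho> + \<eta>" if \<eta>: "\<eta> > 0" for \<eta>
  proof -
    define \<phi> where "\<phi> t = sqrt (n t + \<eta>\<^sup>2)" for t
    have pos: "n t + \<eta>\<^sup>2 > 0" for t using n0[of t] \<eta> by (simp add: add_nonneg_pos)
    have d: "(\<phi> has_real_derivative n' t * (inverse (\<phi> t) / 2)) (at t)" for t
      unfolding \<phi>_def using dn[of t] pos[of t]
      by (auto intro!: derivative_eq_intros simp: field_simps)
    have b: "norm (n' t * (inverse (\<phi> t) / 2)) \<le> \<rho>" for t
    proof -
      have \<phi>: "\<phi> t > 0" "sqrt (n t) \<le> \<phi> t" using pos[of t] by (auto simp: \<phi>_def)
      have "\<bar>n' t\<bar> \<le> 2 * (\<phi> t * \<rho>)"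
        using n'_le[of t] mult_right_mono[OF \<phi>(2) rho] by linarith
      then show ?thesis using \<phi>(1) by (simp add: abs_mult field_simps)
    qed
    have "norm (\<phi> t - \<phi> 0) \<le> \<rho> * norm (t - 0)"
      by (rule field_differentiable_bound[where S = UNIV and f' = "\<lambda>t. n' t * (inverse (\<phi> t) / 2)"])
         (use d b in \<open>auto intro: DERIV_subset\<close>)
    moreover have "\<phi> 0 = \<eta>" using \<eta> u0 by (simp add: \<phi>_def n_def)
    moreover have "sqrt (n t) \<le> \<phi> t" by (simp add: \<phi>_def)
    ultimately show ?thesis by (simp add: mult.commute)
  qed
  then show ?thesis unfolding vn by (rule field_le_epsilon)
qed

section \<open>The centered discrete Fourier transform on sampled Hermite functions\<close>

lemma xd_mvec: "j \<in> idx N \<Longrightarrow> mvec N (xd N) v j = complex_of_real (grid N j) * v j"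
proof -
  assume "j \<in> idx N"
  moreover have "mvec N (xd N) v j = (\<Sum>k\<in>idx N. if k = j then complex_of_real (grid N j) * v k else 0)"
    unfolding mvec_def xd_def by (intro sum.cong) auto
  ultimately show ?thesis by simp
qed

lemma mmult_hermitian:
  assumes "\<And>j k. A k j = cnj (A j k)"
  shows "mmult N A A k j = cnj (mmult N A A j k)"
  by (simp add: mmult_def assms[symmetric] mult.commute)

lemma pd_eq: "pd N j k = (\<Sum>l\<in>idx N. cnj (Fc N l j) * complex_of_real (grid N l) * Fc N l k)"
proof -
  have "mmult N (xd N) (Fc N) l k = complex_of_real (grid N l) * Fc N l k" if "l \<in> idx N" for l
    using xd_mvec[OF that, of "\<lambda>l. Fc N l k"] by (simp add: mmult_def mvec_def)
  then show ?thesis unfolding pd_def mmult_def[of N "Fc_inv N"]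
    by (intro sum.cong) (auto simp: Fc_inv_def)
qed

lemma Hd_hermitian: "Hd N k j = cnj (Hd N j k)"
proof -
  have 1: "mmult N (xd N) (xd N) k j = cnj (mmult N (xd N) (xd N) j k)"
    by (rule mmult_hermitian) (simp add: xd_def)
  have 2: "mmult N (pd N) (pd N) k j = cnj (mmult N (pd N) (pd N) j k)"
    by (rule mmult_hermitian) (simp add: pd_eq mult_ac)
  show ?thesis unfolding Hd_def 1 2 by simp
qed

lemma Hd_mvec: "mvec N (Hd N) v j = (mvec N (xd N) (mvec N (xd N) v) j + mvec N (pd N) (mvec N (pd N) v) j) / 2"
proof -
  have "mvec N (Hd N) v j = (mvec N (mmult N (xd N) (xd N)) v j + mvec N (mmult N (pd N) (pd N)) v j) / 2"
    unfolding mvec_def Hd_def by (simp add: sum.distrib[symmetric] sum_divide_distrib distrib_right)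
  then show ?thesis by (simp only: mvec_mmult)
qed

lemma Fc_sym: "Fc N j k = Fc N k j"
  by (simp add: Fc_def mult.commute mult.left_commute)

lemma norm_Fc: "norm (Fc N j k) = 1 / sqrt (real N)"
  unfolding Fc_def norm_divide by (simp only: norm_exp_i_of_real) simp

definition herm_dr :: "nat \<Rightarrow> nat \<Rightarrow> int \<Rightarrow> real" where
  "herm_dr N n j = (2 * pi / real N) powr (1/4) * hermite_fun n (grid N j)"

lemma herm_d_altdef: "herm_d N n j = complex_of_real (herm_dr N n j)"
  by (simp add: herm_d_def herm_dr_def)

text \<open>The samples are real and the DFT matrix is symmetric, so estimates for the inverse
  follow by conjugation.\<close>

lemma Fc_inv_herm_d: "mvec N (Fc_inv N) (herm_d N n) j = cnj (mvec N (Fc N) (herm_d N n) j)"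
  by (simp add: mvec_def Fc_inv_def herm_d_altdef Fc_sym[of N _ j])

definition half_sqrt :: "nat \<Rightarrow> real" where "half_sqrt n = sqrt (real n / 2)"

lemma half_sqrt_0 [simp]: "half_sqrt 0 = 0"
  by (simp add: half_sqrt_def)

lemma half_sqrt_nonneg [simp]: "half_sqrt n \<ge> 0"
  by (simp add: half_sqrt_def)

lemma half_sqrt_sq: "half_sqrt n * half_sqrt n = real n / 2"
  by (simp add: half_sqrt_def)

lemma half_sqrt_le:
  assumes "n \<le> N" shows "half_sqrt n \<le> real N"
proof (cases "N = 0")
  case False
  then have "1 \<le> real N" "real n \<le> real N" using assms by auto
  then have "real n / 2 \<le> (real N)\<^sup>2"
    using mult_left_mono[of 1 "real N" "real N"] unfolding power2_eq_square by linarith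
  then show ?thesis unfolding half_sqrt_def by (intro real_le_lsqrt) auto
qed (use assms in simp)

lemma grid_herm_dr: "grid N j * herm_dr N n j
    = half_sqrt (Suc n) * herm_dr N (Suc n) j + half_sqrt n * herm_dr N (n - 1) j"
proof -
  have "grid N j * herm_dr N n j = (2 * pi / real N) powr (1/4) * (grid N j * hermite_fun n (grid N j))"
    by (simp add: herm_dr_def)
  then show ?thesis unfolding hermite_fun_mult_x by (simp add: herm_dr_def half_sqrt_def algebra_simps)
qed

lemma grid_herm_d: "complex_of_real (grid N j) * herm_d N n j
    = complex_of_real (half_sqrt (Suc n)) * herm_d N (Suc n) j + complex_of_real (half_sqrt n) * herm_d N (n - 1) j"
  unfolding herm_d_altdef of_real_mult[symmetric] of_real_add[symmetric] grid_herm_dr ..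

section \<open>Grid geometry and the DFT of the samples\<close>

context
  fixes N :: nat
  assumes N: "even N" "2 \<le> N"
begin

abbreviation (input) "h \<equiv> sqrt (2 * pi / real N)"

lemma step_pos: "h > 0" using N by simp

lemma step_sq: "h\<^sup>2 = 2 * pi / real N" using N by simp

lemma step_le: "h \<le> 2"
proof -
  have "2 * pi / real N \<le> pi" using N by (simp add: field_simps)
  also have "\<dots> \<le> 2\<^sup>2" using pi_less_4 by simp
  finally show ?thesis by (intro real_le_lsqrt) auto
qed

text \<open>The square of the weight in \<open>herm_d\<close> is the grid step, so inner products of
  sampled functions are Riemann sums.\<close>

lemma quarter_powr: "(2 * pi / real N) powr (1/4) = sqrt h"
proof -
  have "sqrt h = ((2 * pi / real N) powr (1/2)) powr (1/2)" using N by (simp add: powr_half_sqrt)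
  then show ?thesis by (simp add: powr_powr)
qed

lemma quarter_powr_le: "(2 * pi / real N) powr (1/4) \<le> 3/2"
proof -
  have "(2::real) \<le> (3/2)\<^sup>2" by (simp add: power2_eq_square)
  from order.trans[OF step_le this] show ?thesis
    unfolding quarter_powr by (rule real_le_lsqrt[rotated]) simp
qed

lemma abs_idx_le: "j \<in> idx N \<Longrightarrow> \<bar>real_of_int j\<bar> \<le> real N / 2"
proof -
  assume "j \<in> idx N"
  then have "2 * \<bar>j\<bar> \<le> int N" by (auto simp: idx_def)
  then have "real_of_int (2 * \<bar>j\<bar>) \<le> real_of_int (int N)" by (simp only: of_int_le_iff)
  then show ?thesis by simp
qed

text \<open>pi / h is half the alias period 2 pi / h, so every alias of a grid point stays away from
  the origin.\<close>

lemma abs_grid_le: "j \<in> idx N \<Longrightarrow> \<bar>grid N j\<bar> \<le> pi / h"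
proof -
  assume "j \<in> idx N"
  have "\<bar>grid N j\<bar> = \<bar>real_of_int j\<bar> * h" by (simp add: grid_def abs_mult)
  also have "\<dots> \<le> real N / 2 * h" using abs_idx_le[OF \<open>j \<in> idx N\<close>] step_pos by (intro mult_right_mono) auto
  also have "\<dots> = pi / h"
  proof -
    have "real N / 2 * h\<^sup>2 = pi" unfolding step_sq using N by simp
    moreover have "real N / 2 * x\<^sup>2 = pi \<Longrightarrow> real N / 2 * x = pi / x" if "x > 0" for x :: real
      using that by (simp add: field_simps power2_eq_square)
    ultimately show ?thesis using step_pos by blast
  qed
  finally show ?thesis .
qed

lemma abs_grid_le': "j \<in> idx N \<Longrightarrow> \<bar>grid N j\<bar> \<le> real N"
proof -
  assume "j \<in> idx N"
  have "\<bar>grid N j\<bar> = \<bar>real_of_int j\<bar> * h" by (simp add: grid_def abs_mult)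
  also have "\<dots> \<le> real N / 2 * 2" using abs_idx_le[OF \<open>j \<in> idx N\<close>] step_le step_pos by (intro mult_mono) auto
  finally show ?thesis by simp
qed

lemma abs_herm_dr_le: "\<bar>herm_dr N n j\<bar> \<le> 2 * 4 ^ n"
proof -
  have "4 ^ n * exp (- ((grid N j)\<^sup>2) / 4) \<le> 4 ^ n * 1" by (intro mult_left_mono) auto
  then have "\<bar>hermite_fun n (grid N j)\<bar> \<le> 4 ^ n" using hermite_fun_bound[of n "grid N j"] by linarith
  then have "\<bar>herm_dr N n j\<bar> \<le> 3/2 * 4 ^ n"
    unfolding herm_dr_def abs_mult using quarter_powr_le by (intro mult_mono) auto
  then show ?thesis by (simp add: field_simps)
qed

text \<open>Poisson summation at the grid point y = x_j: the relation h^2 = 2 pi / N turns exp(i h k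
  y) into the DFT kernel.\<close>

lemma Fc_herm_d:
  assumes j: "j \<in> idx N"
  shows "norm (mvec N (Fc N) (herm_d N n) j - \<i> ^ n * herm_d N n j) \<le> 24 * 4 ^ n * exp (- (3 * real N / 16))"
proof -
  define y where "y = grid N j"
  define q where "q = (2 * pi / real N) powr (1/4)"
  define S where "S = (\<Sum>k\<in>idx N. complex_of_real (hermite_fun n (h * real_of_int k)) * exp (\<i> * complex_of_real (h * real_of_int k * y)))"
  have q: "q > 0" "q \<le> 3/2" using N quarter_powr_le by (auto simp: q_def)
  have y: "\<bar>y\<bar> \<le> pi / h" unfolding y_def by (rule abs_grid_le[OF j])
  \<comment> \<open>The m-th alias has modulus at least pi m / h, whose square is pi m^2 N /
    2.\<close>
  have aliasing: "3/2 * real m * real N \<le> z\<^sup>2" if m: "m \<ge> 1" and z: "\<bar>z\<bar> \<ge> 2 * pi * real m / h - pi / h" for m z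
  proof -
    have "pi * real m / h \<le> 2 * pi * real m / h - pi / h"
    proof -
      have "pi * 1 \<le> pi * real m" using m by (intro mult_left_mono) auto
      then show ?thesis unfolding diff_divide_distrib[symmetric] using step_pos by (intro divide_right_mono) auto
    qed
    then have "(pi * real m / h)\<^sup>2 \<le> \<bar>z\<bar>\<^sup>2" using z step_pos by (intro power_mono) auto
    moreover have "(pi * real m / h)\<^sup>2 = pi * (real m * real m * real N) / 2"
      unfolding power_divide step_sq using N by (simp add: power2_eq_square field_simps)
    moreover have "3 * (real m * real N) \<le> pi * (real m * real m * real N)"
      using pi_gt3 m mult_right_mono[of 1 "real m" "real m * real N"] by (intro mult_mono) auto
    ultimately show ?thesis by simp
  qed
  have bound: "norm (complex_of_real h * S - complex_of_real (sqrt (2 * pi)) * \<i> ^ n * complex_of_real (hermite_fun n y))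
     \<le> (h + sqrt (2 * pi)) * (8 * 4 ^ n * exp (- (3 * real N / 16)))"
    unfolding S_def
  proof (rule hermite_fun_grid_poisson[OF N step_pos])
    fix m :: nat assume m: "m \<ge> 1"
    then have "0 \<le> 2 * pi * real m / h" by simp
    then show "3/2 * real m * real N \<le> (y + 2 * pi * real m / h)\<^sup>2" "3/2 * real m * real N \<le> (y - 2 * pi * real m / h)\<^sup>2"
      using y by (intro aliasing[OF m]; linarith)+
  qed (simp add: step_sq)
  \<comment> \<open>The unitary normalisation of the DFT is the step h times that of the Fourier
    transform.\<close>
  have sN: "1 / sqrt (real N) = h / sqrt (2 * pi)" using N by (simp add: real_sqrt_divide)
  have "mvec N (Fc N) (herm_d N n) j = complex_of_real (q / sqrt (2 * pi)) * (complex_of_real h * S)"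
  proof -
    have "Fc N j k * herm_d N n k = complex_of_real (q * (1 / sqrt (real N))) *
        (complex_of_real (hermite_fun n (h * real_of_int k)) * exp (\<i> * complex_of_real (h * real_of_int k * y)))" for k
    proof -
      have "2 * pi * real_of_int j * real_of_int k / real N = h\<^sup>2 * (real_of_int k * real_of_int j)"
        unfolding step_sq by simp
      also have "\<dots> = h * real_of_int k * y" by (simp only: y_def grid_def power2_eq_square mult_ac)
      finally have e: "2 * pi * real_of_int j * real_of_int k / real N = h * real_of_int k * y" .
      have g: "grid N k = h * real_of_int k" by (simp add: grid_def mult.commute)
      show ?thesis unfolding Fc_def herm_d_def e g q_def by simp
    qed
    then have "mvec N (Fc N) (herm_d N n) j = complex_of_real (q * (1 / sqrt (real N))) * S"
      unfolding mvec_def S_def by (simp only: sum_distrib_left)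
    then show ?thesis unfolding sN by simp
  qed
  moreover have "\<i> ^ n * herm_d N n j = complex_of_real (q / sqrt (2 * pi)) * (complex_of_real (sqrt (2 * pi)) * \<i> ^ n * complex_of_real (hermite_fun n y))"
    by (simp add: herm_d_def q_def y_def)
  ultimately have "norm (mvec N (Fc N) (herm_d N n) j - \<i> ^ n * herm_d N n j)
      = (q / sqrt (2 * pi)) * norm (complex_of_real h * S - complex_of_real (sqrt (2 * pi)) * \<i> ^ n * complex_of_real (hermite_fun n y))"
    using q by (simp only: right_diff_distrib[symmetric] norm_mult norm_of_real) simp
  also have "\<dots> \<le> (q / sqrt (2 * pi)) * ((h + sqrt (2 * pi)) * (8 * 4 ^ n * exp (- (3 * real N / 16))))"
    using q by (intro mult_left_mono bound) auto
  also have "\<dots> = (q * h / sqrt (2 * pi) + q) * (8 * 4 ^ n * exp (- (3 * real N / 16)))"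
    by (simp add: field_simps)
  also have "\<dots> \<le> 3 * (8 * 4 ^ n * exp (- (3 * real N / 16)))"
  proof (intro mult_right_mono)
    have "2 \<le> sqrt (2 * pi)" using pi_gt3 by (intro real_le_rsqrt) auto
    moreover have "q * h \<le> 3/2 * 2" using q step_le step_pos by (intro mult_mono) auto
    ultimately have "q * h / sqrt (2 * pi) \<le> 3 / 2" using q step_pos by (intro frac_le) auto
    then show "q * h / sqrt (2 * pi) + q \<le> 3" using q by linarith
  qed auto
  finally show ?thesis by simp
qed

text \<open>Squaring the Gaussian rescales its argument by sqrt 2: psi_0(x)^2 = psi_0(sqrt 2 x) / c
  with c = pi^(1/4). The sum of squares is thus Poisson summation of psi_0 itself at y = 0 with step
  sqrt 2 h.\<close>

lemma sum_herm_dr_0_sq: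
  "\<bar>(\<Sum>j\<in>idx N. herm_dr N 0 j * herm_dr N 0 j) - 1\<bar> \<le> 48 * exp (- (3 * real N / 16))"
proof -
  define h' where "h' = sqrt 2 * h"
  define c where "c = sqrt (sqrt pi)"
  have c: "c \<ge> 1" "c * c = sqrt pi" using pi_gt3 by (auto simp: c_def)
  have h': "h' > 0" using step_pos by (simp add: h'_def)
  have h'2: "h'\<^sup>2 = 4 * pi / real N" unfolding h'_def power_mult_distrib step_sq by simp
  have psi0: "hermite_fun 0 x = exp (- (x\<^sup>2) / 2) / c" for x by (simp add: hermite_fun_def c_def)
  define S where "S = (\<Sum>k\<in>idx N. hermite_fun 0 (h' * real_of_int k))"
  \<comment> \<open>At y = 0 the alias has modulus exactly 2 pi m / h', which compensates for the
    larger step.\<close>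
  have aliasing: "3/2 * real m * real N \<le> z\<^sup>2" if m: "m \<ge> 1" and z: "\<bar>z\<bar> = 2 * pi * real m / h'" for m z
  proof -
    have "\<bar>z\<bar>\<^sup>2 = pi * (real m * real m * real N)"
      unfolding z power_divide h'2 using N by (simp add: power2_eq_square field_simps)
    moreover have "3 * (real m * real N) \<le> pi * (real m * real m * real N)"
      using pi_gt3 m mult_right_mono[of 1 "real m" "real m * real N"] by (intro mult_mono) auto
    moreover have "0 \<le> real m * real N" by simp
    ultimately show ?thesis unfolding power2_abs by linarith
  qed
  have "norm (complex_of_real h' * (\<Sum>k\<in>idx N. complex_of_real (hermite_fun 0 (h' * real_of_int k)) * exp (\<i> * complex_of_real (h' * real_of_int k * 0)))
       - complex_of_real (sqrt (2 * pi)) * \<i> ^ 0 * complex_of_real (hermite_fun 0 0))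
     \<le> (h' + sqrt (2 * pi)) * (8 * 4 ^ 0 * exp (- (3 * real N / 16)))"
  proof (rule hermite_fun_grid_poisson[OF N h'])
    show "2 * pi / real N \<le> h'\<^sup>2" unfolding h'2 by (simp add: divide_right_mono)
    fix m :: nat assume m: "m \<ge> 1"
    show "3/2 * real m * real N \<le> (0 + 2 * pi * real m / h')\<^sup>2" "3/2 * real m * real N \<le> (0 - 2 * pi * real m / h')\<^sup>2"
      using h' by (intro aliasing[OF m]; simp)+
  qed
  also have "complex_of_real h' * (\<Sum>k\<in>idx N. complex_of_real (hermite_fun 0 (h' * real_of_int k)) * exp (\<i> * complex_of_real (h' * real_of_int k * 0)))
       - complex_of_real (sqrt (2 * pi)) * \<i> ^ 0 * complex_of_real (hermite_fun 0 0) = complex_of_real (h' * S - sqrt (2 * pi) / c)"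
    by (simp add: S_def psi0)
  finally have b: "\<bar>h' * S - sqrt (2 * pi) / c\<bar> \<le> (h' + sqrt (2 * pi)) * (8 * exp (- (3 * real N / 16)))"
    unfolding norm_of_real by simp
  have "(\<Sum>j\<in>idx N. herm_dr N 0 j * herm_dr N 0 j) = h * (S / c)"
  proof -
    have "herm_dr N 0 j * herm_dr N 0 j = h * (hermite_fun 0 (h' * real_of_int j) / c)" for j
    proof -
      have "herm_dr N 0 j * herm_dr N 0 j = (sqrt h * sqrt h) * (hermite_fun 0 (grid N j) * hermite_fun 0 (grid N j))"
        unfolding herm_dr_def quarter_powr by (simp only: mult_ac)
      also have "sqrt h * sqrt h = h" using step_pos by simp
      also have "hermite_fun 0 (grid N j) * hermite_fun 0 (grid N j) = hermite_fun 0 (h' * real_of_int j) / c"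
      proof -
        have "(h' * real_of_int j)\<^sup>2 = 2 * (grid N j)\<^sup>2" by (simp add: h'_def grid_def power_mult_distrib)
        then show ?thesis unfolding hermite_fun_0_sq unfolding psi0 by (simp add: c(2))
      qed
      finally show ?thesis .
    qed
    then show ?thesis by (simp add: S_def sum_distrib_left sum_divide_distrib)
  qed
  also have "h * (S / c) - 1 = (h' * S - sqrt (2 * pi) / c) / (sqrt 2 * c)"
  proof -
    have "sqrt 2 * (c * c) = sqrt (2 * pi)" unfolding c(2) by (simp add: real_sqrt_mult)
    then show ?thesis using c(1) by (simp add: h'_def field_simps)
  qed
  also have "\<bar>\<dots>\<bar> \<le> \<bar>h' * S - sqrt (2 * pi) / c\<bar> / 1"
  proof -
    have "1 * 1 \<le> sqrt 2 * c" using c(1) by (intro mult_mono) auto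
    then show ?thesis unfolding abs_divide by (intro divide_left_mono) auto
  qed
  also have "\<dots> \<le> (h' + sqrt (2 * pi)) * (8 * exp (- (3 * real N / 16)))" using b by simp
  also have "\<dots> \<le> 6 * (8 * exp (- (3 * real N / 16)))"
  proof (intro mult_right_mono)
    have "sqrt 2 \<le> 3/2" by (intro real_le_lsqrt) (auto simp: power2_eq_square)
    then have "h' \<le> 3/2 * 2" unfolding h'_def using step_le step_pos by (intro mult_mono) auto
    moreover have "sqrt (2 * pi) \<le> 3" using pi_less_4 by (intro real_le_lsqrt) auto
    ultimately show "h' + sqrt (2 * pi) \<le> 6" by linarith
  qed auto
  finally show ?thesis by simp
qed

end

section \<open>Approximate eigenvectors of the discrete Hamiltonian\<close>

lemma i_power_mult_neg_i_power: "\<i> ^ n * (- \<i>) ^ n = 1"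
  by (simp flip: power_mult_distrib)

context
  fixes N L :: nat and \<delta> :: real
  assumes N: "even N" "2 \<le> N" and LN: "L \<le> N"
    and Fc_approx: "\<And>n j. n \<le> L \<Longrightarrow> j \<in> idx N \<Longrightarrow>
      norm (mvec N (Fc N) (herm_d N n) j - \<i> ^ n * herm_d N n j) \<le> \<delta>"
begin

lemma delta_nonneg: "\<delta> \<ge> 0"
proof -
  have "0 \<in> idx N" using N by (auto simp: idx_def)
  from order.trans[OF norm_ge_zero Fc_approx[OF le0 this]] show ?thesis .
qed

lemma Fc_inv_approx:
  assumes "n \<le> L" "j \<in> idx N"
  shows "norm (mvec N (Fc_inv N) (herm_d N n) j - (- \<i>) ^ n * herm_d N n j) \<le> \<delta>"
proof -
  have "mvec N (Fc_inv N) (herm_d N n) j - (- \<i>) ^ n * herm_d N n j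
      = cnj (mvec N (Fc N) (herm_d N n) j - \<i> ^ n * herm_d N n j)"
    by (simp add: Fc_inv_herm_d herm_d_altdef)
  then show ?thesis using Fc_approx[OF assms] by (simp only: complex_mod_cnj)
qed

lemma norm_Fc_le: "norm (Fc N j k) \<le> 1"
  unfolding norm_Fc using N by simp

lemma norm_pd_le: "norm (pd N j k) \<le> real N * real N"
proof -
  have "norm (pd N j k) \<le> (\<Sum>l\<in>idx N. real N)"
    unfolding pd_eq
  proof (intro order.trans[OF norm_sum] sum_mono)
    fix l assume l: "l \<in> idx N"
    have "norm (cnj (Fc N l j) * complex_of_real (grid N l) * Fc N l k) = norm (Fc N l j) * \<bar>grid N l\<bar> * norm (Fc N l k)"
      by (simp add: norm_mult)
    also have "\<dots> \<le> 1 * real N * 1"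
      by (intro mult_mono norm_Fc_le abs_grid_le'[OF N l]) auto
    finally show "norm (cnj (Fc N l j) * complex_of_real (grid N l) * Fc N l k) \<le> real N" by simp
  qed
  also have "\<dots> \<le> real N * real N" by (simp add: idx_def mult_right_mono)
  finally show ?thesis .
qed

lemma pd_mvec: "mvec N (pd N) v j = mvec N (Fc_inv N) (mvec N (xd N) (mvec N (Fc N) v)) j"
  unfolding pd_def mvec_mmult ..

text \<open>The DFT contributes i^n, multiplication by x moves to n + 1 and n - 1, and the inverse
  contributes the power of -i for the new level; the phases that remain are -i and i. The result is
  i times the sampled derivative of psi_n, opposite in sign to the usual momentum, and only its
  square enters \<open>Hd\<close>.\<close>

lemma pd_approx:
  assumes n: "Suc n \<le> L" and j: "j \<in> idx N"
  shows "norm (mvec N (pd N) (herm_d N n) j - \<i> * (complex_of_real (half_sqrt n) * herm_d N (n - 1) j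
            - complex_of_real (half_sqrt (Suc n)) * herm_d N (Suc n) j)) \<le> 2 * real N ^ 2 * \<delta>"
proof -
  define a where "a = complex_of_real (half_sqrt (Suc n))"
  define b where "b = complex_of_real (half_sqrt n)"
  define e where "e l = mvec N (Fc N) (herm_d N n) l - \<i> ^ n * herm_d N n l" for l
  define d where "d m = mvec N (Fc_inv N) (herm_d N m) j - (- \<i>) ^ m * herm_d N m j" for m
  define ge where "ge l = complex_of_real (grid N l) * e l" for l
  have "mvec N (pd N) (herm_d N n) j = mvec N (Fc_inv N)
      (\<lambda>l. (\<i> ^ n * a) * herm_d N (Suc n) l + (\<i> ^ n * b) * herm_d N (n - 1) l + ge l) j"
    unfolding pd_mvec
  proof (rule mvec_cong)
    fix l assume l: "l \<in> idx N"
    have "mvec N (xd N) (mvec N (Fc N) (herm_d N n)) l = complex_of_real (grid N l) * (\<i> ^ n * herm_d N n l + e l)"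
      unfolding xd_mvec[OF l] e_def by simp
    also have "\<dots> = \<i> ^ n * (complex_of_real (grid N l) * herm_d N n l) + ge l"
      by (simp add: algebra_simps ge_def)
    finally show "mvec N (xd N) (mvec N (Fc N) (herm_d N n)) l
        = (\<i> ^ n * a) * herm_d N (Suc n) l + (\<i> ^ n * b) * herm_d N (n - 1) l + ge l"
      unfolding grid_herm_d a_def b_def by (simp add: algebra_simps)
  qed
  also have "\<dots> = (\<i> ^ n * a) * mvec N (Fc_inv N) (herm_d N (Suc n)) j
      + (\<i> ^ n * b) * mvec N (Fc_inv N) (herm_d N (n - 1)) j + mvec N (Fc_inv N) ge j"
    by (simp only: mvec_add mvec_cmult)
  also have "\<dots> = (\<i> ^ n * a) * d (Suc n) + (\<i> ^ n * b) * d (n - 1) + mvec N (Fc_inv N) ge j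
      + (a * (\<i> ^ n * (- \<i>) ^ Suc n) * herm_d N (Suc n) j + b * (\<i> ^ n * (- \<i>) ^ (n - 1)) * herm_d N (n - 1) j)"
    by (simp add: d_def algebra_simps)
  also have "\<i> ^ n * (- \<i>) ^ Suc n = - \<i>"
    using i_power_mult_neg_i_power[of n] by (simp add: mult_ac)
  \<comment> \<open>For n = 0 the exponent \<open>n - 1\<close> truncates and the identity holds
    because b = 0.\<close>
  also have "b * (\<i> ^ n * (- \<i>) ^ (n - 1)) = b * \<i>"
  proof (cases n)
    case (Suc k)
    then show ?thesis using i_power_mult_neg_i_power[of k] by (simp add: mult.assoc)
  qed (simp add: b_def)
  finally have "mvec N (pd N) (herm_d N n) j - \<i> * (b * herm_d N (n - 1) j - a * herm_d N (Suc n) j)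
     = (\<i> ^ n * a) * d (Suc n) + (\<i> ^ n * b) * d (n - 1) + mvec N (Fc_inv N) ge j"
    by (simp add: algebra_simps)
  also have "norm \<dots> \<le> real N * \<delta> + real N * \<delta> + real N * (1 * (real N * \<delta>))"
  proof (intro order.trans[OF norm_triangle_ineq] add_mono)
    have "norm ((\<i> ^ n * a) * d (Suc n)) = half_sqrt (Suc n) * norm (d (Suc n))"
      by (simp add: norm_mult norm_power a_def)
    also have "\<dots> \<le> real N * \<delta>"
      unfolding d_def using n LN by (intro mult_mono half_sqrt_le Fc_inv_approx j) auto
    finally show "norm ((\<i> ^ n * a) * d (Suc n)) \<le> real N * \<delta>" .
    have "norm ((\<i> ^ n * b) * d (n - 1)) = half_sqrt n * norm (d (n - 1))"
      by (simp add: norm_mult norm_power b_def)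
    also have "\<dots> \<le> real N * \<delta>"
      unfolding d_def using n LN by (intro mult_mono half_sqrt_le Fc_inv_approx j) auto
    finally show "norm ((\<i> ^ n * b) * d (n - 1)) \<le> real N * \<delta>" .
    show "norm (mvec N (Fc_inv N) ge j) \<le> real N * (1 * (real N * \<delta>))"
    proof (rule norm_mvec_le)
      fix k assume k: "k \<in> idx N"
      show "norm (Fc_inv N j k) \<le> 1" using norm_Fc_le by (simp add: Fc_inv_def)
      show "norm (ge k) \<le> real N * \<delta>"
        unfolding ge_def norm_mult norm_of_real e_def
        using n by (intro mult_mono abs_grid_le'[OF N k] Fc_approx k) auto
    qed (use delta_nonneg in auto)
  qed
  also have "\<dots> = (2 * real N + real N ^ 2) * \<delta>" by (simp add: algebra_simps power2_eq_square)
  also have "\<dots> \<le> (2 * real N ^ 2) * \<delta>"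
    using N delta_nonneg by (intro mult_right_mono) (simp_all add: power2_eq_square)
  finally show ?thesis unfolding a_def b_def .
qed

text \<open>In the sum of the two squares the levels n + 2 and n - 2 cancel, while level n collects
  twice (n + 1)/2 + n/2. The fifth power of N arises from applying \<open>pd\<close>, with N entries
  per row of size at most N^2, to an error of order N^2 times delta.\<close>

lemma Hd_approx:
  assumes n: "n + 2 \<le> L" and j: "j \<in> idx N"
  shows "norm (mvec N (Hd N) (herm_d N n) j - complex_of_real (real n + 1/2) * herm_d N n j) \<le> 2 * real N ^ 5 * \<delta>"
proof -
  define s where "s m = complex_of_real (half_sqrt m)" for m
  define p where "p m l = \<i> * (s m * herm_d N (m - 1) l - s (Suc m) * herm_d N (Suc m) l)" for m l
  define e where "e m l = mvec N (pd N) (herm_d N m) l - p m l" for m l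
  have ss: "s m * s m = of_nat m / 2" for m
    unfolding s_def of_real_mult[symmetric] half_sqrt_sq by simp
  have e: "norm (e m l) \<le> 2 * real N ^ 2 * \<delta>" if "Suc m \<le> L" "l \<in> idx N" for m l
    using pd_approx[OF that] by (simp add: e_def p_def s_def)
  have x: "complex_of_real (grid N l) * herm_d N m l = s (Suc m) * herm_d N (Suc m) l + s m * herm_d N (m - 1) l" for m l
    unfolding s_def by (rule grid_herm_d)
  have xx: "mvec N (xd N) (mvec N (xd N) (herm_d N n)) j
      = s (Suc n) * (complex_of_real (grid N j) * herm_d N (Suc n) j) + s n * (complex_of_real (grid N j) * herm_d N (n - 1) j)"
    unfolding xd_mvec[OF j] x[where m = n] by (simp only: distrib_left mult.left_commute[of "complex_of_real (grid N j)"])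
  have "mvec N (pd N) (mvec N (pd N) (herm_d N n)) j
      = mvec N (pd N) (\<lambda>l. (\<i> * s n) * herm_d N (n - 1) l - (\<i> * s (Suc n)) * herm_d N (Suc n) l + e n l) j"
    by (intro mvec_cong) (simp add: e_def p_def algebra_simps)
  also have "\<dots> = (\<i> * s n) * mvec N (pd N) (herm_d N (n - 1)) j
      - (\<i> * s (Suc n)) * mvec N (pd N) (herm_d N (Suc n)) j + mvec N (pd N) (e n) j"
    by (simp only: mvec_add mvec_diff mvec_cmult)
  also have "\<dots> = ((\<i> * s n) * p (n - 1) j - (\<i> * s (Suc n)) * p (Suc n) j)
     + ((\<i> * s n) * e (n - 1) j - (\<i> * s (Suc n)) * e (Suc n) j + mvec N (pd N) (e n) j)"
    by (simp add: e_def algebra_simps)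
  finally have pp: "mvec N (pd N) (mvec N (pd N) (herm_d N n)) j = ((\<i> * s n) * p (n - 1) j - (\<i> * s (Suc n)) * p (Suc n) j)
     + ((\<i> * s n) * e (n - 1) j - (\<i> * s (Suc n)) * e (Suc n) j + mvec N (pd N) (e n) j)" .
  have main: "mvec N (xd N) (mvec N (xd N) (herm_d N n)) j + ((\<i> * s n) * p (n - 1) j - (\<i> * s (Suc n)) * p (Suc n) j)
     = 2 * (complex_of_real (real n + 1/2) * herm_d N n j)"
  proof -
    have ii: "\<i> * (\<i> * z) = - z" for z by simp
    \<comment> \<open>Raising after lowering returns to level n only for n > 0; the factor
      \<open>s n\<close> covers n = 0 here and in \<open>m2\<close>.\<close>
    have m1: "s n * p (n - 1) j = \<i> * (s n * s (n - 1) * herm_d N (n - 1 - 1) j - s n * s n * herm_d N n j)"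
      by (cases n) (simp_all add: p_def s_def algebra_simps)
    have m2: "s n * (complex_of_real (grid N j) * herm_d N (n - 1) j)
        = s n * s n * herm_d N n j + s n * s (n - 1) * herm_d N (n - 1 - 1) j"
      unfolding x by (cases n) (simp_all add: s_def algebra_simps)
    have m3: "s (Suc n) * p (Suc n) j = \<i> * (s (Suc n) * s (Suc n) * herm_d N n j - s (Suc n) * s (Suc (Suc n)) * herm_d N (Suc (Suc n)) j)"
      by (simp add: p_def algebra_simps)
    have m4: "s (Suc n) * (complex_of_real (grid N j) * herm_d N (Suc n) j)
        = s (Suc n) * s (Suc (Suc n)) * herm_d N (Suc (Suc n)) j + s (Suc n) * s (Suc n) * herm_d N n j"
      unfolding x by (simp add: algebra_simps)
    have "mvec N (xd N) (mvec N (xd N) (herm_d N n)) j + ((\<i> * s n) * p (n - 1) j - (\<i> * s (Suc n)) * p (Suc n) j)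
       = 2 * (s (Suc n) * s (Suc n) + s n * s n) * herm_d N n j"
      unfolding xx mult.assoc[of \<i>] m1 m2 m3 m4 by (simp add: ii algebra_simps)
    also have "2 * (s (Suc n) * s (Suc n) + s n * s n) = 2 * complex_of_real (real n + 1/2)"
      unfolding ss by (simp add: field_simps)
    finally show ?thesis by (simp only: mult.assoc)
  qed
  have "mvec N (Hd N) (herm_d N n) j - complex_of_real (real n + 1/2) * herm_d N n j
     = ((mvec N (xd N) (mvec N (xd N) (herm_d N n)) j + ((\<i> * s n) * p (n - 1) j - (\<i> * s (Suc n)) * p (Suc n) j))
        + ((\<i> * s n) * e (n - 1) j - (\<i> * s (Suc n)) * e (Suc n) j + mvec N (pd N) (e n) j)) / 2
        - complex_of_real (real n + 1/2) * herm_d N n j"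
    unfolding Hd_mvec pp by (simp only: add.assoc)
  also have "\<dots> = ((\<i> * s n) * e (n - 1) j - (\<i> * s (Suc n)) * e (Suc n) j + mvec N (pd N) (e n) j) / 2"
    unfolding main by (simp add: field_simps)
  finally have "norm (mvec N (Hd N) (herm_d N n) j - complex_of_real (real n + 1/2) * herm_d N n j)
     = norm ((\<i> * s n) * e (n - 1) j - (\<i> * s (Suc n)) * e (Suc n) j + mvec N (pd N) (e n) j) / 2"
    by (simp only: norm_divide norm_numeral)
  also have "norm ((\<i> * s n) * e (n - 1) j - (\<i> * s (Suc n)) * e (Suc n) j + mvec N (pd N) (e n) j)
     \<le> real N * (2 * real N ^ 2 * \<delta>) + real N * (2 * real N ^ 2 * \<delta>) + real N * ((real N * real N) * (2 * real N ^ 2 * \<delta>))"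
  proof (intro order.trans[OF norm_triangle_ineq] order.trans[OF norm_triangle_ineq4] add_mono)
    show "norm ((\<i> * s n) * e (n - 1) j) \<le> real N * (2 * real N ^ 2 * \<delta>)"
      unfolding norm_mult using n LN half_sqrt_le[of n N]
      by (intro mult_mono e j) (auto simp: s_def)
    show "norm ((\<i> * s (Suc n)) * e (Suc n) j) \<le> real N * (2 * real N ^ 2 * \<delta>)"
      unfolding norm_mult using n LN half_sqrt_le[of "Suc n" N]
      by (intro mult_mono e j) (auto simp: s_def)
    show "norm (mvec N (pd N) (e n) j) \<le> real N * ((real N * real N) * (2 * real N ^ 2 * \<delta>))"
      using n delta_nonneg by (intro norm_mvec_le norm_pd_le e) auto
  qed
  also have "\<dots> = (4 * real N ^ 3 + 2 * real N ^ 5) * \<delta>" by (simp add: algebra_simps eval_nat_numeral)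
  also have "\<dots> \<le> (4 * real N ^ 5) * \<delta>"
  proof (intro mult_right_mono delta_nonneg)
    have "2 * 2 \<le> real N * real N" using N by (intro mult_mono) auto
    then have "real N ^ 3 * 2 \<le> real N ^ 3 * (real N * real N)" by (intro mult_left_mono) auto
    then show "4 * real N ^ 3 + 2 * real N ^ 5 \<le> 4 * real N ^ 5" by (simp add: eval_nat_numeral)
  qed
  finally show ?thesis by (simp add: mult_ac)
qed

end

section \<open>Approximate orthonormality and time evolution\<close>

lemma mvec_adjoint:
  assumes "\<And>j k. H k j = cnj (H j k)"
  shows "(\<Sum>j\<in>idx N. cnj (v j) * mvec N H w j) = (\<Sum>j\<in>idx N. cnj (mvec N H v j) * w j)"
proof -
  have "(\<Sum>j\<in>idx N. cnj (v j) * mvec N H w j) = (\<Sum>j\<in>idx N. \<Sum>k\<in>idx N. cnj (v j) * (H j k * w k))"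
    by (simp add: mvec_def sum_distrib_left)
  also have "\<dots> = (\<Sum>k\<in>idx N. \<Sum>j\<in>idx N. cnj (v j) * (H j k * w k))" by (rule sum.swap)
  also have "\<dots> = (\<Sum>j\<in>idx N. cnj (mvec N H v j) * w j)"
    by (simp add: mvec_def sum_distrib_right sum_distrib_left assms[symmetric] mult_ac)
  finally show ?thesis .
qed

definition gram :: "nat \<Rightarrow> nat \<Rightarrow> nat \<Rightarrow> real" where
  "gram N m n = (\<Sum>j\<in>idx N. herm_dr N m j * herm_dr N n j)"

definition comb :: "nat \<Rightarrow> nat \<Rightarrow> (nat \<Rightarrow> complex) \<Rightarrow> int \<Rightarrow> complex" where
  "comb N N' c j = (\<Sum>n\<le>N'. c n * herm_d N n j)"

definition phase :: "real \<Rightarrow> nat \<Rightarrow> complex" where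
  "phase t n = exp (- \<i> * complex_of_real ((real n + 1/2) * t))"

lemma norm_phase [simp]: "norm (phase t n) = 1"
  unfolding phase_def by (simp add: norm_exp_eq_Re)

lemma has_vector_derivative_phase:
  "((\<lambda>t. phase t n) has_vector_derivative - \<i> * complex_of_real (real n + 1/2) * phase t n) (at t)"
proof -
  have "((\<lambda>z. exp (- \<i> * (complex_of_real (real n + 1/2) * z))) has_field_derivative
     - \<i> * complex_of_real (real n + 1/2) * exp (- \<i> * (complex_of_real (real n + 1/2) * complex_of_real t))) (at (complex_of_real t))"
    by (auto intro!: derivative_eq_intros)
  from has_vector_derivative_real_field[OF this] show ?thesis
    by (simp add: phase_def)
qed

lemma sum_cnj_comb:
  "(\<Sum>j\<in>idx N. cnj (comb N N' c' j) * comb N N' c j)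
    = (\<Sum>m\<le>N'. \<Sum>n\<le>N'. cnj (c' m) * c n * complex_of_real (gram N m n))"
proof -
  have "(\<Sum>j\<in>idx N. cnj (comb N N' c' j) * comb N N' c j)
    = (\<Sum>j\<in>idx N. \<Sum>m\<le>N'. \<Sum>n\<le>N'. cnj (c' m) * c n * complex_of_real (herm_dr N m j * herm_dr N n j))"
    unfolding comb_def cnj_sum sum_product by (simp add: herm_d_altdef mult_ac)
  also have "\<dots> = (\<Sum>m\<le>N'. \<Sum>n\<le>N'. \<Sum>j\<in>idx N. cnj (c' m) * c n * complex_of_real (herm_dr N m j * herm_dr N n j))"
    by (subst sum.swap, rule sum.cong[OF refl], rule sum.swap)
  finally show ?thesis by (simp add: gram_def sum_distrib_left)
qed

lemma vnorm_sq: "(vnorm N v)\<^sup>2 = (\<Sum>j\<in>idx N. (cmod (v j))\<^sup>2)"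
  by (simp add: vnorm_def sum_nonneg)

lemma vnorm_sq_complex: "complex_of_real ((vnorm N v)\<^sup>2) = (\<Sum>j\<in>idx N. cnj (v j) * v j)"
  unfolding vnorm_sq of_real_sum
  by (intro sum.cong refl) (metis complex_norm_square mult.commute)

lemma vnorm_nonneg [simp]: "vnorm N v \<ge> 0"
  by (simp add: vnorm_def sum_nonneg)

lemma norm_le_vnorm: "j \<in> idx N \<Longrightarrow> norm (v j) \<le> vnorm N v"
proof -
  assume "j \<in> idx N"
  then have "(cmod (v j))\<^sup>2 \<le> (vnorm N v)\<^sup>2"
    unfolding vnorm_sq by (intro member_le_sum[where f = "\<lambda>j. (cmod (v j))\<^sup>2"]) auto
  then show ?thesis by (rule power2_le_imp_le) simp
qed

lemma vnorm_le:
  assumes "\<And>j. j \<in> idx N \<Longrightarrow> norm (v j) \<le> b" "b \<ge> 0"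
  shows "vnorm N v \<le> real N * b"
proof (rule power2_le_imp_le)
  have "(vnorm N v)\<^sup>2 \<le> (\<Sum>j\<in>idx N. b\<^sup>2)"
    unfolding vnorm_sq using assms by (intro sum_mono power_mono) auto
  also have "\<dots> = real (card (idx N)) * b\<^sup>2" by simp
  also have "\<dots> \<le> (real N)\<^sup>2 * b\<^sup>2"
  proof (intro mult_right_mono)
    have "card (idx N) \<le> N" by (simp add: idx_def)
    also have "N \<le> N\<^sup>2" by (simp add: power2_eq_square)
    finally have "real (card (idx N)) \<le> real (N\<^sup>2)" by (simp only: of_nat_le_iff)
    then show "real (card (idx N)) \<le> (real N)\<^sup>2" by simp
  qed simp
  finally show "(vnorm N v)\<^sup>2 \<le> (real N * b)\<^sup>2" by (simp add: power_mult_distrib)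
qed (use assms in simp)

lemma norm_sum_cnj_le: "norm (\<Sum>j\<in>idx N. cnj (v j) * w j) \<le> vnorm N v * vnorm N w"
proof -
  have "norm (\<Sum>j\<in>idx N. cnj (v j) * w j) \<le> (\<Sum>j\<in>idx N. \<bar>cmod (v j)\<bar> * \<bar>cmod (w j)\<bar>)"
    by (intro order.trans[OF norm_sum] sum_mono) (simp add: norm_mult)
  also have "\<dots> \<le> L2_set (\<lambda>j. cmod (v j)) (idx N) * L2_set (\<lambda>j. cmod (w j)) (idx N)"
    by (rule L2_set_mult_ineq)
  finally show ?thesis by (simp add: L2_set_def vnorm_def)
qed

context
  fixes N L :: nat and \<delta> \<alpha> :: real
  assumes N: "even N" "2 \<le> N" and LN: "L \<le> N"
    and Fc_approx: "\<And>n j. n \<le> L \<Longrightarrow> j \<in> idx N \<Longrightarrow>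
      norm (mvec N (Fc N) (herm_d N n) j - \<i> ^ n * herm_d N n j) \<le> \<delta>"
    and gram_00: "\<bar>gram N 0 0 - 1\<bar> \<le> \<alpha>"
begin

lemma delta_ge_0: "\<delta> \<ge> 0"
  by (rule delta_nonneg[OF N LN Fc_approx])

definition resid :: "nat \<Rightarrow> int \<Rightarrow> complex" where
  "resid n j = mvec N (Hd N) (herm_d N n) j - complex_of_real (real n + 1/2) * herm_d N n j"

lemma norm_resid: "n + 2 \<le> L \<Longrightarrow> j \<in> idx N \<Longrightarrow> norm (resid n j) \<le> 2 * real N ^ 5 * \<delta>"
  unfolding resid_def by (rule Hd_approx[OF N LN Fc_approx])

lemma norm_herm_d_le: "n \<le> L \<Longrightarrow> norm (herm_d N n j) \<le> 2 * 4 ^ L"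
proof -
  assume "n \<le> L"
  then have "(4::real) ^ n \<le> 4 ^ L" by (intro power_increasing) auto
  then show ?thesis using abs_herm_dr_le[OF N, of n j] unfolding herm_d_altdef norm_of_real by linarith
qed

text \<open>Evaluating the form of \<open>Hd\<close> on both sides gives (n - m) times the inner
  product as a difference of residual terms; distinct levels differ by at least 1, so nothing is
  lost on division.\<close>

lemma gram_offdiag:
  assumes "m \<noteq> n" "m + 2 \<le> L" "n + 2 \<le> L"
  shows "\<bar>gram N m n\<bar> \<le> 8 * real N ^ 6 * 4 ^ L * \<delta>"
proof -
  define G where "G = (\<Sum>j\<in>idx N. cnj (herm_d N m j) * herm_d N n j)"
  have G: "G = complex_of_real (gram N m n)"
    by (simp add: G_def gram_def herm_d_altdef)
  define A where "A = (\<Sum>j\<in>idx N. cnj (herm_d N m j) * resid n j)"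
  define B where "B = (\<Sum>j\<in>idx N. cnj (resid m j) * herm_d N n j)"
  have "(\<Sum>j\<in>idx N. cnj (herm_d N m j) * mvec N (Hd N) (herm_d N n) j) = complex_of_real (real n + 1/2) * G + A"
    unfolding A_def G_def sum_distrib_left sum.distrib[symmetric] resid_def
    by (intro sum.cong) (auto simp: algebra_simps)
  moreover have "(\<Sum>j\<in>idx N. cnj (mvec N (Hd N) (herm_d N m) j) * herm_d N n j) = complex_of_real (real m + 1/2) * G + B"
    unfolding B_def G_def sum_distrib_left sum.distrib[symmetric] resid_def
    by (intro sum.cong) (auto simp: algebra_simps)
  ultimately have "complex_of_real (real n + 1/2) * G + A = complex_of_real (real m + 1/2) * G + B"
    using mvec_adjoint[of "Hd N", OF Hd_hermitian] by simp
  then have "complex_of_real (real n - real m) * G = B - A" by (simp add: algebra_simps)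
  then have "\<bar>real n - real m\<bar> * norm G = norm (B - A)" by (metis norm_mult norm_of_real)
  moreover have "1 \<le> \<bar>real n - real m\<bar>" using assms(1) by linarith
  then have "1 * norm G \<le> \<bar>real n - real m\<bar> * norm G" by (intro mult_right_mono) auto
  moreover have nn: "0 \<le> 2 * real N ^ 5 * \<delta>" "(0::real) \<le> 2 * 4 ^ L" using delta_ge_0 by simp_all
  moreover have "norm B \<le> (\<Sum>j\<in>idx N. (2 * real N ^ 5 * \<delta>) * (2 * 4 ^ L))"
    unfolding B_def using assms delta_ge_0
    by (intro order.trans[OF norm_sum] sum_mono)
       (auto simp only: norm_mult complex_mod_cnj intro!: mult_mono norm_resid norm_herm_d_le norm_ge_zero nn)
  moreover have "norm A \<le> (\<Sum>j\<in>idx N. (2 * 4 ^ L) * (2 * real N ^ 5 * \<delta>))"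
    unfolding A_def using assms delta_ge_0
    by (intro order.trans[OF norm_sum] sum_mono)
       (auto simp only: norm_mult complex_mod_cnj intro!: mult_mono norm_resid norm_herm_d_le norm_ge_zero nn)
  moreover have "(\<Sum>j\<in>idx N. (2 * 4 ^ L) * (2 * real N ^ 5 * \<delta>)) \<le> real N * ((2 * 4 ^ L) * (2 * real N ^ 5 * \<delta>))"
  proof -
    have "real (card (idx N)) * ((2 * 4 ^ L) * (2 * real N ^ 5 * \<delta>)) \<le> real N * ((2 * 4 ^ L) * (2 * real N ^ 5 * \<delta>))"
      using delta_ge_0 by (intro mult_right_mono) (auto simp: idx_def)
    then show ?thesis by (simp only: sum_constant)
  qed
  moreover have "norm (B - A) \<le> norm B + norm A" by (rule norm_triangle_ineq4)
  ultimately have "norm G \<le> 2 * (real N * ((2 * 4 ^ L) * (2 * real N ^ 5 * \<delta>)))" by (simp add: mult_ac)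
  then show ?thesis unfolding G by (simp add: eval_nat_numeral algebra_simps)
qed

text \<open>Both sides come from moving \<open>x\<^sup>d\<close> across the inner product of consecutive states.\<close>

lemma gram_step:
  assumes "n + 4 \<le> L"
  shows "\<bar>gram N (Suc n) (Suc n) - gram N n n\<bar> \<le> 3 * (8 * real N ^ 6 * 4 ^ L * \<delta>)"
proof -
  let ?\<gamma> = "8 * real N ^ 6 * 4 ^ L * \<delta>"
  have "(\<Sum>j\<in>idx N. (grid N j * herm_dr N n j) * herm_dr N (Suc n) j) = (\<Sum>j\<in>idx N. herm_dr N n j * (grid N j * herm_dr N (Suc n) j))"
    by (simp add: mult_ac)
  then have "half_sqrt (Suc n) * gram N (Suc n) (Suc n) + half_sqrt n * gram N (n - 1) (Suc n)
      = half_sqrt (Suc (Suc n)) * gram N n (Suc (Suc n)) + half_sqrt (Suc n) * gram N n n"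
    unfolding grid_herm_dr gram_def sum_distrib_left sum.distrib[symmetric] by (simp add: algebra_simps)
  then have eq: "half_sqrt (Suc n) * (gram N (Suc n) (Suc n) - gram N n n)
      = half_sqrt (Suc (Suc n)) * gram N n (Suc (Suc n)) - half_sqrt n * gram N (n - 1) (Suc n)"
    by (simp add: algebra_simps)
  \<comment> \<open>The ratios of the outer ladder coefficients to \<open>half_sqrt (Suc n)\<close>
    are at most 1 and 2, which add up to the factor 3.\<close>
  have 1: "half_sqrt n \<le> half_sqrt (Suc n)" by (simp add: half_sqrt_def)
  have 2: "half_sqrt (Suc (Suc n)) \<le> 2 * half_sqrt (Suc n)"
    unfolding half_sqrt_def by (rule real_le_lsqrt) (simp_all add: power_mult_distrib)
  have pos: "half_sqrt (Suc n) > 0" by (simp add: half_sqrt_def)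
  have "half_sqrt (Suc n) * \<bar>gram N (Suc n) (Suc n) - gram N n n\<bar>
      = \<bar>half_sqrt (Suc (Suc n)) * gram N n (Suc (Suc n)) - half_sqrt n * gram N (n - 1) (Suc n)\<bar>"
    unfolding eq[symmetric] by (simp add: abs_mult)
  also have "\<dots> \<le> half_sqrt (Suc (Suc n)) * \<bar>gram N n (Suc (Suc n))\<bar> + half_sqrt n * \<bar>gram N (n - 1) (Suc n)\<bar>"
    by (rule order.trans[OF abs_triangle_ineq4]) (simp add: abs_mult)
  also have "\<dots> \<le> (2 * half_sqrt (Suc n)) * ?\<gamma> + half_sqrt (Suc n) * ?\<gamma>"
    using assms 1 2 by (intro add_mono mult_mono gram_offdiag) auto
  also have "\<dots> = half_sqrt (Suc n) * (3 * ?\<gamma>)" by simp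
  finally show ?thesis using pos by (simp only: mult_le_cancel_left_pos)
qed

text \<open>The norms telescope down to n = 0, and at most N steps are taken; this is the seventh
  power of N. The off-diagonal bound is smaller and is absorbed.\<close>

lemma gram_approx:
  assumes "m + 3 \<le> L" "n + 3 \<le> L"
  shows "\<bar>gram N m n - (if m = n then 1 else 0)\<bar> \<le> 24 * real N ^ 7 * 4 ^ L * \<delta> + \<alpha>"
proof -
  let ?\<gamma> = "8 * real N ^ 6 * 4 ^ L * \<delta>"
  have g0: "?\<gamma> \<ge> 0" using delta_ge_0 by simp
  have diag: "\<bar>gram N n n - 1\<bar> \<le> real n * (3 * ?\<gamma>) + \<alpha>" if "n + 3 \<le> L" for n
    using that
  proof (induction n)
    case 0
    then show ?case using gram_00 by simp
  next
    case (Suc n)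
    have "\<bar>gram N (Suc n) (Suc n) - 1\<bar> \<le> \<bar>gram N (Suc n) (Suc n) - gram N n n\<bar> + \<bar>gram N n n - 1\<bar>" by linarith
    also have "\<dots> \<le> 3 * ?\<gamma> + (real n * (3 * ?\<gamma>) + \<alpha>)" using Suc by (intro add_mono gram_step) auto
    finally show ?case by (simp add: algebra_simps)
  qed
  have N7: "24 * real N ^ 7 * 4 ^ L * \<delta> = real N * (3 * ?\<gamma>)" by (simp add: eval_nat_numeral)
  have a0: "\<alpha> \<ge> 0" using gram_00 by linarith
  show ?thesis
  proof (cases "m = n")
    case True
    have "real n * (3 * ?\<gamma>) \<le> real N * (3 * ?\<gamma>)" using assms LN g0 by (intro mult_right_mono) auto
    then show ?thesis using diag[OF assms(2)] True unfolding N7 by simp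
  next
    case False
    have "1 * ?\<gamma> \<le> (real N * 3) * ?\<gamma>" using N g0 by (intro mult_right_mono) auto
    moreover have "\<bar>gram N m n\<bar> \<le> ?\<gamma>" using gram_offdiag[OF False] assms by simp
    moreover have "gram N m n - (if m = n then 1 else 0) = gram N m n" using False by simp
    ultimately show ?thesis using a0 unfolding N7 by (simp only:)
  qed
qed

lemma comb_inner_approx:
  assumes "N' + 3 \<le> L" and c: "\<And>n. n \<le> N' \<Longrightarrow> norm (c n) \<le> 1" and c': "\<And>n. n \<le> N' \<Longrightarrow> norm (c' n) \<le> 1"
  shows "norm ((\<Sum>j\<in>idx N. cnj (comb N N' c' j) * comb N N' c j) - (\<Sum>n\<le>N'. cnj (c' n) * c n))
      \<le> real N ^ 2 * (24 * real N ^ 7 * 4 ^ L * \<delta> + \<alpha>)"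
proof -
  let ?\<Gamma> = "24 * real N ^ 7 * 4 ^ L * \<delta> + \<alpha>"
  have G: "?\<Gamma> \<ge> 0" using delta_ge_0 gram_00 by simp
  have "(\<Sum>n\<le>N'. cnj (c' n) * c n) = (\<Sum>m\<le>N'. \<Sum>n\<le>N'. cnj (c' m) * c n * complex_of_real (if m = n then 1 else 0))"
  proof (rule sum.cong[OF refl])
    fix m assume m: "m \<in> {..N'}"
    have "(\<Sum>n\<le>N'. cnj (c' m) * c n * complex_of_real (if m = n then 1 else 0)) = (\<Sum>n\<le>N'. if n = m then cnj (c' m) * c m else 0)"
      by (intro sum.cong) auto
    then show "cnj (c' m) * c m = (\<Sum>n\<le>N'. cnj (c' m) * c n * complex_of_real (if m = n then 1 else 0))"
      using m by simp
  qed
  then have "(\<Sum>j\<in>idx N. cnj (comb N N' c' j) * comb N N' c j) - (\<Sum>n\<le>N'. cnj (c' n) * c n)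
    = (\<Sum>m\<le>N'. \<Sum>n\<le>N'. cnj (c' m) * c n * complex_of_real (gram N m n - (if m = n then 1 else 0)))"
    unfolding sum_cnj_comb by (simp only: sum_subtractf[symmetric] right_diff_distrib of_real_diff)
  also have "norm \<dots> \<le> (\<Sum>m\<le>N'. \<Sum>n\<le>N'. 1 * 1 * ?\<Gamma>)"
  proof (intro order.trans[OF norm_sum] sum_mono order.trans[OF norm_sum])
    fix m n assume mn: "m \<in> {..N'}" "n \<in> {..N'}"
    have "norm (cnj (c' m) * c n * complex_of_real (gram N m n - (if m = n then 1 else 0)))
        = norm (c' m) * norm (c n) * \<bar>gram N m n - (if m = n then 1 else 0)\<bar>"
      by (simp only: norm_mult complex_mod_cnj norm_of_real)
    also have "\<dots> \<le> 1 * 1 * ?\<Gamma>" using assms mn by (intro mult_mono gram_approx) auto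
    finally show "norm (cnj (c' m) * c n * complex_of_real (gram N m n - (if m = n then 1 else 0))) \<le> 1 * 1 * ?\<Gamma>" .
  qed
  also have "\<dots> = real (Suc N') ^ 2 * ?\<Gamma>" by (simp add: power2_eq_square)
  also have "\<dots> \<le> real N ^ 2 * ?\<Gamma>" using assms(1) LN G by (intro mult_right_mono power_mono) auto
  finally show ?thesis .
qed

text \<open>The candidate solution rotates each coefficient by its own phase. It solves the
  Schroedinger equation of \<open>Hd\<close> up to the residuals, which become the source in
  \<open>duhamel_bound\<close> for the difference from the true evolution.\<close>

lemma evolution_approx:
  assumes "N' + 3 \<le> L" and c: "\<And>n. n \<le> N' \<Longrightarrow> norm (c n) \<le> 1"
  shows "vnorm N (\<lambda>j. mvec N (Ud N t) (comb N N' c) j - comb N N' (\<lambda>n. c n * phase t n) j)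
      \<le> \<bar>t\<bar> * (2 * real N ^ 7 * \<delta>)"
proof -
  define a where "a t = comb N N' (\<lambda>n. c n * phase t n)" for t
  define u where "u t j = mvec N (Ud N t) (comb N N' c) j - a t j" for t j
  define s where "s t j = (\<Sum>n\<le>N'. (- \<i> * c n * phase t n) * resid n j)" for t j
  let ?\<rho> = "2 * real N ^ 5 * \<delta>"
  have "vnorm N (u t) \<le> \<bar>t\<bar> * (real N * (real N * ?\<rho>))"
  proof (rule duhamel_bound[of "Hd N" N u s, OF Hd_hermitian])
    fix t j assume j: "j \<in> idx N"
    have da: "((\<lambda>t. a t j) has_vector_derivative (\<Sum>n\<le>N'. c n * (- \<i> * complex_of_real (real n + 1/2) * phase t n) * herm_d N n j)) (at t)"
      unfolding a_def comb_def
      by (intro has_vector_derivative_sum has_vector_derivative_mult_left has_vector_derivative_mult_right has_vector_derivative_phase)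
    have Ha: "mvec N (Hd N) (a t) j = (\<Sum>n\<le>N'. c n * phase t n * mvec N (Hd N) (herm_d N n) j)"
      unfolding a_def comb_def[abs_def] by (rule mvec_sum)
    \<comment> \<open>Replacing the eigenvalue by \<open>Hd\<close> costs \<open>resid\<close>; the
      sign of s is chosen so that it enters the equation for u with a plus.\<close>
    have eq: "(\<Sum>n\<le>N'. c n * (- \<i> * complex_of_real (real n + 1/2) * phase t n) * herm_d N n j)
        = - \<i> * mvec N (Hd N) (a t) j - s t j"
      unfolding Ha s_def sum_distrib_left sum_distrib_right sum_subtractf[symmetric]
      by (intro sum.cong) (auto simp: resid_def algebra_simps)
    from has_vector_derivative_diff[OF has_vector_derivative_Ud[OF j, of "comb N N' c" t] da, unfolded eq]
    show "((\<lambda>t. u t j) has_vector_derivative - \<i> * mvec N (Hd N) (u t) j + s t j) (at t)"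
      unfolding u_def[abs_def] mvec_diff by (simp add: algebra_simps)
  next
    fix j assume "j \<in> idx N"
    have e: "exp (- \<i> * complex_of_real ((real n + 1/2) * 0)) = 1" for n by simp
    show "u 0 j = 0" unfolding u_def mvec_Ud_0[OF \<open>j \<in> idx N\<close>] a_def phase_def e by simp
  next
    fix t
    show "vnorm N (s t) \<le> real N * (real N * ?\<rho>)"
    proof (rule vnorm_le)
      fix j assume j: "j \<in> idx N"
      have "norm (s t j) \<le> (\<Sum>n\<le>N'. 1 * ?\<rho>)"
        unfolding s_def
      proof (intro order.trans[OF norm_sum] sum_mono)
        fix n assume "n \<in> {..N'}"
        then have "norm ((- \<i> * c n * phase t n) * resid n j) = norm (c n) * norm (resid n j)" "norm (c n) \<le> 1" "norm (resid n j) \<le> ?\<rho>"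
          using c assms(1) by (auto simp: norm_mult intro!: norm_resid j)
        then show "norm ((- \<i> * c n * phase t n) * resid n j) \<le> 1 * ?\<rho>"
          using delta_ge_0 mult_mono[of "norm (c n)" 1 "norm (resid n j)" ?\<rho>] by simp
      qed
      also have "\<dots> = real (Suc N') * ?\<rho>" by simp
      also have "\<dots> \<le> real N * ?\<rho>" using assms(1) LN delta_ge_0 by (intro mult_right_mono) auto
      finally show "norm (s t j) \<le> real N * ?\<rho>" .
    qed (use delta_ge_0 in simp)
  qed
  also have "real N * (real N * ?\<rho>) = 2 * real N ^ 7 * \<delta>" by (simp add: eval_nat_numeral)
  finally show ?thesis unfolding u_def[abs_def] a_def .
qed

end

lemma L2_inner_herm_state:
  "L2_inner (herm_state N' c') (evolved_state t N' c) = (\<Sum>n\<le>N'. cnj (c' n) * (c n * phase t n))"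
proof -
  have I: "integrable lborel (\<lambda>x. cnj (c' m) * (c n * phase t n) * complex_of_real (hermite_fun m x * hermite_fun n x))" for m n
    by (intro integrable_mult_right integrable_of_real integrable_hermite_fun_mult)
  have "L2_inner (herm_state N' c') (evolved_state t N' c) = (LINT x|lborel. (\<Sum>m\<le>N'. \<Sum>n\<le>N'.
      cnj (c' m) * (c n * phase t n) * complex_of_real (hermite_fun m x * hermite_fun n x)))"
    unfolding L2_inner_def herm_state_def evolved_state_def phase_def cnj_sum sum_product
    by (simp add: mult_ac)
  also have "\<dots> = (\<Sum>m\<le>N'. \<Sum>n\<le>N'. LINT x|lborel. cnj (c' m) * (c n * phase t n) * complex_of_real (hermite_fun m x * hermite_fun n x))"
    by (subst Bochner_Integration.integral_sum, intro Bochner_Integration.integrable_sum I)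
       (intro sum.cong refl Bochner_Integration.integral_sum I)
  also have "\<dots> = (\<Sum>m\<le>N'. \<Sum>n\<le>N'. if n = m then cnj (c' m) * (c m * phase t m) else 0)"
  proof (intro sum.cong refl)
    fix m n
    have "(LINT x|lborel. cnj (c' m) * (c n * phase t n) * complex_of_real (hermite_fun m x * hermite_fun n x))
      = cnj (c' m) * (c n * phase t n) * complex_of_real (LINT x|lborel. hermite_fun m x * hermite_fun n x)"
      by (simp only: integral_mult_right_zero integral_complex_of_real)
    then show "(LINT x|lborel. cnj (c' m) * (c n * phase t n) * complex_of_real (hermite_fun m x * hermite_fun n x))
      = (if n = m then cnj (c' m) * (c m * phase t m) else 0)"
      unfolding hermite_fun_orthonormal by auto
  qed
  also have "\<dots> = (\<Sum>n\<le>N'. cnj (c' n) * (c n * phase t n))" by simp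
  finally show ?thesis .
qed

section \<open>Amplitudes\<close>

lemma mvec_divide: "mvec N A (\<lambda>j. v j / c) j = mvec N A v j / c"
  by (simp add: mvec_def sum_divide_distrib)

lemma herm_state_d_eq: "herm_state_d N N' c = (\<lambda>j. comb N N' c j / complex_of_real (vnorm N (comb N N' c)))"
  by (simp add: herm_state_d_def comb_def[abs_def] Let_def fun_eq_iff)

lemma amp_d_eq: "amp_d N t v' v = (\<Sum>j\<in>idx N. cnj (v' j) * mvec N (Ud N t) v j)"
  by (simp add: amp_d_def mvec_def sum_distrib_left mult.assoc)

lemma norm_le_1_of_sum_sq:
  fixes c :: "nat \<Rightarrow> complex"
  assumes "(\<Sum>n\<le>N'. (cmod (c n))\<^sup>2) = 1" "n \<le> N'"
  shows "norm (c n) \<le> 1"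
proof -
  have "(cmod (c n))\<^sup>2 \<le> (\<Sum>n\<le>N'. (cmod (c n))\<^sup>2)"
    using assms(2) by (intro member_le_sum[where f = "\<lambda>n. (cmod (c n))\<^sup>2"]) auto
  then show ?thesis using assms(1) by (intro power2_le_imp_le[of "norm (c n)" 1]) auto
qed

text \<open>|a^2 - 1| = |a - 1| (a + 1) and a + 1 >= 1. The bounds 1/2 and 3/2 are what division by,
  and multiplication with, the norms of the discrete states require.\<close>

lemma abs_sqrt_near_1:
  fixes a k :: real
  assumes "0 \<le> a" "\<bar>a\<^sup>2 - 1\<bar> \<le> k" "k \<le> 1/2"
  shows "\<bar>a - 1\<bar> \<le> k" "1/2 \<le> a" "a \<le> 3/2"
proof -
  have "\<bar>a - 1\<bar> * 1 \<le> \<bar>a - 1\<bar> * \<bar>a + 1\<bar>" using assms by (intro mult_left_mono) auto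
  also have "\<dots> = \<bar>a\<^sup>2 - 1\<bar>" unfolding abs_mult[symmetric] by (simp add: power2_eq_square algebra_simps)
  finally show "\<bar>a - 1\<bar> \<le> k" using assms by simp
  then show "1/2 \<le> a" "a \<le> 3/2" using assms by linarith+
qed

context
  fixes N N' :: nat and t E :: real
  assumes N: "even N" "2 \<le> N" and NN': "N' + 3 \<le> N"
  defines "E \<equiv> real N ^ 10 * 64 ^ (N' + 3) * exp (- (3 * real N / 16))"
  assumes small: "624 * E \<le> 1/2"
begin

text \<open>The bound of \<open>Fc_herm_d\<close> at the highest level in use.\<close>

definition "Fc_error = 24 * 4 ^ (N' + 3) * exp (- (3 * real N / 16))"

lemma Fc_approx_Fc_error:
  assumes "n \<le> N' + 3" "j \<in> idx N"
  shows "norm (mvec N (Fc N) (herm_d N n) j - \<i> ^ n * herm_d N n j) \<le> Fc_error"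
proof -
  have "(4::real) ^ n \<le> 4 ^ (N' + 3)" using assms by (intro power_increasing) auto
  then have "24 * 4 ^ n * exp (- (3 * real N / 16)) \<le> Fc_error"
    unfolding Fc_error_def by (intro mult_right_mono mult_left_mono) auto
  then show ?thesis using Fc_herm_d[OF N assms(2), of n] by linarith
qed

lemma gram_00_approx: "\<bar>gram N 0 0 - 1\<bar> \<le> 48 * exp (- (3 * real N / 16))"
  using sum_herm_dr_0_sq[OF N] by (simp add: gram_def)

text \<open>One factor 4^(N'+3) sits in \<open>Fc_error\<close>, the other in the orthogonality
  bound; together they give base 16. The constant 624 is 24 * 24 + 48.\<close>

lemma gram_error_bound:
  "real N ^ 2 * (24 * real N ^ 7 * 4 ^ (N' + 3) * Fc_error + 48 * exp (- (3 * real N / 16)))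
    \<le> 624 * (real N ^ 9 * 16 ^ (N' + 3) * exp (- (3 * real N / 16)))"
proof -
  let ?e = "exp (- (3 * real N / 16))"
  have "(4::real) ^ (N' + 3) * 4 ^ (N' + 3) = (4 * 4) ^ (N' + 3)" by (rule power_mult_distrib[symmetric])
  then have 4: "(4::real) ^ (N' + 3) * 4 ^ (N' + 3) = 16 ^ (N' + 3)" by simp
  have "real N ^ 2 * (24 * real N ^ 7 * 4 ^ (N' + 3) * Fc_error) = 576 * (real N ^ 2 * real N ^ 7) * (4 ^ (N' + 3) * 4 ^ (N' + 3)) * ?e"
    by (simp only: Fc_error_def)
  also have "\<dots> = 576 * (real N ^ 9 * 16 ^ (N' + 3) * ?e)" unfolding 4 by (simp flip: power_add)
  finally have 1: "real N ^ 2 * (24 * real N ^ 7 * 4 ^ (N' + 3) * Fc_error) = 576 * (real N ^ 9 * 16 ^ (N' + 3) * ?e)" .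
  have "real N ^ 2 * 1 \<le> real N ^ 9 * 16 ^ (N' + 3)"
    using N by (intro mult_mono power_increasing one_le_power) auto
  then have "real N ^ 2 * 1 * ?e \<le> real N ^ 9 * 16 ^ (N' + 3) * ?e" by (intro mult_right_mono) auto
  then have 2: "real N ^ 2 * (48 * ?e) \<le> 48 * (real N ^ 9 * 16 ^ (N' + 3) * ?e)" by simp
  show ?thesis using 1 2 unfolding distrib_left by linarith
qed

definition "gram_error = 624 * (real N ^ 9 * 16 ^ (N' + 3) * exp (- (3 * real N / 16)))"

lemma gram_error_nonneg: "gram_error \<ge> 0" by (simp add: gram_error_def)

text \<open>The extra factor is, up to 2, the entry bound of \<open>norm_comb_le\<close>, by which
  the normalisation error is multiplied in the position amplitude. It raises N^9 and 16 to the N^10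
  and 64 in \<open>E\<close>.\<close>

lemma N_mult_gram_error_le: "real N * gram_error * 4 ^ (N' + 3) \<le> 624 * E"
proof -
  have "(16::real) ^ (N' + 3) * 4 ^ (N' + 3) = (16 * 4) ^ (N' + 3)" by (rule power_mult_distrib[symmetric])
  then have 64: "(16::real) ^ (N' + 3) * 4 ^ (N' + 3) = 64 ^ (N' + 3)" by simp
  have "real N * gram_error * 4 ^ (N' + 3) = 624 * (real N * real N ^ 9) * (16 ^ (N' + 3) * 4 ^ (N' + 3)) * exp (- (3 * real N / 16))"
    by (simp only: gram_error_def mult_ac)
  also have "\<dots> = 624 * E" unfolding 64 E_def by (simp flip: power_Suc)
  finally show ?thesis by simp
qed

lemma N_mult_gram_error_le': "real N * gram_error \<le> 624 * E"
proof -
  have "real N * gram_error * 1 \<le> real N * gram_error * 4 ^ (N' + 3)"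
    using gram_error_nonneg by (intro mult_left_mono one_le_power) auto
  then show ?thesis using N_mult_gram_error_le by linarith
qed

lemma gram_error_le_half: "gram_error \<le> 1/2"
proof -
  have "1 * gram_error \<le> real N * gram_error" using N gram_error_nonneg by (intro mult_right_mono) auto
  then show ?thesis using N_mult_gram_error_le' small by linarith
qed

lemma comb_inner:
  assumes "\<And>n. n \<le> N' \<Longrightarrow> norm (c n) \<le> 1" "\<And>n. n \<le> N' \<Longrightarrow> norm (c' n) \<le> 1"
  shows "norm ((\<Sum>j\<in>idx N. cnj (comb N N' c' j) * comb N N' c j) - (\<Sum>n\<le>N'. cnj (c' n) * c n)) \<le> gram_error"
proof (rule order.trans)
  show "norm ((\<Sum>j\<in>idx N. cnj (comb N N' c' j) * comb N N' c j) - (\<Sum>n\<le>N'. cnj (c' n) * c n))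
      \<le> real N ^ 2 * (24 * real N ^ 7 * 4 ^ (N' + 3) * Fc_error + 48 * exp (- (3 * real N / 16)))"
    by (rule comb_inner_approx[OF N NN' Fc_approx_Fc_error gram_00_approx order_refl]) (use assms in auto)
qed (unfold gram_error_def, rule gram_error_bound)

lemma vnorm_comb:
  assumes "(\<Sum>n\<le>N'. (cmod (c n))\<^sup>2) = 1"
  shows "\<bar>(vnorm N (comb N N' c))\<^sup>2 - 1\<bar> \<le> gram_error"
proof -
  have "(\<Sum>n\<le>N'. cnj (c n) * c n) = complex_of_real (\<Sum>n\<le>N'. (cmod (c n))\<^sup>2)"
    unfolding of_real_sum by (intro sum.cong refl) (metis complex_norm_square mult.commute)
  then have "(\<Sum>n\<le>N'. cnj (c n) * c n) = 1" using assms by simp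
  moreover have "norm ((\<Sum>j\<in>idx N. cnj (comb N N' c j) * comb N N' c j) - (\<Sum>n\<le>N'. cnj (c n) * c n)) \<le> gram_error"
    by (rule comb_inner) (rule norm_le_1_of_sum_sq[OF assms], assumption)+
  ultimately have "norm (complex_of_real ((vnorm N (comb N N' c))\<^sup>2 - 1)) \<le> gram_error"
    unfolding of_real_diff vnorm_sq_complex by simp
  then show ?thesis by (simp only: norm_of_real)
qed

lemma evolution:
  assumes "\<And>n. n \<le> N' \<Longrightarrow> norm (c n) \<le> 1"
  shows "vnorm N (\<lambda>j. mvec N (Ud N t) (comb N N' c) j - comb N N' (\<lambda>n. c n * phase t n) j) \<le> \<bar>t\<bar> * (48 * E)"
proof -
  have "2 * real N ^ 7 * Fc_error \<le> 48 * E"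
  proof -
    have "real N ^ 7 * 4 ^ (N' + 3) \<le> real N ^ 10 * 64 ^ (N' + 3)"
      using N by (intro mult_mono power_increasing power_mono) auto
    then have "real N ^ 7 * 4 ^ (N' + 3) * exp (- (3 * real N / 16)) \<le> E"
      unfolding E_def by (intro mult_right_mono) auto
    then show ?thesis by (simp add: Fc_error_def mult_ac)
  qed
  then have "\<bar>t\<bar> * (2 * real N ^ 7 * Fc_error) \<le> \<bar>t\<bar> * (48 * E)" by (intro mult_left_mono) auto
  moreover have "vnorm N (\<lambda>j. mvec N (Ud N t) (comb N N' c) j - comb N N' (\<lambda>n. c n * phase t n) j) \<le> \<bar>t\<bar> * (2 * real N ^ 7 * Fc_error)"
    by (rule evolution_approx[OF N NN' Fc_approx_Fc_error gram_00_approx order_refl]) (use assms in auto)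
  ultimately show ?thesis by linarith
qed

lemma norm_comb_le:
  assumes "\<And>n. n \<le> N' \<Longrightarrow> norm (c n) \<le> 1"
  shows "norm (comb N N' c j) \<le> real N * (2 * 4 ^ (N' + 3))"
proof -
  have "norm (comb N N' c j) \<le> (\<Sum>n\<le>N'. 1 * (2 * 4 ^ (N' + 3)))"
    unfolding comb_def
  proof (intro order.trans[OF norm_sum] sum_mono)
    fix n assume n: "n \<in> {..N'}"
    show "norm (c n * herm_d N n j) \<le> 1 * (2 * 4 ^ (N' + 3))"
      unfolding norm_mult using n
      by (intro mult_mono assms norm_herm_d_le[OF N NN' Fc_approx_Fc_error gram_00_approx]) auto
  qed
  also have "\<dots> = real (Suc N') * (2 * 4 ^ (N' + 3))" by simp
  also have "\<dots> \<le> real N * (2 * 4 ^ (N' + 3))" using NN' by (intro mult_right_mono) auto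
  finally show ?thesis .
qed

text \<open>Three errors meet: the Gram matrix against the identity, the evolution against the
  diagonal phases, and the product of the two norms against 1.\<close>

lemma amplitude_hermite:
  assumes c: "(\<Sum>n\<le>N'. (cmod (c n))\<^sup>2) = 1" and c': "(\<Sum>n\<le>N'. (cmod (c' n))\<^sup>2) = 1"
  shows "norm (amp_d N t (herm_state_d N N' c') (herm_state_d N N' c)
            - L2_inner (herm_state N' c') (evolved_state t N' c)) \<le> (8000 + 300 * \<bar>t\<bar>) * E"
proof -
  define a where "a = vnorm N (comb N N' c)"
  define a' where "a' = vnorm N (comb N N' c')"
  define Y where "Y = L2_inner (herm_state N' c') (evolved_state t N' c)"
  define w where "w = mvec N (Ud N t) (comb N N' c)"
  define b where "b = comb N N' (\<lambda>n. c n * phase t n)"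
  define Z where "Z = (\<Sum>j\<in>idx N. cnj (comb N N' c' j) * w j)"
  note a = abs_sqrt_near_1[OF vnorm_nonneg vnorm_comb[OF c] gram_error_le_half, folded a_def]
  note a' = abs_sqrt_near_1[OF vnorm_nonneg vnorm_comb[OF c'] gram_error_le_half, folded a'_def]
  have E0: "E \<ge> 0" by (simp add: E_def)
  have bd: "norm (c n) \<le> 1" "norm (c' n) \<le> 1" if "n \<le> N'" for n
    using norm_le_1_of_sum_sq[OF c that] norm_le_1_of_sum_sq[OF c' that] .
  have Y: "Y = (\<Sum>n\<le>N'. cnj (c' n) * (c n * phase t n))" unfolding Y_def by (rule L2_inner_herm_state)
  \<comment> \<open>A crude bound by the number of terms; the factor N is already provided for in
    \<open>N_mult_gram_error_le'\<close>.\<close>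
  have normY: "norm Y \<le> real N"
  proof -
    have "norm Y \<le> (\<Sum>n\<le>N'. 1 * (1 * 1))"
      unfolding Y using bd by (intro order.trans[OF norm_sum] sum_mono) (auto simp: norm_mult intro!: mult_le_one)
    also have "\<dots> \<le> real N" using NN' by simp
    finally show ?thesis .
  qed
  have Z: "Z = (\<Sum>j\<in>idx N. cnj (comb N N' c' j) * b j) + (\<Sum>j\<in>idx N. cnj (comb N N' c' j) * (w j - b j))"
    unfolding Z_def sum.distrib[symmetric] by (intro sum.cong) (auto simp: algebra_simps)
  have 1: "norm ((\<Sum>j\<in>idx N. cnj (comb N N' c' j) * b j) - Y) \<le> gram_error"
    unfolding Y b_def using bd by (intro comb_inner) (auto simp: norm_mult)
  have 2: "norm (\<Sum>j\<in>idx N. cnj (comb N N' c' j) * (w j - b j)) \<le> 3/2 * (\<bar>t\<bar> * (48 * E))"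
  proof (rule order.trans[OF norm_sum_cnj_le])
    have "vnorm N (\<lambda>j. w j - b j) \<le> \<bar>t\<bar> * (48 * E)" unfolding w_def b_def by (rule evolution) (rule bd)
    then show "vnorm N (comb N N' c') * vnorm N (\<lambda>j. w j - b j) \<le> 3/2 * (\<bar>t\<bar> * (48 * E))"
      using a'(3) unfolding a'_def by (intro mult_mono) auto
  qed
  have ZY: "norm (Z - Y) \<le> gram_error + 72 * (\<bar>t\<bar> * E)"
    using norm_triangle_ineq[of "(\<Sum>j\<in>idx N. cnj (comb N N' c' j) * b j) - Y" "\<Sum>j\<in>idx N. cnj (comb N N' c' j) * (w j - b j)"] 1 2
    unfolding Z by (simp add: algebra_simps)
  have aa: "1/4 \<le> a * a'" using mult_mono[of "1/2" a "1/2" a'] a(2) a'(2) by simp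
  have aa1: "\<bar>1 - a * a'\<bar> \<le> 5/2 * gram_error"
  proof -
    have "1 - a * a' = (1 - a) * a' + (1 - a')" by (simp add: algebra_simps)
    also have "\<bar>\<dots>\<bar> \<le> \<bar>a - 1\<bar> * a' + \<bar>a' - 1\<bar>"
      using a'(2) by (intro order.trans[OF abs_triangle_ineq]) (simp add: abs_mult abs_minus_commute)
    also have "\<dots> \<le> gram_error * (3/2) + gram_error" using a a' by (intro add_mono mult_mono) auto
    finally show ?thesis by simp
  qed
  have "amp_d N t (herm_state_d N N' c') (herm_state_d N N' c) = Z / complex_of_real (a * a')"
    unfolding amp_d_eq herm_state_d_eq mvec_divide Z_def w_def a_def a'_def
    by (simp add: sum_divide_distrib field_simps)
  then have "amp_d N t (herm_state_d N N' c') (herm_state_d N N' c) - Y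
      = (Z - Y) / complex_of_real (a * a') + Y * complex_of_real ((1 - a * a') / (a * a'))"
    using aa a(2) a'(2) by (simp add: field_simps)
  also have "norm \<dots> \<le> (gram_error + 72 * (\<bar>t\<bar> * E)) / (1/4) + real N * ((5/2 * gram_error) / (1/4))"
  proof (intro order.trans[OF norm_triangle_ineq] add_mono)
    show "norm ((Z - Y) / complex_of_real (a * a')) \<le> (gram_error + 72 * (\<bar>t\<bar> * E)) / (1/4)"
      unfolding norm_divide norm_of_real using ZY aa E0 gram_error_nonneg by (intro frac_le) auto
    show "norm (Y * complex_of_real ((1 - a * a') / (a * a'))) \<le> real N * ((5/2 * gram_error) / (1/4))"
      unfolding norm_mult norm_of_real abs_divide using normY aa aa1 gram_error_nonneg
      by (intro mult_mono frac_le) auto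
  qed
  also have "\<dots> = 4 * gram_error + 288 * (\<bar>t\<bar> * E) + 10 * (real N * gram_error)" by simp
  also have "\<dots> \<le> 12 * (real N * gram_error) + 288 * (\<bar>t\<bar> * E)"
    using mult_right_mono[OF _ gram_error_nonneg, of 2 "real N"] N by simp
  also have "\<dots> \<le> 12 * (624 * E) + 288 * (\<bar>t\<bar> * E)" using N_mult_gram_error_le' by linarith
  \<comment> \<open>Here 12 * 624 = 7488 and 288 are rounded up.\<close>
  also have "\<dots> \<le> (8000 + 300 * \<bar>t\<bar>) * E"
    using E0 mult_nonneg_nonneg[OF abs_ge_zero[of t] E0] by (simp add: algebra_simps)
  finally show ?thesis unfolding Y_def .
qed

text \<open>The weight in the target is the one in \<open>herm_d\<close>, so the target is exactly
  the j-th entry of the diagonally evolved combination. What remains is the evolution error in one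
  entry and the normalisation.\<close>

lemma amplitude_position:
  assumes c: "(\<Sum>n\<le>N'. (cmod (c n))\<^sup>2) = 1" and j: "j \<in> idx N"
  shows "norm (amp_d N t (basis_d j) (herm_state_d N N' c)
            - complex_of_real ((2 * pi / real N) powr (1/4)) * evolved_state t N' c (grid N j))
          \<le> (8000 + 300 * \<bar>t\<bar>) * E"
proof -
  define a where "a = vnorm N (comb N N' c)"
  define w where "w = mvec N (Ud N t) (comb N N' c)"
  define b where "b = comb N N' (\<lambda>n. c n * phase t n)"
  note a = abs_sqrt_near_1[OF vnorm_nonneg vnorm_comb[OF c] gram_error_le_half, folded a_def]
  have E0: "E \<ge> 0" by (simp add: E_def)
  have bd: "norm (c n) \<le> 1" if "n \<le> N'" for n using norm_le_1_of_sum_sq[OF c that] .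
  have amp: "amp_d N t (basis_d j) (herm_state_d N N' c) = w j / complex_of_real a"
  proof -
    have "amp_d N t (basis_d j) (herm_state_d N N' c) = (\<Sum>k\<in>idx N. if k = j then w j / complex_of_real a else 0)"
      unfolding amp_d_eq herm_state_d_eq mvec_divide w_def a_def basis_d_def by (intro sum.cong) auto
    then show ?thesis using j by simp
  qed
  have target: "complex_of_real ((2 * pi / real N) powr (1/4)) * evolved_state t N' c (grid N j) = b j"
    unfolding evolved_state_def b_def comb_def phase_def herm_d_def by (simp add: sum_distrib_left mult_ac)
  have wb: "norm (w j - b j) \<le> \<bar>t\<bar> * (48 * E)"
  proof -
    have "vnorm N (\<lambda>j. w j - b j) \<le> \<bar>t\<bar> * (48 * E)" unfolding w_def b_def by (rule evolution) (rule bd)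
    then show ?thesis using norm_le_vnorm[OF j, of "\<lambda>j. w j - b j"] by simp
  qed
  have b: "norm (b j) \<le> real N * (2 * 4 ^ (N' + 3))"
    unfolding b_def using bd by (intro norm_comb_le) (auto simp: norm_mult)
  have "w j / complex_of_real a - b j = (w j - b j) / complex_of_real a + b j * complex_of_real ((1 - a) / a)"
    using a(2) by (simp add: field_simps)
  also have "norm \<dots> \<le> (\<bar>t\<bar> * (48 * E)) / (1/2) + (real N * (2 * 4 ^ (N' + 3))) * (gram_error / (1/2))"
  proof (intro order.trans[OF norm_triangle_ineq] add_mono)
    show "norm ((w j - b j) / complex_of_real a) \<le> (\<bar>t\<bar> * (48 * E)) / (1/2)"
      unfolding norm_divide norm_of_real using wb a(2) E0 by (intro frac_le) auto
    show "norm (b j * complex_of_real ((1 - a) / a)) \<le> (real N * (2 * 4 ^ (N' + 3))) * (gram_error / (1/2))"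
      unfolding norm_mult norm_of_real abs_divide using b a gram_error_nonneg
      by (intro mult_mono frac_le) auto
  qed
  also have "\<dots> = 96 * (\<bar>t\<bar> * E) + 4 * (real N * gram_error * 4 ^ (N' + 3))" by simp
  also have "\<dots> \<le> 96 * (\<bar>t\<bar> * E) + 4 * (624 * E)" using N_mult_gram_error_le by linarith
  also have "\<dots> \<le> (8000 + 300 * \<bar>t\<bar>) * E"
    using E0 mult_nonneg_nonneg[OF abs_ge_zero[of t] E0] by (simp add: algebra_simps)
  finally show ?thesis unfolding amp target .
qed

end

text \<open>With x = N/16 the decay is exp (- 3x). One factor exp x pays for N^10 through x^10 <=
  10! exp x, one pays for 64^N' = 2^(6 N') <= exp (6 N'), and the last leaves exp (- x) <= epsilon.
  The number 96 = 16 * 6 makes x equal to 6 (M + N').\<close>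

lemma grid_size_error_bound:
  fixes \<epsilon> :: real
  assumes eps: "0 < \<epsilon>" and M: "ln (1 / \<epsilon>) \<le> real M" and N: "N = 96 * (M + N')"
  shows "real N ^ 10 * 64 ^ (N' + 3) * exp (- (3 * real N / 16)) \<le> fact 10 * 16 ^ 10 * 64 ^ 3 * \<epsilon>"
proof -
  define x where "x = real N / 16"
  have x: "x = 6 * (real M + real N')" by (simp add: x_def N)
  have "real N ^ 10 = 16 ^ 10 * x ^ 10" unfolding power_mult_distrib[symmetric] by (simp add: x_def)
  also have "x ^ 10 \<le> fact 10 * exp x"
    using power_div_fact_le_exp[of x 10] by (simp add: x_def field_simps)
  finally have 1: "real N ^ 10 \<le> 16 ^ 10 * (fact 10 * exp x)" by simp
  have "(64::real) ^ N' = ((2 ^ 6) ^ N')" by simp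
  also have "\<dots> \<le> (exp 1 ^ 6) ^ N'"
    using exp_ge_add_one_self[of "1::real"] by (intro power_mono) auto
  also have "\<dots> = exp (6 * real N')" by (simp only: power_mult[symmetric] exp_of_nat_mult[symmetric]) simp
  also have "\<dots> \<le> exp x" by (simp add: x)
  finally have 2: "(64::real) ^ (N' + 3) \<le> 64 ^ 3 * exp x" by (simp add: power_add)
  have "exp (- x) \<le> exp (- ln (1 / \<epsilon>))"
  proof -
    have "real M \<le> x" by (simp add: x)
    then show ?thesis using M by simp
  qed
  also have "\<dots> = \<epsilon>" using eps by (simp add: exp_minus)
  finally have 3: "exp (- x) \<le> \<epsilon>" .
  have "real N ^ 10 * 64 ^ (N' + 3) * exp (- (3 * real N / 16))
      \<le> (16 ^ 10 * (fact 10 * exp x)) * (64 ^ 3 * exp x) * exp (- (3 * x))"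
    using 1 2 by (intro mult_mono) (auto simp: x_def)
  also have "\<dots> = fact 10 * 16 ^ 10 * 64 ^ 3 * (exp x * exp x * exp (- (3 * x)))" by (simp only: mult_ac)
  also have "exp x * exp x * exp (- (3 * x)) = exp (- x)" by (simp flip: exp_add)
  also have "fact 10 * 16 ^ 10 * 64 ^ 3 * exp (- x) \<le> fact 10 * 16 ^ 10 * 64 ^ 3 * \<epsilon>"
    by (intro mult_left_mono 3) auto
  finally show ?thesis .
qed

theorem theorem1:
  fixes T0 :: real
  assumes "T0 > 1"
  shows "\<exists>C>0. \<exists>\<epsilon>0>0. \<forall>\<epsilon> N' (c :: nat \<Rightarrow> complex) (t :: real).
     0 < \<epsilon> \<and> \<epsilon> < \<epsilon>0 \<and> 1 < \<bar>t\<bar> \<and> \<bar>t\<bar> \<le> T0 \<and> (\<Sum>n\<le>N'. (cmod (c n))^2) = 1 \<longrightarrow>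
       (\<forall>c' :: nat \<Rightarrow> complex. (\<Sum>n\<le>N'. (cmod (c' n))^2) = 1 \<longrightarrow>
          (\<exists>N::nat. even N \<and> 2 \<le> N \<and> real N \<le> C * (ln (1 / \<epsilon>) + real N') \<and>
             cmod (amp_d N t (herm_state_d N N' c') (herm_state_d N N' c)
                   - L2_inner (herm_state N' c') (evolved_state t N' c)) \<le> C * \<epsilon>))
     \<and> (\<exists>N::nat. even N \<and> 2 \<le> N \<and> real N \<le> C * (ln (1 / \<epsilon>) + real N') \<and>
          (\<forall>j\<in>idx N.
             cmod (amp_d N t (basis_d j) (herm_state_d N N' c)
                   - complex_of_real ((2 * pi / real N) powr (1/4)) * evolved_state t N' c (grid N j))
             \<le> C * \<epsilon>))"
proof -
  define C1 :: real where "C1 = fact 10 * 16 ^ 10 * 64 ^ 3"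
  \<comment> \<open>The summand 192 serves the size of N, the other one the error.\<close>
  define C where "C = 192 + (8000 + 300 * T0) * C1"
  \<comment> \<open>1248 = 2 * 624, so that C1 times epsilon meets the smallness condition
    \<open>624 * E \<le> 1/2\<close>.\<close>
  define \<epsilon>0 where "\<epsilon>0 = 1 / (1248 * C1)"
  have C1: "C1 \<ge> 1"
    unfolding C1_def by (intro mult_ge1_I fact_ge_1 one_le_power) auto
  have "(8000 + 300 * T0) * C1 \<ge> 0" using assms C1 by simp
  then have C: "C \<ge> 192" "(8000 + 300 * T0) * C1 \<le> C" by (simp_all add: C_def)
  \<comment> \<open>N is chosen from epsilon and \<open>N'\<close> alone, so a single grid serves
    all target states at once.\<close>
  have main: "\<exists>N. even N \<and> 2 \<le> N \<and> real N \<le> C * (ln (1 / \<epsilon>) + real N') \<and>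
      (\<forall>c'. (\<Sum>n\<le>N'. (cmod (c' n))^2) = 1 \<longrightarrow> cmod (amp_d N t (herm_state_d N N' c') (herm_state_d N N' c)
                   - L2_inner (herm_state N' c') (evolved_state t N' c)) \<le> C * \<epsilon>) \<and>
      (\<forall>j\<in>idx N. cmod (amp_d N t (basis_d j) (herm_state_d N N' c)
                   - complex_of_real ((2 * pi / real N) powr (1/4)) * evolved_state t N' c (grid N j)) \<le> C * \<epsilon>)"
    if eps: "0 < \<epsilon>" "\<epsilon> < \<epsilon>0" and t: "\<bar>t\<bar> \<le> T0" and c: "(\<Sum>n\<le>N'. (cmod (c n))^2) = 1"
    for \<epsilon> N' t and c :: "nat \<Rightarrow> complex"
  proof -
    define M where "M = nat \<lceil>ln (1 / \<epsilon>)\<rceil>"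
    define N where "N = 96 * (M + N')"
    define E where "E = real N ^ 10 * 64 ^ (N' + 3) * exp (- (3 * real N / 16))"
    \<comment> \<open>This absorbs the rounding in M, doubling 96 to 192, and gives M >= 1, which
      makes room for the three extra levels.\<close>
    have ln1: "1 \<le> ln (1 / \<epsilon>)"
    proof -
      have "\<epsilon> * 3 \<le> 1"
      proof -
        have "\<epsilon> * (1248 * C1) < 1" using eps C1 by (simp add: \<epsilon>0_def field_simps)
        moreover have "\<epsilon> * 3 \<le> \<epsilon> * (1248 * C1)" using eps C1 by (intro mult_left_mono) auto
        ultimately show ?thesis by linarith
      qed
      moreover have "\<epsilon> * exp 1 \<le> \<epsilon> * 3" using exp_le eps by (intro mult_left_mono) auto
      ultimately have "\<epsilon> * exp 1 \<le> 1" by linarith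
      then have "exp 1 \<le> 1 / \<epsilon>" using eps by (simp add: field_simps)
      then show ?thesis using eps by (simp add: ln_ge_iff)
    qed
    have M: "ln (1 / \<epsilon>) \<le> real M" "real M \<le> ln (1 / \<epsilon>) + 1" "1 \<le> M"
      using ln1 by (auto simp: M_def) linarith+
    have N: "even N" "2 \<le> N" "N' + 3 \<le> N" using M(3) by (auto simp: N_def)
    have E: "E \<le> C1 * \<epsilon>" unfolding E_def C1_def by (rule grid_size_error_bound[OF eps(1) M(1) N_def])
    have small: "624 * E \<le> 1/2"
    proof -
      have "C1 * \<epsilon> \<le> 1 / 1248" using eps C1 by (simp add: \<epsilon>0_def field_simps)
      then show ?thesis using E by linarith
    qed
    have bound: "(8000 + 300 * \<bar>t\<bar>) * E \<le> C * \<epsilon>"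
    proof -
      have "(8000 + 300 * \<bar>t\<bar>) * E \<le> (8000 + 300 * T0) * (C1 * \<epsilon>)"
        using t E by (intro mult_mono) (auto simp: E_def)
      also have "\<dots> \<le> C * \<epsilon>"
        using mult_right_mono[OF C(2), of \<epsilon>] eps by (simp only: mult.assoc)
      finally show ?thesis .
    qed
    have "real N = 96 * (real M + real N')" by (simp add: N_def)
    also have "\<dots> \<le> 192 * (ln (1 / \<epsilon>) + real N')" using M ln1 by simp
    also have "\<dots> \<le> C * (ln (1 / \<epsilon>) + real N')" using C ln1 by (intro mult_right_mono) auto
    finally have NC: "real N \<le> C * (ln (1 / \<epsilon>) + real N')" .
    show ?thesis
    proof (intro exI[of _ N] conjI allI impI ballI N NC)
      fix c' :: "nat \<Rightarrow> complex" assume c': "(\<Sum>n\<le>N'. (cmod (c' n))^2) = 1"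
      show "cmod (amp_d N t (herm_state_d N N' c') (herm_state_d N N' c)
            - L2_inner (herm_state N' c') (evolved_state t N' c)) \<le> C * \<epsilon>"
        using amplitude_hermite[OF N small[unfolded E_def] c c', of t] bound unfolding E_def by linarith
    next
      fix j assume j: "j \<in> idx N"
      show "cmod (amp_d N t (basis_d j) (herm_state_d N N' c)
            - complex_of_real ((2 * pi / real N) powr (1/4)) * evolved_state t N' c (grid N j)) \<le> C * \<epsilon>"
        using amplitude_position[OF N small[unfolded E_def] c j, of t] bound unfolding E_def by linarith
    qed
  qed
  have pos: "C > 0" "\<epsilon>0 > 0" using C C1 by (auto simp: \<epsilon>0_def)
  show ?thesis
  proof (rule exI[of _ C], rule conjI[OF pos(1)], rule exI[of _ \<epsilon>0], rule conjI[OF pos(2)], intro allI impI, elim conjE)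
    fix \<epsilon> N' t and c :: "nat \<Rightarrow> complex"
    assume "0 < \<epsilon>" "\<epsilon> < \<epsilon>0" "\<bar>t\<bar> \<le> T0" "(\<Sum>n\<le>N'. (cmod (c n))^2) = 1"
    from main[OF this] obtain N where N: "even N" "2 \<le> N" "real N \<le> C * (ln (1 / \<epsilon>) + real N')"
      and 1: "\<And>c'. (\<Sum>n\<le>N'. (cmod (c' n))^2) = 1 \<Longrightarrow> cmod (amp_d N t (herm_state_d N N' c') (herm_state_d N N' c)
                   - L2_inner (herm_state N' c') (evolved_state t N' c)) \<le> C * \<epsilon>"
      and 2: "\<forall>j\<in>idx N. cmod (amp_d N t (basis_d j) (herm_state_d N N' c)
                   - complex_of_real ((2 * pi / real N) powr (1/4)) * evolved_state t N' c (grid N j)) \<le> C * \<epsilon>"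
      by blast
    show "(\<forall>c' :: nat \<Rightarrow> complex. (\<Sum>n\<le>N'. (cmod (c' n))^2) = 1 \<longrightarrow>
          (\<exists>N::nat. even N \<and> 2 \<le> N \<and> real N \<le> C * (ln (1 / \<epsilon>) + real N') \<and>
             cmod (amp_d N t (herm_state_d N N' c') (herm_state_d N N' c)
                   - L2_inner (herm_state N' c') (evolved_state t N' c)) \<le> C * \<epsilon>))
     \<and> (\<exists>N::nat. even N \<and> 2 \<le> N \<and> real N \<le> C * (ln (1 / \<epsilon>) + real N') \<and>
          (\<forall>j\<in>idx N.
             cmod (amp_d N t (basis_d j) (herm_state_d N N' c)
                   - complex_of_real ((2 * pi / real N) powr (1/4)) * evolved_state t N' c (grid N j))
             \<le> C * \<epsilon>))"
    proof (intro conjI allI impI)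
      fix c' :: "nat \<Rightarrow> complex" assume "(\<Sum>n\<le>N'. (cmod (c' n))^2) = 1"
      from N 1[OF this] show "\<exists>N::nat. even N \<and> 2 \<le> N \<and> real N \<le> C * (ln (1 / \<epsilon>) + real N') \<and>
             cmod (amp_d N t (herm_state_d N N' c') (herm_state_d N N' c)
                   - L2_inner (herm_state N' c') (evolved_state t N' c)) \<le> C * \<epsilon>"
        by (intro exI[of _ N] conjI)
    qed (use N 2 in \<open>intro exI[of _ N] conjI\<close>)
  qed
qed

end
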